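(* As subalgebras of $\operatorname{End}(P)$ one has $$Y\subset e(\aleph)\,\mathcal Y\,e(\aleph),$$ where $Y$ is the truncated shifted iYangian (embedded in $\operatorname{End}(P)$ by $X\mapsto X\circ e_\Sigma$) and $\mathcal Y$ is the KLR iYangian. Moreover the elements $b_{i,r}$ ($r\ge0$) of $Y$ correspond to the following elements: for $i\in Q_0^{(+)}$, $$b_{i,r}=(-1)^{r+\epsilon_i}D_i\Big(y_{a_i}-\frac\hbar2\Big)^re_\Sigma,\qquad b_{\tau i,r}=-D_{\tau i}\Big(y_{N_i}+\frac\hbar2\Big)^re_\Sigma,$$ where $a_i=1+\sum_{j<i}v_j$, $N_i=\sum_{j\le i}v_j$ (sums over $j\in Q_0^{(+)}$) and $\epsilon_i=v_i+\sum_{j\to\tau i}v_j-\delta_{i\to\tau i}$.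
   Context: **Quiver.** $Q=(Q_0,Q_1,s,t)$ is a loop-free quiver with at most one arrow (both directions counted) between two distinct vertices; $\tau$ is an involution of $Q_0$ and $Q_1$ with $s(\tau h)=\tau(t(h))$, $t(\tau h)=\tau(s(h))$, with $\tau(s(h))=t(h)$ iff $\tau(h)=h$, and without fixed vertices. $i\to j$ means there is an arrow from $i$ to $j$; $\delta_{i\to\tau i}\in\{0,1\}$ accordingly; $c_{i,\tau i}=-1$ if $i,\tau i$ are joined by an arrow, else $0$. Fix a partition $Q_0=Q_0^{(+)}\sqcup Q_0^{(-)}$ with $\tau(Q_0^{(\pm)})=Q_0^{(\mp)}$, all arrows going from $Q_0^{(+)}$ to $Q_0^{(-)}$, and a total order on $Q_0^{(+)}$. **Data.** $\lambda=\sum\lambda_i\varpi_i$ is dominant ($\varpi_i$ fundamental weights), $\mu$ is a $\tau$-invariant weight with $\lambda+\tau\lambda-\mu=\sum v_i\alpha_i$ ($\alpha_i$ simple roots), $v_i=v_{\tau i}\ge0$; $\mathbf R=(\mathbf R_i)_{i\in Q_0}$ with $\mathbf R_i$ a collection of $\lambda_i$ complex numbers; $p_i(u)=\prod_{c\in\mathbf R_i}(u-c\hbar)$. **Truncated shifted iYangian $Y$.** $P=\mathbb C[\hbar][x_{i,k}:i\in Q_0^{(+)},1\le k\le v_i]$, $\Sigma=\prod_{i\in Q_0^{(+)}}S_{v_i}$ permuting the variables. $d_{i,k}$ is the automorphism $x_{i,k}\mapsto x_{i,k}+\hbar$ fixing the other variables; $x_{\tau i,k}=-x_{i,k}$, $d_{\tau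 i,k}=d_{i,k}^{-1}$ for $i\in Q_0^{(+)}$. $V_i(z)=\prod_k(z-x_{i,k})$, $V_{i,r}(z)=V_i(z)/(z-x_{i,r})$. For $i\in Q_0$ consider the series in $z^{-1}$ of operators preserving $P^\Sigma$ $$b_i(z)=\sum_{r=1}^{v_i}\frac{1}{-z-x_{i,r}-\frac\hbar2}\prod_{i\to\tau i}V_{\tau i,r}(x_{i,r}+\tfrac\hbar2)\prod_{j\ne\tau i,\,i\to j}V_j(x_{i,r}+\tfrac\hbar2)\frac{p_{\tau i}(x_{\tau i,r})}{V_{i,r}(x_{i,r})}d_{i,r},$$ $$h_i(z)=(-1)^{v_i-1+\delta_{i\to\tau i}}(2z)^{c_{i,\tau i}}\frac{p_i(-z)p_{\tau i}(z)}{V_i(-z+\frac\hbar2)V_i(-z-\frac\hbar2)}\prod_{i\to j}V_j(-z)\prod_{\tau i\to j}V_j(z)$$ (first product in $b_i$: present only if $i\to\tau i$). $b_{i,r}$ denotes the coefficient of $z^{-r-1}$ in $b_i(z)$. These series give the iGKLO action of the shifted iYangian on $P^\Sigma$, and $Y\subset\operatorname{End}(P^\Sigma)$ is the image of the shifted iYangian, i.e. the subalgebra generated by all coefficients of all $b_i(z),h_i(z)$. **Symmetrizer.** $\partial_{i,k}=\frac{s_{i,k}-1}{x_{i,k+1}-x_{i,k}}$ ($s_{i,k}$ swaps $x_{i,k},x_{i,k+1}$); $e_\Sigma=\prod_{i\in Q_0^{(+)}}\frac1{v_i!}\partial_{i,w_0}\prod_{k<l}(x_{i,k}-x_{i,l})$,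 the projection of $P$ onto $P^\Sigma$ ($\partial_{i,w_0}$: product of the $\partial_{i,k}$ along a reduced word of the longest element of $S_{v_i}$). **KLR iYangian $\mathcal Y$.** This is a diagrammatic algebra of black strands between two mirrors. It acts faithfully on $\mathrm{Pol}=\bigoplus_m\bigoplus_{\mathbf i\in Q_0^m}\mathbb C[\hbar][X_1(\mathbf i),\dots,X_m(\mathbf i)]$ and is identified with the algebra of operators generated by: $e(\mathbf i)$, the projection onto the $\mathbf i$-summand; $y_k$ (dot), multiplication by $X_k$; $\sigma_k$ ($1\le k<m$, crossing), acting on the $\mathbf i$-summand as $\frac{s_k-1}{X_{k+1}-X_k}$ if $i_k=i_{k+1}$ and as $s_k\circ\overline X_{i_k,i_{k+1}}(X_k,X_{k+1})$ otherwise; the left reflection $\rho_L=p_{\tau i_1}(X_1)s_0$; the right reflection $\rho_R=s_m$ (all taken with $e(\mathbf i)$ on the right). Here $\overline X_{ij}(u,v)=u-v-\frac\hbar2$ if $j\to i$, else $1$; $s_k$ exchanges $i_k,i_{k+1}$ in the word and $X_k,X_{k+1}$; $s_0$ maps the $(i_1,\dots)$-summand to the $(\tau i_1,i_2,\dots)$-summand with $X_1\mapsto-X_1+\hbar$; $s_m$ maps the $\mathbf i$-summand to the $(i_1,\dots,i_{m-1},\tau i_m)$-summand with $X_m\mapsto-X_m$; other variables are fixed. $\aleph$ is the word listing the vertices of $Q_0^{(+)}$ in increasing order, each $i$ repeated $v_i$ times; $m=\sum_{i\in Q_0^{(+)}}v_i$ is its length. The $\aleph$-summand of $\mathrm{Pol}$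 is identified with $P$ via $X_{a_i+k-1}=x_{i,k}$, so $e(\aleph)\mathcal Ye(\aleph)\subset\operatorname{End}(P)$. For $i\in Q_0^{(+)}$ (rightmost factor acts first) $$D_i=\sigma_{a_i}\cdots\sigma_{m-1}\,\rho_R\,\sigma_{m-1}\cdots\sigma_1\,\rho_L\,\sigma_1\cdots\sigma_{a_i-1}\,e(\aleph),$$ $$D_{\tau i}=\sigma_{N_i-1}\cdots\sigma_1\,\rho_L\,\sigma_1\cdots\sigma_{m-1}\,\rho_R\,\sigma_{m-1}\cdots\sigma_{N_i}\,e(\aleph)$$ (the first $i$-strand goes to the left mirror, then to the right mirror, then back to its place; resp. the last $i$-strand goes to the right mirror, then to the left mirror, then back to its place).
   Formalization: The sign in the formula for b_{τi,r} is (-1)^{v_i} instead of -1 (the printed sign fails for even v_i, e.g. no arrows, p=1, v_i=2, r=0), and both formulas are stated for v_i>0, since D_i and D_{τi} need an i-strand. *)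

theory Defs
  imports
    "HOL-Library.Poly_Mapping"
    "HOL-Library.FuncSet"
    "HOL-Combinatorics.Permutations"
    "HOL-Computational_Algebra.Computational_Algebra"
    "Graph_Theory.Digraph"
begin

section \<open>Quivers with involution and the associated data\<close>

text \<open>
  The total order on \<open>Q\<^sub>0\<^sup>(\<^sup>+\<^sup>)\<close> is the restriction of the order of the vertex type, which is an
  arbitrary linear order.  \<open>Q\<^sub>0\<^sup>(\<^sup>-\<^sup>)\<close> is the complement of \<open>Qplus\<close> in the vertex set.  Weights are
  given by their coordinates with respect to the fundamental weights.
\<close>

record ('v, 'a) iyangian_data =
  quiver :: "('v, 'a) pre_digraph"
  tau :: "'v \<Rightarrow> 'v"
  tau_arc :: "'a \<Rightarrow> 'a"
  Qplus :: "'v set"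
  weight_lam :: "'v \<Rightarrow> nat"
  weight_mu :: "'v \<Rightarrow> int"
  vdim :: "'v \<Rightarrow> nat"
  params :: "'v \<Rightarrow> complex multiset"

abbreviation arrow :: "('v, 'a) iyangian_data \<Rightarrow> 'v \<Rightarrow> 'v \<Rightarrow> bool" where
  "arrow S i j \<equiv> i \<rightarrow>\<^bsub>quiver S\<^esub> j"

definition cartan :: "('v, 'a) iyangian_data \<Rightarrow> 'v \<Rightarrow> 'v \<Rightarrow> int" where
  "cartan S i j = (if i = j then 2 else if arrow S i j \<or> arrow S j i then -1 else 0)"

definition delta :: "('v, 'a) iyangian_data \<Rightarrow> 'v \<Rightarrow> int" where
  "delta S i = (if arrow S i (tau S i) then 1 else 0)"

locale iyangian_datum =
  fin_digraph "quiver S" + loopfree_digraph "quiver S"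
  for S :: "('v::linorder, 'a) iyangian_data" +
  assumes single_arrow:
      "\<lbrakk>h \<in> arcs (quiver S); h' \<in> arcs (quiver S);
        {tail (quiver S) h, head (quiver S) h} = {tail (quiver S) h', head (quiver S) h'}\<rbrakk>
       \<Longrightarrow> h = h'"
    and tau_vert: "i \<in> verts (quiver S) \<Longrightarrow> tau S i \<in> verts (quiver S)"
    and tau_tau: "i \<in> verts (quiver S) \<Longrightarrow> tau S (tau S i) = i"
    and tau_no_fix: "i \<in> verts (quiver S) \<Longrightarrow> tau S i \<noteq> i"
    and tau_arc: "h \<in> arcs (quiver S) \<Longrightarrow> tau_arc S h \<in> arcs (quiver S)"
    and tau_arc_tau_arc: "h \<in> arcs (quiver S) \<Longrightarrow> tau_arc S (tau_arc S h) = h"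
    and tail_tau_arc:
      "h \<in> arcs (quiver S) \<Longrightarrow> tail (quiver S) (tau_arc S h) = tau S (head (quiver S) h)"
    and head_tau_arc:
      "h \<in> arcs (quiver S) \<Longrightarrow> head (quiver S) (tau_arc S h) = tau S (tail (quiver S) h)"
    and tau_arc_fix:
      "h \<in> arcs (quiver S) \<Longrightarrow>
         tau S (tail (quiver S) h) = head (quiver S) h \<longleftrightarrow> tau_arc S h = h"
    and plus_verts: "Qplus S \<subseteq> verts (quiver S)"
    and tau_plus: "tau S ` Qplus S = verts (quiver S) - Qplus S"
    and tau_minus: "tau S ` (verts (quiver S) - Qplus S) = Qplus S"
    and arc_plus_minus:
      "h \<in> arcs (quiver S) \<Longrightarrow>
         tail (quiver S) h \<in> Qplus S \<and> head (quiver S) h \<in> verts (quiver S) - Qplus S"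
    and mu_tau: "i \<in> verts (quiver S) \<Longrightarrow> weight_mu S (tau S i) = weight_mu S i"
    and vdim_tau: "i \<in> verts (quiver S) \<Longrightarrow> vdim S (tau S i) = vdim S i"
    and weight_eq: \<comment> \<open>the coefficient of \<open>\<varpi>\<^sub>i\<close> in \<open>\<lambda> + \<tau>\<lambda> - \<mu> = \<Sum>\<^sub>j v\<^sub>j \<alpha>\<^sub>j\<close>\<close>
      "i \<in> verts (quiver S) \<Longrightarrow>
         int (weight_lam S i) + int (weight_lam S (tau S i)) - weight_mu S i
           = (\<Sum>j\<in>verts (quiver S). int (vdim S j) * cartan S i j)"
    and size_params: "i \<in> verts (quiver S) \<Longrightarrow> size (params S i) = weight_lam S i"


section \<open>Polynomials and operators\<close>

text \<open>
  \<open>\<complex>[\<hbar>][X\<^sub>1, X\<^sub>2, \<dots>]\<close>: the coefficient ring \<open>complex poly\<close> is \<open>\<complex>[\<hbar>]\<close>.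
\<close>

type_synonym pol = "(nat \<Rightarrow>\<^sub>0 nat) \<Rightarrow>\<^sub>0 complex poly"

definition Cst :: "complex poly \<Rightarrow> pol" where
  "Cst c = Poly_Mapping.single 0 c"

definition Var :: "nat \<Rightarrow> pol" where
  "Var n = Poly_Mapping.single (Poly_Mapping.single n 1) 1"

definition hbar :: pol where
  "hbar = Cst [:0, 1:]"

definition half_hbar :: pol where
  "half_hbar = Cst [:0, 1/2:]"

definition polys :: "nat \<Rightarrow> pol set" where
  "polys m = {f. \<forall>t\<in>Poly_Mapping.keys f. Poly_Mapping.keys t \<subseteq> {1..m}}"

text \<open>The \<open>\<complex>[\<hbar>]\<close>-algebra homomorphism with \<open>X\<^sub>n \<mapsto> g n\<close>.\<close>

definition subst :: "(nat \<Rightarrow> pol) \<Rightarrow> pol \<Rightarrow> pol" where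
  "subst g f = (\<Sum>t\<in>Poly_Mapping.keys f. Cst (Poly_Mapping.lookup f t) *
                 (\<Prod>n\<in>Poly_Mapping.keys t. g n ^ Poly_Mapping.lookup t n))"

definition swap_vars :: "nat \<Rightarrow> pol \<Rightarrow> pol" where
  "swap_vars k = subst (\<lambda>n. Var (transpose k (k + 1) n))"

definition exact_quot :: "pol \<Rightarrow> pol \<Rightarrow> pol" where
  "exact_quot f g = (THE q. q * g = f)"

definition demazure :: "nat \<Rightarrow> pol \<Rightarrow> pol" where
  "demazure k f = exact_quot (swap_vars k f - f) (Var (k + 1) - Var k)"

text \<open>Product of a word of operators; the rightmost factor acts first.\<close>

definition op_prod :: "('b \<Rightarrow> 'b) list \<Rightarrow> 'b \<Rightarrow> 'b" where
  "op_prod ops = foldr (\<circ>) ops id"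

text \<open>
  The (not necessarily unital) \<open>\<complex>[\<hbar>]\<close>-subalgebra of the endomorphisms of a module \<open>M\<close> generated by
  a set of operators; \<open>sc\<close> is the scalar action.  Endomorphisms of \<open>M\<close> are extensional functions
  on \<open>M\<close>.
\<close>

inductive_set gen_algebra ::
    "(complex poly \<Rightarrow> 'm \<Rightarrow> 'm) \<Rightarrow> 'm::ab_group_add set \<Rightarrow> ('m \<Rightarrow> 'm) set \<Rightarrow> ('m \<Rightarrow> 'm) set"
  for sc :: "complex poly \<Rightarrow> 'm::ab_group_add \<Rightarrow> 'm" and M :: "'m set" and G :: "('m \<Rightarrow> 'm) set"
where
  gen: "A \<in> G \<Longrightarrow> restrict A M \<in> gen_algebra sc M G"
| zero: "(\<lambda>f\<in>M. 0) \<in> gen_algebra sc M G"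
| add: "A \<in> gen_algebra sc M G \<Longrightarrow> B \<in> gen_algebra sc M G \<Longrightarrow>
          (\<lambda>f\<in>M. A f + B f) \<in> gen_algebra sc M G"
| scale: "A \<in> gen_algebra sc M G \<Longrightarrow> (\<lambda>f\<in>M. sc c (A f)) \<in> gen_algebra sc M G"
| mult: "A \<in> gen_algebra sc M G \<Longrightarrow> B \<in> gen_algebra sc M G \<Longrightarrow>
          (\<lambda>f\<in>M. A (B f)) \<in> gen_algebra sc M G"


section \<open>The truncated shifted iYangian\<close>

text \<open>
  \<open>pos_first S i\<close> and \<open>pos_last S i\<close> are \<open>a\<^sub>i\<close> and \<open>N\<^sub>i\<close>, for \<open>i \<in> Q\<^sub>0\<^sup>(\<^sup>+\<^sup>)\<close>.
\<close>

definition pos_first :: "('v::linorder, 'a) iyangian_data \<Rightarrow> 'v \<Rightarrow> nat" where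
  "pos_first S i = 1 + (\<Sum>j\<in>{j \<in> Qplus S. j < i}. vdim S j)"

definition pos_last :: "('v::linorder, 'a) iyangian_data \<Rightarrow> 'v \<Rightarrow> nat" where
  "pos_last S i = (\<Sum>j\<in>{j \<in> Qplus S. j \<le> i}. vdim S j)"

definition total_dim :: "('v::linorder, 'a) iyangian_data \<Rightarrow> nat" where
  "total_dim S = (\<Sum>j\<in>Qplus S. vdim S j)"

text \<open>
  \<open>P = \<complex>[\<hbar>][x\<^sub>i\<^sub>,\<^sub>k]\<close>, where \<open>x\<^sub>i\<^sub>,\<^sub>k\<close> for \<open>i \<in> Q\<^sub>0\<^sup>(\<^sup>+\<^sup>)\<close> is the variable with index \<open>a\<^sub>i + k - 1\<close>.
\<close>

definition P_space :: "('v::linorder, 'a) iyangian_data \<Rightarrow> pol set" where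
  "P_space S = polys (total_dim S)"

definition var_index :: "('v::linorder, 'a) iyangian_data \<Rightarrow> 'v \<Rightarrow> nat \<Rightarrow> nat" where
  "var_index S i k = pos_first S i + k - 1"

definition xvar :: "('v::linorder, 'a) iyangian_data \<Rightarrow> 'v \<Rightarrow> nat \<Rightarrow> pol" where
  "xvar S i k = (if i \<in> Qplus S then Var (var_index S i k) else - Var (var_index S (tau S i) k))"

definition shift_op :: "('v::linorder, 'a) iyangian_data \<Rightarrow> 'v \<Rightarrow> nat \<Rightarrow> pol \<Rightarrow> pol" where
  "shift_op S i k =
     (if i \<in> Qplus S
      then subst (Var(var_index S i k := Var (var_index S i k) + hbar))
      else subst (Var(var_index S (tau S i) k := Var (var_index S (tau S i) k) - hbar)))"

definition P_sym :: "('v::linorder, 'a) iyangian_data \<Rightarrow> pol set" where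
  "P_sym S = {f \<in> P_space S. \<forall>i\<in>Qplus S. \<forall>\<pi>. \<pi> permutes {pos_first S i..pos_last S i} \<longrightarrow>
                subst (\<lambda>n. Var (\<pi> n)) f = f}"

definition V_poly :: "('v::linorder, 'a) iyangian_data \<Rightarrow> 'v \<Rightarrow> pol poly" where
  "V_poly S i = (\<Prod>k\<in>{1..vdim S i}. [:- xvar S i k, 1:])"

definition V_omit :: "('v::linorder, 'a) iyangian_data \<Rightarrow> 'v \<Rightarrow> nat \<Rightarrow> pol poly" where
  "V_omit S i r = (\<Prod>k\<in>{1..vdim S i} - {r}. [:- xvar S i k, 1:])"

definition p_poly :: "('v::linorder, 'a) iyangian_data \<Rightarrow> 'v \<Rightarrow> pol poly" where
  "p_poly S i = (\<Prod>c\<in>#params S i. [:- Cst [:0, c:], 1:])"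

text \<open>
  Series in \<open>z\<^sup>-\<^sup>1\<close> over \<open>Frac P\<close> are formal Laurent series whose indeterminate \<open>fls_X\<close> is \<open>z\<^sup>-\<^sup>1\<close>;
  hence \<open>z\<close> is \<open>fls_X_inv\<close> and the coefficient of \<open>z\<^sup>-\<^sup>n\<close> is \<open>fls_nth _ n\<close>.
\<close>

type_synonym ser = "pol fract fls"

abbreviation z_ser :: ser where
  "z_ser \<equiv> fls_X_inv"

definition emb :: "pol \<Rightarrow> ser" where
  "emb f = fls_const (to_fract f)"

definition ev :: "pol poly \<Rightarrow> ser \<Rightarrow> ser" where
  "ev F u = poly (map_poly emb F) u"

definition b_series :: "('v::linorder, 'a) iyangian_data \<Rightarrow> 'v \<Rightarrow> pol \<Rightarrow> ser" where
  "b_series S i f =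
     (\<Sum>r\<in>{1..vdim S i}.
        1 / (- z_ser - emb (xvar S i r) - emb half_hbar) *
        emb (if arrow S i (tau S i) then poly (V_omit S (tau S i) r) (xvar S i r + half_hbar) else 1) *
        emb (\<Prod>j\<in>{j \<in> verts (quiver S). j \<noteq> tau S i \<and> arrow S i j}.
               poly (V_poly S j) (xvar S i r + half_hbar)) *
        (emb (poly (p_poly S (tau S i)) (xvar S (tau S i) r)) / emb (poly (V_omit S i r) (xvar S i r))) *
        emb (shift_op S i r f))"

definition h_series :: "('v::linorder, 'a) iyangian_data \<Rightarrow> 'v \<Rightarrow> ser" where
  "h_series S i =
     (-1) powi (int (vdim S i) - 1 + delta S i) *
     (2 * z_ser) powi cartan S i (tau S i) *
     (ev (p_poly S i) (- z_ser) * ev (p_poly S (tau S i)) z_ser /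
       (ev (V_poly S i) (- z_ser + emb half_hbar) * ev (V_poly S i) (- z_ser - emb half_hbar))) *
     (\<Prod>j\<in>{j \<in> verts (quiver S). arrow S i j}. ev (V_poly S j) (- z_ser)) *
     (\<Prod>j\<in>{j \<in> verts (quiver S). arrow S (tau S i) j}. ev (V_poly S j) z_ser)"

text \<open>
  The operator on \<open>P\<^sup>\<Sigma>\<close> given by the coefficient of \<open>z\<^sup>-\<^sup>n\<close> in a series of operators; the
  coefficients of the series used below are elements of the polynomial ring.
\<close>

definition coeff_op ::
    "('v::linorder, 'a) iyangian_data \<Rightarrow> (pol \<Rightarrow> ser) \<Rightarrow> int \<Rightarrow> pol \<Rightarrow> pol" where
  "coeff_op S B n = (\<lambda>f\<in>P_sym S. THE g. to_fract g = fls_nth (B f) n)"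

definition b_coeff :: "('v::linorder, 'a) iyangian_data \<Rightarrow> 'v \<Rightarrow> int \<Rightarrow> pol \<Rightarrow> pol" where
  "b_coeff S i n = coeff_op S (b_series S i) n"

definition h_coeff :: "('v::linorder, 'a) iyangian_data \<Rightarrow> 'v \<Rightarrow> int \<Rightarrow> pol \<Rightarrow> pol" where
  "h_coeff S i n = coeff_op S (\<lambda>f. h_series S i * emb f) n"

definition b_gen :: "('v::linorder, 'a) iyangian_data \<Rightarrow> 'v \<Rightarrow> nat \<Rightarrow> pol \<Rightarrow> pol" where
  "b_gen S i r = b_coeff S i (int r + 1)"

definition iYangian :: "('v::linorder, 'a) iyangian_data \<Rightarrow> (pol \<Rightarrow> pol) set" where
  "iYangian S = gen_algebra (\<lambda>c f. Cst c * f) (P_sym S)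
     ({id} \<union> {b_coeff S i n | i n. i \<in> verts (quiver S)}
           \<union> {h_coeff S i n | i n. i \<in> verts (quiver S)})"


section \<open>The symmetrizer\<close>

text \<open>The reduced word \<open>s\<^sub>1 (s\<^sub>2 s\<^sub>1) (s\<^sub>3 s\<^sub>2 s\<^sub>1) \<cdots>\<close> of the longest element of \<open>S\<^sub>n\<close>.\<close>

definition longest_word :: "nat \<Rightarrow> nat list" where
  "longest_word n = concat (map (\<lambda>l. rev [1..<l + 1]) [1..<n])"

definition e_block :: "('v::linorder, 'a) iyangian_data \<Rightarrow> 'v \<Rightarrow> pol \<Rightarrow> pol" where
  "e_block S i f =
     Cst [:1 / fact (vdim S i):] *
     op_prod (map (\<lambda>k. demazure (var_index S i k)) (longest_word (vdim S i)))
       ((\<Prod>(k, l)\<in>{(k, l). 1 \<le> k \<and> k < l \<and> l \<le> vdim S i}. xvar S i k - xvar S i l) * f)"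

definition e_Sigma :: "('v::linorder, 'a) iyangian_data \<Rightarrow> pol \<Rightarrow> pol" where
  "e_Sigma S = (\<lambda>f\<in>P_space S. op_prod (map (e_block S) (sorted_list_of_set (Qplus S))) f)"

text \<open>The embedding of \<open>End(P\<^sup>\<Sigma>)\<close> into \<open>End(P)\<close>.\<close>

definition extend_End :: "('v::linorder, 'a) iyangian_data \<Rightarrow> (pol \<Rightarrow> pol) \<Rightarrow> (pol \<Rightarrow> pol)" where
  "extend_End S A = (\<lambda>f\<in>P_space S. A (e_Sigma S f))"


section \<open>The KLR iYangian\<close>

text \<open>
  Elements of \<open>\<Oplus>\<^sub>m \<Oplus>\<^sub>i \<complex>[\<hbar>][X\<^sub>1, \<dots>, X\<^sub>m]\<close> are finitely supported functions on words.
\<close>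

type_synonym 'v polrep = "'v list \<Rightarrow>\<^sub>0 pol"

definition Pol :: "('v, 'a) iyangian_data \<Rightarrow> 'v polrep set" where
  "Pol S = {F. \<forall>w\<in>Poly_Mapping.keys F. w \<in> lists (verts (quiver S)) \<and>
                 Poly_Mapping.lookup F w \<in> polys (length w)}"

definition pol_scale :: "complex poly \<Rightarrow> 'v polrep \<Rightarrow> 'v polrep" where
  "pol_scale c F = Poly_Mapping.map (\<lambda>f. Cst c * f) F"

text \<open>The operator mapping the \<open>w\<close>-summand to the \<open>g w\<close>-summand by \<open>\<phi> w\<close>.\<close>

definition summandwise ::
    "('v list \<Rightarrow> 'v list) \<Rightarrow> ('v list \<Rightarrow> pol \<Rightarrow> pol) \<Rightarrow> 'v polrep \<Rightarrow> 'v polrep" where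
  "summandwise g \<phi> F =
     (\<Sum>w\<in>Poly_Mapping.keys F. Poly_Mapping.single (g w) (\<phi> w (Poly_Mapping.lookup F w)))"

definition idem :: "'v list \<Rightarrow> 'v polrep \<Rightarrow> 'v polrep" where
  "idem w F = Poly_Mapping.single w (Poly_Mapping.lookup F w)"

text \<open>
  Positions in words are counted from 1, so \<open>i\<^sub>k\<close> is \<open>w ! (k - 1)\<close>.  The operators below are zero
  on the summands on which they are not defined.
\<close>

definition dot :: "nat \<Rightarrow> 'v polrep \<Rightarrow> 'v polrep" where
  "dot k = summandwise (\<lambda>w. w) (\<lambda>w f. if 1 \<le> k \<and> k \<le> length w then Var k * f else 0)"

definition swap_word :: "nat \<Rightarrow> 'v list \<Rightarrow> 'v list" where
  "swap_word k w = w[k - 1 := w ! k, k := w ! (k - 1)]"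

definition Xbar :: "('v, 'a) iyangian_data \<Rightarrow> 'v \<Rightarrow> 'v \<Rightarrow> pol \<Rightarrow> pol \<Rightarrow> pol" where
  "Xbar S i j u v = (if arrow S j i then u - v - half_hbar else 1)"

definition sigma :: "('v, 'a) iyangian_data \<Rightarrow> nat \<Rightarrow> 'v polrep \<Rightarrow> 'v polrep" where
  "sigma S k = summandwise (swap_word k)
     (\<lambda>w f. if 1 \<le> k \<and> k < length w then
              (if w ! (k - 1) = w ! k then demazure k f
               else swap_vars k (Xbar S (w ! (k - 1)) (w ! k) (Var k) (Var (k + 1)) * f))
            else 0)"

definition rho_L :: "('v::linorder, 'a) iyangian_data \<Rightarrow> 'v polrep \<Rightarrow> 'v polrep" where
  "rho_L S = summandwise (\<lambda>w. tau S (hd w) # tl w)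
     (\<lambda>w f. if w \<noteq> []
            then poly (p_poly S (tau S (hd w))) (Var 1) * subst (Var(1 := - Var 1 + hbar)) f
            else 0)"

definition rho_R :: "('v, 'a) iyangian_data \<Rightarrow> 'v polrep \<Rightarrow> 'v polrep" where
  "rho_R S = summandwise (\<lambda>w. butlast w @ [tau S (last w)])
     (\<lambda>w f. if w \<noteq> [] then subst (Var(length w := - Var (length w))) f else 0)"

definition KLR_iYangian ::
    "('v::linorder, 'a) iyangian_data \<Rightarrow> ('v polrep \<Rightarrow> 'v polrep) set" where
  "KLR_iYangian S = gen_algebra pol_scale (Pol S)
     ({idem w | w. w \<in> lists (verts (quiver S))}
      \<union> {dot k \<circ> idem w | k w. w \<in> lists (verts (quiver S)) \<and> 1 \<le> k \<and> k \<le> length w}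
      \<union> {sigma S k \<circ> idem w | k w. w \<in> lists (verts (quiver S)) \<and> 1 \<le> k \<and> k < length w}
      \<union> {rho_L S \<circ> idem w | w. w \<in> lists (verts (quiver S)) \<and> w \<noteq> []}
      \<union> {rho_R S \<circ> idem w | w. w \<in> lists (verts (quiver S)) \<and> w \<noteq> []})"

definition aleph :: "('v::linorder, 'a) iyangian_data \<Rightarrow> 'v list" where
  "aleph S = concat (map (\<lambda>i. replicate (vdim S i) i) (sorted_list_of_set (Qplus S)))"

text \<open>
  The endomorphism of \<open>P\<close>, identified with the \<open>\<aleph>\<close>-summand, induced by an operator on \<open>Pol\<close>.
\<close>

definition on_aleph ::
    "('v::linorder, 'a) iyangian_data \<Rightarrow> ('v polrep \<Rightarrow> 'v polrep) \<Rightarrow> (pol \<Rightarrow> pol)" where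
  "on_aleph S A =
     (\<lambda>f\<in>P_space S. Poly_Mapping.lookup (A (Poly_Mapping.single (aleph S) f)) (aleph S))"

definition KLR_corner :: "('v::linorder, 'a) iyangian_data \<Rightarrow> (pol \<Rightarrow> pol) set" where
  "KLR_corner S = on_aleph S ` {idem (aleph S) \<circ> A \<circ> idem (aleph S) | A. A \<in> KLR_iYangian S}"

text \<open>
  For \<open>i \<in> Q\<^sub>0\<^sup>(\<^sup>+\<^sup>)\<close>, \<open>D_loop S i\<close> moves the first \<open>i\<close>-strand and \<open>D_loop S (\<tau>i)\<close> the last one; both
  make sense only if there is an \<open>i\<close>-strand, i.e. \<open>v\<^sub>i > 0\<close>.  In the formula for \<open>b\<^sub>\<tau>\<^sub>i\<^sub>,\<^sub>r\<close> the sign is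
  \<open>(-1)^v\<^sub>i\<close>: each summand of \<open>b\<^sub>\<tau>\<^sub>i(z)\<close> has the denominator
  \<open>V\<^sub>\<tau>\<^sub>i\<^sub>,\<^sub>r(x\<^sub>\<tau>\<^sub>i\<^sub>,\<^sub>r) = (-1)^(v\<^sub>i - 1) V\<^sub>i\<^sub>,\<^sub>r(x\<^sub>i\<^sub>,\<^sub>r)\<close>, while the divided differences occurring in
  \<open>D_loop S (\<tau>i)\<close> produce the denominator \<open>V\<^sub>i\<^sub>,\<^sub>r(x\<^sub>i\<^sub>,\<^sub>r)\<close>.
\<close>

definition D_loop :: "('v::linorder, 'a) iyangian_data \<Rightarrow> 'v \<Rightarrow> 'v polrep \<Rightarrow> 'v polrep" where
  "D_loop S i =
     (let m = total_dim S; \<sigma> = (\<lambda>ks. op_prod (map (sigma S) ks)) in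
      if i \<in> Qplus S then
        \<sigma> [pos_first S i..<m] \<circ> rho_R S \<circ> \<sigma> (rev [1..<m]) \<circ> rho_L S \<circ> \<sigma> [1..<pos_first S i]
          \<circ> idem (aleph S)
      else
        let N = pos_last S (tau S i) in
        \<sigma> (rev [1..<N]) \<circ> rho_L S \<circ> \<sigma> [1..<m] \<circ> rho_R S \<circ> \<sigma> (rev [N..<m])
          \<circ> idem (aleph S))"

text \<open>The operator \<open>y\<^sub>k + c\<close> for a scalar \<open>c\<close>.\<close>

definition dot_plus :: "nat \<Rightarrow> complex poly \<Rightarrow> 'v polrep \<Rightarrow> 'v polrep" where
  "dot_plus k c F = dot k F + pol_scale c F"

definition eps :: "('v, 'a) iyangian_data \<Rightarrow> 'v \<Rightarrow> int" where
  "eps S i = int (vdim S i)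
     + (\<Sum>j\<in>{j \<in> verts (quiver S). arrow S j (tau S i)}. int (vdim S j)) - delta S i"

end

theory Submission
  imports Defs
begin

text \<open>
  A strand going around both mirrors acts on \<open>\<complex>[\<hbar>][X\<^sub>1, \<dots>, X\<^sub>m]\<close> by the shift of its variable by \<open>\<plusminus>\<hbar>\<close>,
  multiplied by the factors picked up at the crossings and at the left mirror.  When it comes back to its block,
  it crosses the other strands of the same colour, which applies a chain of divided differences to a polynomial
  \<open>h\<close> symmetric in all variables of the block except the moved one.  Such a chain evaluates to
  \<open>\<Sum>\<^sub>r h\<^sub>r / \<Prod>\<^sub>j\<^sub>\<noteq>\<^sub>r (X\<^sub>r - X\<^sub>j)\<close>, where \<open>X\<^sub>r\<close> is the moved variable in \<open>h\<^sub>r\<close>, and this is the sum defining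
  \<open>b\<^sub>i\<^sub>,\<^sub>r\<close> up to sign.  The same evaluation, iterated along the reduced word of the longest element, identifies
  the symmetrizer.  The coefficients of \<open>h\<^sub>i(z)\<close> act by multiplication with symmetric polynomials, and
  multiplications by polynomials are generated by the dots.
\<close>

section \<open>Substitutions of polynomials\<close>

text \<open>Arrows only go from \<open>Qplus S\<close> to its complement, and all letters of
  \<open>aleph S\<close> lie in \<open>Qplus S\<close>. A travelling strand can therefore collect
  crossing factors only while it has a colour \<open>tau S i\<close> and moves to the right; the
  loop for \<open>tau S i\<close> collects none. The mirrors send X to -X + \<hbar> and to -X, which
  compose to X + \<hbar> or X - \<hbar> according to their order; the half \<hbar> in the dots then
  turns the shifted variable, up to sign, into the point where the geometric series of
  \<open>b_series\<close> is expanded. The signs have separate origins: the geometric series, the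
  crossing factors, the direction in which the strand re-enters its block, and for
  \<open>tau S i\<close> the denominator evaluated at negated variables. The obstacle is that the
  sums over a block have denominators, whereas operators and renamings act on polynomials.
  Identities are stated in the fraction field, renamings are applied after clearing denominators,
  and the same sums show that the results are again symmetric. This last point is what makes
  products of operators on \<open>P_sym S\<close> correspond to products in the corner.\<close>

lemma Cst_0 [simp]: "Cst 0 = 0"
  by (simp add: Cst_def)

lemma Cst_1 [simp]: "Cst 1 = 1"
  by (simp add: Cst_def)

lemma Cst_add: "Cst (a + b) = Cst a + Cst b"
  by (simp add: Cst_def single_add)

lemma Cst_uminus: "Cst (- a) = - Cst a"
  by (simp add: Cst_def single_uminus)

lemma Cst_mult: "Cst (a * b) = Cst a * Cst b"
  by (simp add: Cst_def mult_single)

lemma Cst_pCons_mult: "Cst [:a * b:] = Cst [:a:] * Cst [:b:]"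
  by (simp add: Cst_mult [symmetric] mult.commute)

lemma Cst_of_nat: "Cst [:of_nat n:] = of_nat n"
  by (simp add: Cst_def of_nat_poly [symmetric])

lemma Cst_neg_one: "Cst [:- 1:] = - 1"
proof -
  have "Cst [:- 1:] = Cst (- [:1:])" by simp
  then show ?thesis by (simp add: Cst_uminus del: minus_pCons flip: one_pCons)
qed

lemma Cst_neg_one_power: "Cst [:(- 1) ^ n:] = (- 1) ^ n"
proof (induction n)
  case 0
  then show ?case by (simp flip: one_pCons)
next
  case (Suc n)
  then show ?case using Cst_pCons_mult [of "-1" "(-1) ^ n"] Cst_neg_one by simp
qed

definition mon_subst :: "(nat \<Rightarrow> pol) \<Rightarrow> (nat \<Rightarrow>\<^sub>0 nat) \<Rightarrow> pol" where
  "mon_subst g t = (\<Prod>n\<in>Poly_Mapping.keys t. g n ^ Poly_Mapping.lookup t n)"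

text \<open>The index set \<open>keys t\<close> varies with \<open>t\<close>; over a common finite
  set the exponents simply add.\<close>

lemma mon_subst_superset:
  "finite A \<Longrightarrow> Poly_Mapping.keys t \<subseteq> A \<Longrightarrow>
    mon_subst g t = (\<Prod>n\<in>A. g n ^ Poly_Mapping.lookup t n)"
  unfolding mon_subst_def by (rule prod.mono_neutral_left) (auto simp: in_keys_iff)

lemma mon_subst_add: "mon_subst g (s + t) = mon_subst g s * mon_subst g t"
proof -
  let ?A = "Poly_Mapping.keys s \<union> Poly_Mapping.keys t"
  have "mon_subst g u = (\<Prod>n\<in>?A. g n ^ Poly_Mapping.lookup u n)" if "u \<in> {s, t, s + t}" for u
    using that keys_add [of s t] by (intro mon_subst_superset) auto
  then show ?thesis
    by (simp add: lookup_add power_add prod.distrib)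
qed

lemma subst_alt: "subst g f = (\<Sum>t\<in>Poly_Mapping.keys f. Cst (Poly_Mapping.lookup f t) * mon_subst g t)"
  by (simp add: subst_def mon_subst_def)

lemma subst_add [simp]: "subst g (f + h) = subst g f + subst g h"
  unfolding subst_alt by (rule setsum_keys_plus_distrib) (auto simp: Cst_add algebra_simps)

lemma subst_single: "subst g (Poly_Mapping.single t c) = Cst c * mon_subst g t"
  by (simp add: subst_alt)

lemma subst_0 [simp]: "subst g 0 = 0"
  by (simp add: subst_alt)

lemma subst_sum [simp]: "subst g (sum F A) = (\<Sum>x\<in>A. subst g (F x))"
  by (induction A rule: infinite_finite_induct) auto

lemma pol_expand: "f = (\<Sum>t\<in>Poly_Mapping.keys f. Poly_Mapping.single t (Poly_Mapping.lookup f t))"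
  by (rule poly_mapping_eqI)
    (auto simp: lookup_sum lookup_single when_def not_in_keys_iff_lookup_eq_zero)

lemma subst_mult [simp]: "subst g (f * h) = subst g f * subst g h"
proof -
  have single: "subst g (Poly_Mapping.single s a * Poly_Mapping.single t b)
      = subst g (Poly_Mapping.single s a) * subst g (Poly_Mapping.single t b)" for s t a b
    by (simp add: mult_single subst_single mon_subst_add Cst_mult)
  have "subst g (Poly_Mapping.single s a * h) = subst g (Poly_Mapping.single s a) * subst g h" for s a
    by (subst (1 2) pol_expand [of h]) (simp add: sum_distrib_left single)
  then show ?thesis
    by (subst (1 2) pol_expand [of f]) (simp add: sum_distrib_right)
qed

lemma subst_Cst [simp]: "subst g (Cst c) = Cst c"
  by (simp add: Cst_def subst_single mon_subst_def)

lemma subst_1 [simp]: "subst g 1 = 1"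
  using subst_Cst [of g 1] by simp

lemma subst_Var [simp]: "subst g (Var n) = g n"
  by (simp add: Var_def subst_single mon_subst_def)

lemma subst_hbar [simp]: "subst g hbar = hbar" "subst g half_hbar = half_hbar"
  by (simp_all add: hbar_def half_hbar_def)

lemma subst_uminus [simp]: "subst g (- f) = - subst g f"
  using subst_add [of g f "- f"] by (simp del: subst_add add: eq_neg_iff_add_eq_0 add.commute)

lemma subst_diff [simp]: "subst g (f - h) = subst g f - subst g h"
  using subst_add [of g f "- h"] by simp

lemma subst_power [simp]: "subst g (f ^ n) = subst g f ^ n"
  by (induction n) auto

lemma subst_prod [simp]: "subst g (prod F A) = (\<Prod>x\<in>A. subst g (F x))"
  by (induction A rule: infinite_finite_induct) auto

section \<open>Monomials, polynomials in finitely many variables, and structural induction\<close>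

lemma pol_monomial:
  "Poly_Mapping.single t c = Cst c * (\<Prod>n\<in>Poly_Mapping.keys t. Var n ^ Poly_Mapping.lookup t n)"
proof -
  have pow: "Var n ^ k = Poly_Mapping.single (Poly_Mapping.single n k) 1" for n k
    by (induction k) (auto simp: Var_def mult_single single_add [symmetric] simp flip: single_one)
  have "(\<Prod>n\<in>A. Var n ^ Poly_Mapping.lookup t n)
      = Poly_Mapping.single (\<Sum>n\<in>A. Poly_Mapping.single n (Poly_Mapping.lookup t n)) 1" if "finite A" for A
    using that by (induction A) (auto simp: pow mult_single)
  moreover have "(\<Sum>n\<in>Poly_Mapping.keys t. Poly_Mapping.single n (Poly_Mapping.lookup t n)) = t"
    by (rule poly_mapping_eqI)
      (auto simp: lookup_sum lookup_single when_def not_in_keys_iff_lookup_eq_zero)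
  ultimately show ?thesis
    by (simp add: Cst_def mult_single)
qed

lemma polys_Cst [simp]: "Cst c \<in> polys m"
  by (simp add: polys_def Cst_def)

lemma polys_hbar [simp]: "hbar \<in> polys m" "half_hbar \<in> polys m"
  by (simp_all add: hbar_def half_hbar_def)

lemma polys_0 [simp]: "0 \<in> polys m" and polys_1 [simp]: "1 \<in> polys m"
  using polys_Cst [of 0 m] polys_Cst [of 1 m] by simp_all

lemma polys_Var [simp]: "1 \<le> n \<Longrightarrow> n \<le> m \<Longrightarrow> Var n \<in> polys m"
  by (simp add: polys_def Var_def)

lemma polys_add [simp]: "f \<in> polys m \<Longrightarrow> g \<in> polys m \<Longrightarrow> f + g \<in> polys m"
  using keys_add [of f g] by (auto simp: polys_def)

lemma polys_mult [simp]:
  assumes "f \<in> polys m" "g \<in> polys m"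
  shows "f * g \<in> polys m"
proof -
  have "Poly_Mapping.keys t \<subseteq> {1..m}" if "t \<in> Poly_Mapping.keys (f * g)" for t
  proof -
    from that keys_mult [of f g] obtain a b where
      "t = a + b" "a \<in> Poly_Mapping.keys f" "b \<in> Poly_Mapping.keys g" by auto
    then show ?thesis
      using assms keys_add [of a b] unfolding polys_def by blast
  qed
  then show ?thesis
    by (simp add: polys_def)
qed

lemma polys_uminus [simp]: "f \<in> polys m \<Longrightarrow> - f \<in> polys m"
  by (simp add: polys_def)

lemma polys_diff [simp]: "f \<in> polys m \<Longrightarrow> g \<in> polys m \<Longrightarrow> f - g \<in> polys m"
  using polys_add [of f m "- g"] by simp

lemma polys_sum: "(\<And>x. x \<in> A \<Longrightarrow> F x \<in> polys m) \<Longrightarrow> sum F A \<in> polys m"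
  by (induction A rule: infinite_finite_induct) auto

lemma polys_prod: "(\<And>x. x \<in> A \<Longrightarrow> F x \<in> polys m) \<Longrightarrow> prod F A \<in> polys m"
  by (induction A rule: infinite_finite_induct) auto

lemma polys_power [simp]: "f \<in> polys m \<Longrightarrow> f ^ n \<in> polys m"
  by (induction n) auto

text \<open>The membership hypotheses in the last two cases allow closure facts such as
  \<open>polys_rename\<close> to be applied to the factors during the induction.\<close>

lemma polys_induct [consumes 1, case_names Cst Var add mult]:
  assumes "f \<in> polys m"
    and Cst: "\<And>c. P (Cst c)"
    and Var: "\<And>n. 1 \<le> n \<Longrightarrow> n \<le> m \<Longrightarrow> P (Var n)"
    and add: "\<And>f g. f \<in> polys m \<Longrightarrow> g \<in> polys m \<Longrightarrow> P f \<Longrightarrow> P g \<Longrightarrow> P (f + g)"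
    and mult: "\<And>f g. f \<in> polys m \<Longrightarrow> g \<in> polys m \<Longrightarrow> P f \<Longrightarrow> P g \<Longrightarrow> P (f * g)"
  shows "P f"
proof -
  let ?Q = "\<lambda>f. f \<in> polys m \<and> P f"
  have Q1: "?Q 1" using Cst [of 1] by simp
  have Q0: "?Q 0" using Cst [of 0] by simp
  have pow: "?Q (Var n ^ k)" if "1 \<le> n" "n \<le> m" for n k
    by (induction k) (use that Q1 Var mult in auto)
  have prod: "?Q (\<Prod>n\<in>A. Var n ^ k n)" if "A \<subseteq> {1..m}" for A k
    using that by (induction A rule: infinite_finite_induct)
      (use Q1 pow mult in \<open>auto simp del: polys_power\<close>)
  have "?Q (Poly_Mapping.single t (Poly_Mapping.lookup f t))" if "t \<in> Poly_Mapping.keys f" for t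
  proof -
    have "Poly_Mapping.keys t \<subseteq> {1..m}"
      using that assms(1) by (auto simp: polys_def)
    then show ?thesis
      unfolding pol_monomial using prod [of "Poly_Mapping.keys t"] Cst mult by simp
  qed
  then have "?Q (\<Sum>t\<in>A. Poly_Mapping.single t (Poly_Mapping.lookup f t))" if "A \<subseteq> Poly_Mapping.keys f" for A
    using that by (induction A rule: infinite_finite_induct) (use Q0 add in auto)
  then show ?thesis
    by (subst pol_expand) blast
qed

lemma pol_induct [case_names Cst Var add mult]:
  assumes Cst: "\<And>c. P (Cst c)"
    and Var: "\<And>n. P (Var n)"
    and add: "\<And>f g. P f \<Longrightarrow> P g \<Longrightarrow> P (f + g)"
    and mult: "\<And>f g. P f \<Longrightarrow> P g \<Longrightarrow> P (f * g)"
  shows "P f"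
proof -
  have Q1: "P 1" using Cst [of 1] by simp
  have Q0: "P 0" using Cst [of 0] by simp
  have pow: "P (Var n ^ k)" for n k
    by (induction k) (use Q1 Var mult in auto)
  have prod: "P (\<Prod>n\<in>A. Var n ^ k n)" for A k
    by (induction A rule: infinite_finite_induct) (use Q1 pow mult in auto)
  have "P (Poly_Mapping.single t c)" for t c
    unfolding pol_monomial by (intro mult prod Cst)
  then have "P (\<Sum>t\<in>A. Poly_Mapping.single t (Poly_Mapping.lookup f t))" for A
    by (induction A rule: infinite_finite_induct) (use Q0 add in auto)
  then show ?thesis
    by (subst pol_expand) blast
qed

lemma subst_subst: "subst g (subst h f) = subst (\<lambda>n. subst g (h n)) f"
  by (induction f rule: pol_induct) auto

lemma subst_ident: "subst Var f = f"
  by (induction f rule: pol_induct) auto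

lemma subst_cong:
  assumes "f \<in> polys m" "\<And>n. 1 \<le> n \<Longrightarrow> n \<le> m \<Longrightarrow> g n = h n"
  shows "subst g f = subst h f"
  using assms(1) by (induction rule: polys_induct) (use assms(2) in auto)

lemma polys_subst:
  assumes "f \<in> polys m" "\<And>n. 1 \<le> n \<Longrightarrow> n \<le> m \<Longrightarrow> g n \<in> polys k"
  shows "subst g f \<in> polys k"
  using assms(1) by (induction rule: polys_induct) (use assms(2) in auto)

lemma Var_eq_iff [simp]: "Var n = Var k \<longleftrightarrow> n = k"
proof
  assume "Var n = Var k"
  then have "Poly_Mapping.lookup (Var n) (Poly_Mapping.single n 1) = Poly_Mapping.lookup (Var k) (Poly_Mapping.single n 1)"
    by simp
  then have "Poly_Mapping.single k (1::nat) = Poly_Mapping.single n 1"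
    by (simp add: Var_def lookup_single when_def split: if_splits)
  then have "Poly_Mapping.lookup (Poly_Mapping.single k (1::nat)) n = 1" by simp
  then show "n = k"
    by (simp add: lookup_single when_def split: if_splits)
qed simp

section \<open>Renaming of variables\<close>

definition rename :: "(nat \<Rightarrow> nat) \<Rightarrow> pol \<Rightarrow> pol" where
  "rename \<pi> = subst (\<lambda>n. Var (\<pi> n))"

lemma rename_simps [simp]:
  "rename \<pi> (f + g) = rename \<pi> f + rename \<pi> g"
  "rename \<pi> (f * g) = rename \<pi> f * rename \<pi> g"
  "rename \<pi> (f - g) = rename \<pi> f - rename \<pi> g"
  "rename \<pi> (- f) = - rename \<pi> f"
  "rename \<pi> (f ^ k) = rename \<pi> f ^ k"
  "rename \<pi> (Cst c) = Cst c"
  "rename \<pi> (Var n) = Var (\<pi> n)"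
  "rename \<pi> 0 = 0"
  "rename \<pi> 1 = 1"
  "rename \<pi> hbar = hbar"
  "rename \<pi> half_hbar = half_hbar"
  "rename \<pi> (sum F A) = (\<Sum>x\<in>A. rename \<pi> (F x))"
  "rename \<pi> (prod F A) = (\<Prod>x\<in>A. rename \<pi> (F x))"
  by (simp_all add: rename_def)

lemma rename_rename: "rename \<pi> (rename \<rho> f) = rename (\<pi> \<circ> \<rho>) f"
  by (simp add: rename_def subst_subst o_def)

lemma rename_id [simp]: "rename id f = f"
  by (simp add: rename_def subst_ident)

lemma polys_rename: "f \<in> polys m \<Longrightarrow> (\<And>n. 1 \<le> n \<Longrightarrow> n \<le> m \<Longrightarrow> 1 \<le> \<pi> n \<and> \<pi> n \<le> k) \<Longrightarrow> rename \<pi> f \<in> polys k"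
  unfolding rename_def by (rule polys_subst) auto

lemma swap_vars_eq: "swap_vars k = rename (transpose k (k + 1))"
  by (simp add: swap_vars_def rename_def)

section \<open>Divided differences\<close>

definition ddiff :: "nat \<Rightarrow> nat \<Rightarrow> pol \<Rightarrow> pol" where
  "ddiff p q f = exact_quot (rename (transpose p q) f - f) (Var q - Var p)"

lemma demazure_eq: "demazure k = ddiff k (k + 1)"
  by (simp add: fun_eq_iff demazure_def ddiff_def swap_vars_eq)

lemma exact_quot_eqI: "g \<noteq> 0 \<Longrightarrow> q * g = f \<Longrightarrow> exact_quot f g = q"
  unfolding exact_quot_def by (rule the_equality) auto

lemma ddiff_eqI:
  "p \<noteq> q \<Longrightarrow> d * (Var q - Var p) = rename (transpose p q) f - f \<Longrightarrow> ddiff p q f = d"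
  unfolding ddiff_def by (rule exact_quot_eqI) auto

text \<open>\<open>exact_quot\<close> is a definite description, so divisibility has to be
  established: it is clear on variables and passes to products by the twisted Leibniz rule.\<close>

lemma ddiff_mult:
  assumes "p \<noteq> q"
  shows "ddiff p q f * (Var q - Var p) = rename (transpose p q) f - f"
proof -
  have "\<exists>d. d * (Var q - Var p) = rename (transpose p q) f - f"
  proof (induction f rule: pol_induct)
    case (Cst c)
    show ?case by (rule exI [of _ 0]) auto
  next
    case (Var n)
    consider "n = p" | "n = q" "n \<noteq> p" | "n \<noteq> p" "n \<noteq> q" by blast
    then show ?case
    proof cases
      case 1 then show ?thesis by (intro exI [of _ 1]) auto
    next
      case 2 then show ?thesis by (intro exI [of _ "-1"]) auto
    next
      case 3 then show ?thesis by (intro exI [of _ 0]) auto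
    qed
  next
    case (add f g)
    then obtain d e where
      "d * (Var q - Var p) = rename (transpose p q) f - f"
      "e * (Var q - Var p) = rename (transpose p q) g - g" by blast
    then show ?case by (intro exI [of _ "d + e"]) (simp add: distrib_right)
  next
    case (mult f g)
    let ?s = "rename (transpose p q)"
    from mult obtain d e where de: 
      "d * (Var q - Var p) = ?s f - f" "e * (Var q - Var p) = ?s g - g" by blast
    have "(?s f * e + d * g) * (Var q - Var p) = ?s f * (e * (Var q - Var p)) + (d * (Var q - Var p)) * g"
      by (simp add: algebra_simps)
    then have "(?s f * e + d * g) * (Var q - Var p) = ?s (f * g) - f * g"
      unfolding de by (simp add: algebra_simps)
    then show ?case by blast
  qed
  then show ?thesis
    using ddiff_eqI [OF assms] by blast
qed

lemma ddiff_add: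
  assumes "p \<noteq> q"
  shows "ddiff p q (f + g) = ddiff p q f + ddiff p q g"
  by (rule ddiff_eqI [OF assms]) (simp add: ddiff_mult [OF assms] distrib_right)

lemma ddiff_prod:
  assumes "p \<noteq> q"
  shows "ddiff p q (f * g) = rename (transpose p q) f * ddiff p q g + ddiff p q f * g"
proof (rule ddiff_eqI [OF assms])
  let ?s = "rename (transpose p q)"
  have "(?s f * ddiff p q g + ddiff p q f * g) * (Var q - Var p)
      = ?s f * (ddiff p q g * (Var q - Var p)) + (ddiff p q f * (Var q - Var p)) * g"
    by (simp add: algebra_simps)
  also have "\<dots> = ?s (f * g) - f * g"
    unfolding ddiff_mult [OF assms] by (simp add: algebra_simps)
  finally show "(?s f * ddiff p q g + ddiff p q f * g) * (Var q - Var p) = ?s (f * g) - f * g" .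
qed

lemma ddiff_invariant: "p \<noteq> q \<Longrightarrow> rename (transpose p q) f = f \<Longrightarrow> ddiff p q f = 0"
  by (rule ddiff_eqI) auto

lemma ddiff_invariant_mult:
  "p \<noteq> q \<Longrightarrow> rename (transpose p q) f = f \<Longrightarrow> ddiff p q (f * g) = f * ddiff p q g"
  by (simp add: ddiff_prod ddiff_invariant)

lemma polys_ddiff:
  assumes "p \<noteq> q" "1 \<le> p" "p \<le> m" "1 \<le> q" "q \<le> m" "f \<in> polys m"
  shows "ddiff p q f \<in> polys m"
  using assms(6)
proof (induction rule: polys_induct)
  case (Cst c)
  then show ?case using assms(1) by (simp add: ddiff_invariant)
next
  case (Var n)
  consider "n = p" | "n = q" | "n \<noteq> p" "n \<noteq> q" by blast
  then show ?case
  proof cases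
    case 1
    then have "ddiff p q (Var n) = 1" using assms(1) by (intro ddiff_eqI) auto
    then show ?thesis by simp
  next
    case 2
    then have "ddiff p q (Var n) = - 1" using assms(1) by (intro ddiff_eqI) auto
    then show ?thesis by simp
  qed (use assms(1) in \<open>simp add: ddiff_invariant\<close>)
next
  case (mult f g)
  have "rename (transpose p q) f \<in> polys m"
    using mult(1) by (rule polys_rename) (use assms in \<open>auto simp: transpose_def\<close>)
  with mult show ?case using assms(1) by (simp add: ddiff_prod)
qed (use assms(1) in \<open>simp add: ddiff_add\<close>)

lemma ddiff_uminus: "p \<noteq> q \<Longrightarrow> ddiff p q (- g) = - ddiff p q g"
  using ddiff_invariant_mult [of p q "-1" g] by simp

lemma ddiff_0: "p \<noteq> q \<Longrightarrow> ddiff p q 0 = 0"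
  using ddiff_invariant_mult [of p q 0 0] by simp

lemma ddiff_diff: "p \<noteq> q \<Longrightarrow> ddiff p q (f - g) = ddiff p q f - ddiff p q g"
  using ddiff_add [of p q f "- g"] by (simp add: ddiff_uminus)

lemma ddiff_flip: "p \<noteq> q \<Longrightarrow> ddiff q p f = - ddiff p q f"
  by (rule ddiff_eqI) (auto simp: transpose_commute [of q p] algebra_simps ddiff_mult [symmetric])

lemma rename_ddiff:
  assumes "p \<noteq> q" "inj \<pi>"
  shows "rename \<pi> (ddiff p q f) = ddiff (\<pi> p) (\<pi> q) (rename \<pi> f)"
proof -
  have *: "\<pi> \<circ> transpose p q = transpose (\<pi> p) (\<pi> q) \<circ> \<pi>"
    using assms by (auto simp: fun_eq_iff transpose_def inj_eq)
  have "rename \<pi> (ddiff p q f) * (Var (\<pi> q) - Var (\<pi> p)) = rename \<pi> (ddiff p q f * (Var q - Var p))"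
    by simp
  also have "\<dots> = rename (transpose (\<pi> p) (\<pi> q)) (rename \<pi> f) - rename \<pi> f"
    by (simp add: ddiff_mult [OF assms(1)] rename_rename *)
  finally show ?thesis
    using assms ddiff_eqI [of "\<pi> p" "\<pi> q"] by (metis injD)
qed

lemma ddiff_commute:
  assumes "p \<noteq> q" "r \<noteq> s" "{p, q} \<inter> {r, s} = {}"
  shows "ddiff p q (ddiff r s f) = ddiff r s (ddiff p q f)"
proof (rule ddiff_eqI [OF assms(1)])
  let ?t = "rename (transpose p q)"
  have inv: "rename (transpose r s) (Var q - Var p) = Var q - Var p"
    using assms by (auto simp: transpose_def)
  have "ddiff r s (ddiff p q f) * (Var q - Var p) = ddiff r s (ddiff p q f * (Var q - Var p))"
    using ddiff_invariant_mult [OF assms(2) inv] by (simp only: mult.commute)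
  also have "\<dots> = ddiff r s (?t f) - ddiff r s f"
    using assms by (simp add: ddiff_mult ddiff_diff)
  also have "ddiff r s (?t f) = ?t (ddiff r s f)"
    using assms by (subst rename_ddiff) (auto simp: transpose_def inj_def)
  finally show "ddiff r s (ddiff p q f) * (Var q - Var p) = ?t (ddiff r s f) - ddiff r s f" .
qed

text \<open>Multiplied by the three differences of variables, the composite becomes, up to sign, the
  alternating sum of f over the symmetric group on p, q, r. No quotient is left on the
  right.\<close>

lemma ddiff_triple:
  assumes "p \<noteq> q" "q \<noteq> r" "p \<noteq> r"
  defines "s \<equiv> rename (transpose p q)" and "t \<equiv> rename (transpose q r)"
  shows "ddiff p q (ddiff q r (ddiff p q f)) * ((Var q - Var p) * (Var r - Var p) * (Var r - Var q))
    = s (t (s f)) - s (t f) - t (s f) + t f + s f - f"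
proof -
  define a b c where "a = Var p" and "b = Var q" and "c = Var r"
  define g where "g = ddiff p q f"
  define h where "h = ddiff q r g"
  define k where "k = ddiff p q h"
  have g: "g * (b - a) = s f - f" and h: "h * (c - b) = t g - g" and k: "k * (b - a) = s h - h"
    by (simp_all add: g_def h_def k_def s_def t_def a_def b_def c_def ddiff_mult assms)
  have s: "s a = b" "s b = a" "s c = c" and t: "t a = a" "t b = c" "t c = b"
    using assms(1-3) by (auto simp: s_def t_def a_def b_def c_def transpose_def)
  have hom: "s (x * y) = s x * s y" "s (x - y) = s x - s y" "t (x * y) = t x * t y" "t (x - y) = t x - t y"
    for x y by (simp_all add: s_def t_def)
  have ss: "s (s x) = x" for x
    by (simp add: s_def rename_rename)
  \<comment> \<open>A divided difference is invariant under its own transposition.\<close>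
  have "s g = ddiff q p (s f)"
    unfolding g_def s_def using assms by (subst rename_ddiff) (auto simp: transpose_def inj_def)
  also have "\<dots> = g"
    unfolding g_def s_def ddiff_flip [OF assms(1)]
    by (rule minus_equation_iff [THEN iffD1], rule sym, rule ddiff_eqI [OF assms(1)])
      (simp add: rename_rename ddiff_mult assms)
  finally have sg: "s g = g" .
  have sh: "s h * (c - a) = s (t g) - g"
    using arg_cong [OF h, of s] by (simp add: hom s sg)
  have tg: "t g * (c - a) = t (s f) - t f"
    using arg_cong [OF g, of t] by (simp add: hom t)
  have stg: "s (t g) * (c - b) = s (t (s f)) - s (t f)"
    using arg_cong [OF tg, of s] by (simp add: hom s)
  have "k * ((b - a) * (c - a) * (c - b)) = (k * (b - a)) * (c - a) * (c - b)"
    by (simp add: mult_ac)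
  also have "\<dots> = (s h * (c - a)) * (c - b) - (h * (c - b)) * (c - a)"
    unfolding k by (simp add: algebra_simps)
  also have "\<dots> = s (t g) * (c - b) - t g * (c - a) + g * (b - a)"
    unfolding h sh by (simp add: algebra_simps)
  finally show ?thesis
    unfolding stg tg g by (simp add: k_def h_def g_def a_def b_def c_def)
qed

text \<open>\<open>ddiff_triple\<close> is applied to p, q, r and to r, q, p. The alternating sums
  agree by the braid relation for transpositions; the product of differences changes sign, and so
  does the composite when its three factors are flipped.\<close>

lemma ddiff_braid:
  assumes "p \<noteq> q" "q \<noteq> r" "p \<noteq> r"
  shows "ddiff p q (ddiff q r (ddiff p q f)) = ddiff q r (ddiff p q (ddiff q r f))"
proof -
  let ?v = "(Var q - Var p) * (Var r - Var p) * (Var r - Var q)"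
  have "ddiff r q (ddiff q p (ddiff r q f)) = - ddiff q r (ddiff p q (ddiff q r f))"
    using assms ddiff_flip [of q r] ddiff_flip [of p q] by (simp add: ddiff_uminus)
  moreover have v: "(Var q - Var r) * (Var p - Var r) * (Var p - Var q) = - ?v"
    by (simp add: algebra_simps)
  ultimately have "ddiff q r (ddiff p q (ddiff q r f)) * ?v
      = ddiff r q (ddiff q p (ddiff r q f)) * ((Var q - Var r) * (Var p - Var r) * (Var p - Var q))"
    unfolding v by simp
  also have "\<dots> = ddiff p q (ddiff q r (ddiff p q f)) * ?v"
  proof -
    have "transpose p q \<circ> (transpose q r \<circ> transpose p q) = transpose q r \<circ> (transpose p q \<circ> transpose q r)"
      using assms by (auto simp: fun_eq_iff transpose_def)
    then show ?thesis
      using assms by (subst (1 2) ddiff_triple)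
        (auto simp: transpose_commute [of r q] transpose_commute [of q p] rename_rename algebra_simps)
  qed
  finally show ?thesis
    using assms by simp
qed

section \<open>Chains of divided differences as sums over a block\<close>

lemma op_prod_simps [simp]:
  "op_prod [] = id"
  "op_prod (A # As) = A \<circ> op_prod As"
  by (simp_all add: op_prod_def)

lemma op_prod_append [simp]: "op_prod (As @ Bs) = op_prod As \<circ> op_prod Bs"
  by (induction As) (simp_all add: fun_eq_iff)

lemma to_fract_prod: "to_fract (prod F A) = (\<Prod>x\<in>A. to_fract (F x))"
  by (induction A rule: infinite_finite_induct) auto

text \<open>\<open>rename\<close> is defined on polynomials only. Clearing denominators gives a
  polynomial identity to which a renaming applies, and the converse direction restores the
  fractions.\<close>

lemma to_fract_eq_sum_iff:
  assumes "finite R" "\<And>r. r \<in> R \<Longrightarrow> d r \<noteq> 0"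
  shows "to_fract F = (\<Sum>r\<in>R. to_fract (n r) / to_fract (d r)) \<longleftrightarrow>
    F * prod d R = (\<Sum>r\<in>R. n r * prod d (R - {r}))"
proof -
  let ?D = "to_fract (prod d R)"
  have D: "?D \<noteq> 0"
    using assms by simp
  have "to_fract (n r) / to_fract (d r) * ?D = to_fract (n r * prod d (R - {r}))" if "r \<in> R" for r
    unfolding prod.remove [OF assms(1) that, of d] using assms(2) [OF that] by simp
  then have sum: "(\<Sum>r\<in>R. to_fract (n r) / to_fract (d r)) * ?D = (\<Sum>r\<in>R. to_fract (n r * prod d (R - {r})))"
    unfolding sum_distrib_right by (rule sum.cong [OF refl])
  have "to_fract F = (\<Sum>r\<in>R. to_fract (n r) / to_fract (d r)) \<longleftrightarrow>
      to_fract F * ?D = (\<Sum>r\<in>R. to_fract (n r) / to_fract (d r)) * ?D"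
    using mult_right_cancel [OF D] by blast
  also have "\<dots> \<longleftrightarrow> to_fract (F * prod d R) = to_fract (\<Sum>r\<in>R. n r * prod d (R - {r}))"
    unfolding sum by (simp only: to_fract_sum to_fract_mult)
  finally show ?thesis
    by (simp only: to_fract_eq_iff)
qed

lemma rename_inj:
  assumes "bij \<pi>"
  shows "rename \<pi> f = rename \<pi> g \<longleftrightarrow> f = g"
proof -
  have "inv \<pi> \<circ> \<pi> = id"
    using assms by (simp add: bij_is_inj)
  then have "rename (inv \<pi>) (rename \<pi> f) = f" for f
    by (simp add: rename_rename)
  then show ?thesis by metis
qed

lemma to_fract_rename_sum:
  assumes "finite R" "\<And>r. r \<in> R \<Longrightarrow> d r \<noteq> 0" "bij \<pi>"
    and "to_fract F = (\<Sum>r\<in>R. to_fract (n r) / to_fract (d r))"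
  shows "to_fract (rename \<pi> F) = (\<Sum>r\<in>R. to_fract (rename \<pi> (n r)) / to_fract (rename \<pi> (d r)))"
proof -
  have "rename \<pi> (d r) \<noteq> 0" if "r \<in> R" for r
    using rename_inj [OF assms(3), of "d r" 0] assms(2) [OF that] by simp
  moreover have "rename \<pi> (F * prod d R) = rename \<pi> (\<Sum>r\<in>R. n r * prod d (R - {r}))"
    using assms(4) to_fract_eq_sum_iff [of R d F n] assms(1,2) by simp
  ultimately show ?thesis
    using assms(1) by (simp add: to_fract_eq_sum_iff)
qed

definition sym_in :: "nat set \<Rightarrow> pol \<Rightarrow> bool" where
  "sym_in B f \<longleftrightarrow> (\<forall>\<pi>. \<pi> permutes B \<longrightarrow> rename \<pi> f = f)"

text \<open>If h involves only the variable with index c, this is Newton's divided difference of h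
  at the nodes \<open>Var r\<close>, in the form given by Lagrange interpolation. Single summands
  are not polynomials, hence the fraction field.\<close>

definition block_sum :: "nat set \<Rightarrow> nat \<Rightarrow> pol \<Rightarrow> pol fract" where
  "block_sum B c h =
    (\<Sum>r\<in>B. to_fract (rename (transpose c r) h) / to_fract (\<Prod>j\<in>B - {r}. Var r - Var j))"

lemma sym_inD: "sym_in B f \<Longrightarrow> \<pi> permutes B \<Longrightarrow> rename \<pi> f = f"
  by (simp add: sym_in_def)

lemma sym_in_mono: "sym_in B f \<Longrightarrow> A \<subseteq> B \<Longrightarrow> sym_in A f"
  by (auto simp: sym_in_def intro: permutes_subset)

lemma sym_in_mult: "sym_in B f \<Longrightarrow> sym_in B g \<Longrightarrow> sym_in B (f * g)"
  by (simp add: sym_in_def)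

lemma sym_in_Cst: "sym_in B (Cst c)"
  by (simp add: sym_in_def)

text \<open>Both \<pi> composed with the transposition of c and r, and the transposition of c and
  \<pi> r, send c to \<pi> r. They differ by a permutation of B fixing c, which leaves h
  invariant.\<close>

lemma rename_mem_block_sum:
  assumes "c \<in> B" "sym_in (B - {c}) h" "\<pi> permutes B" "r \<in> B"
  shows "rename \<pi> (rename (transpose c r) h) = rename (transpose c (\<pi> r)) h"
proof -
  let ?\<rho> = "transpose c (\<pi> r) \<circ> \<pi> \<circ> transpose c r"
  have "\<pi> r \<in> B"
    using assms by (simp add: permutes_in_image)
  then have "?\<rho> permutes B"
    using assms by (intro permutes_compose permutes_swap_id) auto
  moreover have "?\<rho> c = c"
    by simp
  ultimately have "?\<rho> permutes (B - {c})"
    using permutes_superset [of ?\<rho> B "B - {c}"] by auto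
  then have "rename ?\<rho> h = h"
    using assms(2) by (simp add: sym_inD)
  then have "rename (transpose c (\<pi> r)) (rename ?\<rho> h) = rename (transpose c (\<pi> r)) h"
    by simp
  moreover have "transpose c (\<pi> r) \<circ> ?\<rho> = \<pi> \<circ> transpose c r"
    by (simp add: o_assoc)
  ultimately show ?thesis
    by (simp add: rename_rename)
qed

text \<open>\<pi> carries the summand of index r to the summand of index \<pi> r, denominators
  included, so the sum is only reordered.\<close>

lemma sym_in_block_sum:
  assumes "finite B" "c \<in> B" "sym_in (B - {c}) h" and F: "to_fract F = block_sum B c h"
  shows "sym_in B F"
  unfolding sym_in_def
proof (intro allI impI)
  fix \<pi> assume \<pi>: "\<pi> permutes B"
  have "to_fract (rename \<pi> F) = (\<Sum>r\<in>B. to_fract (rename \<pi> (rename (transpose c r) h)) /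
      to_fract (rename \<pi> (\<Prod>j\<in>B - {r}. Var r - Var j)))"
    using F unfolding block_sum_def
    by (intro to_fract_rename_sum permutes_bij [OF \<pi>]) (use assms(1) in auto)
  also have "\<dots> = (\<Sum>r\<in>B. to_fract (rename (transpose c (\<pi> r)) h) /
      to_fract (\<Prod>j\<in>B - {\<pi> r}. Var (\<pi> r) - Var j))"
  proof (intro sum.cong refl arg_cong2 [where f = "(/)"] arg_cong [where f = to_fract])
    fix r assume r: "r \<in> B"
    show "rename \<pi> (rename (transpose c r) h) = rename (transpose c (\<pi> r)) h"
      using assms \<pi> r by (simp add: rename_mem_block_sum)
    have "rename \<pi> (\<Prod>j\<in>B - {r}. Var r - Var j) = (\<Prod>j\<in>B - {r}. Var (\<pi> r) - Var (\<pi> j))"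
      by simp
    also have "\<dots> = (\<Prod>j\<in>\<pi> ` (B - {r}). Var (\<pi> r) - Var j)"
      using inj_on_subset [OF permutes_inj [OF \<pi>]] by (subst prod.reindex) auto
    also have "\<pi> ` (B - {r}) = B - {\<pi> r}"
      using permutes_inj [OF \<pi>] permutes_image [OF \<pi>] by (simp add: image_set_diff)
    finally show "rename \<pi> (\<Prod>j\<in>B - {r}. Var r - Var j) = (\<Prod>j\<in>B - {\<pi> r}. Var (\<pi> r) - Var j)" .
  qed
  also have "\<dots> = block_sum B c h"
    unfolding block_sum_def using permutes_imp_bij [OF \<pi>]
    by (rule sum.reindex_bij_betw)
  finally show "rename \<pi> F = F"
    using F by (metis to_fract_eq_iff)
qed

text \<open>Transposing e and d replaces the node e by d. The difference of the two sums over B is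
  resolved by partial fractions into the sum over \<open>insert d B\<close>. Any old node e may be
  taken, so the lemma serves chains running in either direction.\<close>

lemma ddiff_block_sum:
  assumes B: "finite B" "c \<in> B" "d \<notin> B" "e \<in> B" and sym: "sym_in (insert d B - {c}) h"
    and F: "to_fract F = block_sum B c h"
  shows "to_fract (ddiff e d F) = block_sum (insert d B) c h"
proof -
  define x where "x j = to_fract (Var j)" for j
  define H where "H r = to_fract (rename (transpose c r) h)" for r
  \<comment> \<open>The part of the denominator of index r that involves neither e nor d as a second
    node; it is common to all sums compared below.\<close>
  define P where "P r = (\<Prod>j\<in>B - {e} - {r}. x r - x j)" for r
  let ?s = "rename (transpose e d)"
  have ne: "e \<noteq> d" using B by auto
  have x: "x j = x k \<longleftrightarrow> j = k" for j k
    by (simp add: x_def)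
  have P0: "P r \<noteq> 0" for r
    using B by (simp add: P_def x)
  have prod_x: "to_fract (\<Prod>j\<in>A. Var r - Var j) = (\<Prod>j\<in>A. x r - x j)" for r A
    by (simp add: to_fract_prod x_def)
  have "to_fract F = (\<Sum>r\<in>B. H r / (\<Prod>j\<in>B - {r}. x r - x j))"
    by (simp add: F block_sum_def H_def prod_x)
  also have "\<dots> = H e / P e + (\<Sum>r\<in>B - {e}. H r / (\<Prod>j\<in>B - {r}. x r - x j))"
    using B by (subst sum.remove [of B e]) (auto simp: P_def)
  also have "(\<Sum>r\<in>B - {e}. H r / (\<Prod>j\<in>B - {r}. x r - x j)) = (\<Sum>r\<in>B - {e}. H r / ((x r - x e) * P r))"
  proof (intro sum.cong refl arg_cong2 [where f = "(/)"])
    fix r assume "r \<in> B - {e}"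
    then show "(\<Prod>j\<in>B - {r}. x r - x j) = (x r - x e) * P r"
      using B unfolding P_def by (subst prod.remove [of "B - {r}" e]) (auto simp: Diff_insert2 [symmetric] insert_commute)
  qed
  finally have F1: "to_fract F = H e / P e + (\<Sum>r\<in>B - {e}. H r / ((x r - x e) * P r))" .
  have "to_fract (?s F) = (\<Sum>r\<in>B. to_fract (?s (rename (transpose c r) h)) /
      to_fract (?s (\<Prod>j\<in>B - {r}. Var r - Var j)))"
    using F unfolding block_sum_def
    by (intro to_fract_rename_sum) (use B in auto)
  also have "\<dots> = (\<Sum>r\<in>B. H (transpose e d r) / (\<Prod>j\<in>B - {r}. x (transpose e d r) - x (transpose e d j)))"
  proof (intro sum.cong refl arg_cong2 [where f = "(/)"])
    fix r assume "r \<in> B"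
    moreover have "transpose e d permutes insert d B"
      using B by (intro permutes_swap_id) auto
    ultimately show "to_fract (?s (rename (transpose c r) h)) = H (transpose e d r)"
      unfolding H_def using sym B by (subst rename_mem_block_sum [of c "insert d B"]) auto
  qed (simp add: to_fract_prod x_def)
  also have "\<dots> = H d / P d + (\<Sum>r\<in>B - {e}. H r / ((x r - x d) * P r))"
  proof (subst sum.remove [of B e], use B in simp, use B in simp, intro arg_cong2 [where f = "(+)"] sum.cong refl)
    have "(\<Prod>j\<in>B - {e}. x d - x (transpose e d j)) = P d"
      unfolding P_def using B by (intro prod.cong) (auto simp: transpose_def)
    then show "H (transpose e d e) / (\<Prod>j\<in>B - {e}. x (transpose e d e) - x (transpose e d j)) = H d / P d"
      by simp
  next
    fix r assume r: "r \<in> B - {e}"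
    have "(\<Prod>j\<in>B - {r}. x r - x (transpose e d j)) = (x r - x d) * (\<Prod>j\<in>B - {r} - {e}. x r - x (transpose e d j))"
      using B r by (subst prod.remove [of "B - {r}" e]) auto
    also have "(\<Prod>j\<in>B - {r} - {e}. x r - x (transpose e d j)) = P r"
      unfolding P_def using B by (intro prod.cong) (auto simp: transpose_def)
    finally show "H (transpose e d r) / (\<Prod>j\<in>B - {r}. x (transpose e d r) - x (transpose e d j)) =
        H r / ((x r - x d) * P r)"
      using r B by (auto simp: transpose_def)
  qed
  finally have F2: "to_fract (?s F) = H d / P d + (\<Sum>r\<in>B - {e}. H r / ((x r - x d) * P r))" .
  have "block_sum (insert d B) c h = (\<Sum>r\<in>insert d B. H r / (\<Prod>j\<in>insert d B - {r}. x r - x j))"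
    by (simp add: block_sum_def H_def prod_x)
  also have "\<dots> = H d / ((x d - x e) * P d) + (H e / ((x e - x d) * P e)
      + (\<Sum>r\<in>B - {e}. H r / ((x r - x e) * (x r - x d) * P r)))"
  proof -
    have "(\<Prod>j\<in>insert d B - {d}. x d - x j) = (x d - x e) * P d"
      unfolding P_def using B by (subst prod.remove [of _ e]) (auto intro!: prod.cong)
    moreover have "(\<Prod>j\<in>insert d B - {e}. x e - x j) = (x e - x d) * P e"
      unfolding P_def using B ne by (subst prod.remove [of _ d]) (auto intro!: prod.cong)
    moreover have "(\<Prod>j\<in>insert d B - {r}. x r - x j) = (x r - x e) * (x r - x d) * P r" if "r \<in> B - {e}" for r
    proof -
      have "(\<Prod>j\<in>insert d B - {r}. x r - x j) = (x r - x d) * (\<Prod>j\<in>B - {r}. x r - x j)"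
        using B that by (subst prod.remove [of _ d]) (auto intro!: prod.cong)
      also have "(\<Prod>j\<in>B - {r}. x r - x j) = (x r - x e) * P r"
        unfolding P_def using B that by (subst prod.remove [of _ e]) (auto intro!: prod.cong)
      finally show ?thesis by simp
    qed
    ultimately show ?thesis
      using B by (simp add: sum.remove [of B e])
  qed
  finally have R: "block_sum (insert d B) c h = \<dots>" .
  \<comment> \<open>Partial fractions, from
    \<open>x d - x e = (x r - x e) - (x r - x d)\<close>.\<close>
  have telescope: "H r / ((x r - x e) * (x r - x d) * P r) * (x d - x e)
      = H r / ((x r - x d) * P r) - H r / ((x r - x e) * P r)" if "r \<in> B - {e}" for r
  proof -
    have "x r - x e \<noteq> 0" "x r - x d \<noteq> 0"
      using that B by (auto simp: x)
    then show ?thesis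
      using P0 [of r] by (simp add: divide_simps) (simp add: algebra_simps)
  qed
  have de: "x d - x e \<noteq> 0"
    using ne by (simp add: x)
  have "(\<Sum>r\<in>B - {e}. H r / ((x r - x e) * (x r - x d) * P r)) * (x d - x e)
      = (\<Sum>r\<in>B - {e}. H r / ((x r - x d) * P r)) - (\<Sum>r\<in>B - {e}. H r / ((x r - x e) * P r))"
    unfolding sum_distrib_right sum_subtractf [symmetric] by (rule sum.cong [OF refl telescope])
  moreover have "H d / ((x d - x e) * P d) * (x d - x e) = H d / P d"
    using de P0 [of d] by simp
  moreover have "H e / ((x e - x d) * P e) * (x d - x e) = - (H e / P e)"
    using de P0 [of e] by (simp add: divide_simps) (simp add: algebra_simps)
  ultimately have "block_sum (insert d B) c h * (x d - x e) = to_fract (?s F) - to_fract F"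
    unfolding F1 F2 R distrib_right by simp
  also have "\<dots> = to_fract (ddiff e d F) * (x d - x e)"
    using ddiff_mult [OF ne, of F] by (simp add: x_def flip: to_fract_diff to_fract_mult)
  finally show ?thesis
    using de by simp
qed

lemma block_sum_singleton: "block_sum {c} c h = to_fract h"
  by (simp add: block_sum_def)

lemma demazure_chain_up:
  assumes "sym_in {a<..a + n} h"
  shows "to_fract (op_prod (map demazure (rev [a..<a + n])) h) = block_sum {a..a + n} a h"
  using assms
proof (induction n)
  case 0
  then show ?case by (simp add: block_sum_singleton)
next
  case (Suc n)
  have "sym_in {a<..a + n} h"
    using Suc.prems by (rule sym_in_mono) auto
  moreover have "insert (Suc (a + n)) {a..a + n} - {a} = {a<..a + Suc n}" by auto
  moreover have "insert (Suc (a + n)) {a..a + n} = {a..a + Suc n}" by auto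
  ultimately show ?case
    using ddiff_block_sum [of "{a..a + n}" a "Suc (a + n)" "a + n" h] Suc by (simp add: demazure_eq)
qed

text \<open>The new node now lies below the old ones, so each \<open>demazure\<close> is a
  \<open>ddiff\<close> with the two indices in the opposite order; every flip costs a sign.\<close>

lemma demazure_chain_down:
  assumes "sym_in {b - n..<b} h" "n \<le> b"
  shows "to_fract (op_prod (map demazure [b - n..<b]) h) = (- 1) ^ n * block_sum {b - n..b} b h"
  using assms
proof (induction n)
  case 0
  then show ?case by (simp add: block_sum_singleton)
next
  case (Suc n)
  let ?F = "op_prod (map demazure [b - n..<b]) h"
  have sym: "sym_in {b - n..<b} h"
    using Suc.prems(1) by (rule sym_in_mono) auto
  have F: "to_fract ((- 1) ^ n * ?F) = block_sum {b - n..b} b h"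
    using Suc.IH [OF sym] Suc.prems by (cases "even n") auto
  have s1: "insert (b - Suc n) {b - n..b} - {b} = {b - Suc n..<b}"
    and s2: "insert (b - Suc n) {b - n..b} = {b - Suc n..b}"
    using Suc.prems(2) by auto
  have sym': "sym_in (insert (b - Suc n) {b - n..b} - {b}) h"
    unfolding s1 by (rule Suc.prems(1))
  have "to_fract (ddiff (b - n) (b - Suc n) ((- 1) ^ n * ?F)) = block_sum {b - Suc n..b} b h"
    using ddiff_block_sum [OF _ _ _ _ sym' F, of "b - n"] Suc.prems unfolding s2 by auto
  moreover have "ddiff (b - n) (b - Suc n) ((- 1) ^ n * ?F) = (- 1) ^ Suc n * ddiff (b - Suc n) (b - n) ?F"
    using ddiff_flip [of "b - Suc n" "b - n"] Suc.prems(2)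
    by (cases "even n") (auto simp: ddiff_uminus)
  moreover have "[b - Suc n..<b] = (b - Suc n) # [b - n..<b]"
    using Suc.prems(2) by (simp add: upt_conv_Cons Suc_diff_Suc)
  moreover have "demazure (b - Suc n) = ddiff (b - Suc n) (b - n)"
    using Suc.prems(2) demazure_eq [of "b - Suc n"] by (simp add: Suc_diff_Suc)
  ultimately show ?case
    by (cases "even n") (auto, metis minus_minus)
qed

section \<open>The symmetrizer\<close>

lemma demazure_braid: "demazure k (demazure (Suc k) (demazure k f)) = demazure (Suc k) (demazure k (demazure (Suc k) f))"
  unfolding demazure_eq Suc_eq_plus1 by (rule ddiff_braid) auto

lemma demazure_far: "Suc k < l \<Longrightarrow> demazure l (demazure k f) = demazure k (demazure l f)"
  unfolding demazure_eq by (rule ddiff_commute) auto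

lemma demazure_far_chain:
  "(\<And>j. j \<in> set js \<Longrightarrow> Suc j < l) \<Longrightarrow>
    demazure l (op_prod (map demazure js) f) = op_prod (map demazure js) (demazure l f)"
  by (induction js) (auto simp: demazure_far)

text \<open>The chain belongs to a long cycle, and commuting past it raises the index by one. For n
  = 0 this is one braid relation, after which the outer operator passes the letters below k; the
  additional letters at the top commute with \<open>demazure k\<close>.\<close>

lemma demazure_chain_commute:
  assumes "a \<le> k"
  shows "demazure k (op_prod (map demazure (rev [a..<k + 2 + n])) f)
    = op_prod (map demazure (rev [a..<k + 2 + n])) (demazure (Suc k) f)"
proof (induction n)
  case 0
  have "demazure (Suc k) (op_prod (map demazure (rev [a..<k])) f) = op_prod (map demazure (rev [a..<k])) (demazure (Suc k) f)"
    by (rule demazure_far_chain) auto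
  then show ?case
    using assms by (simp add: demazure_braid)
next
  case (Suc n)
  have "rev [a..<k + 2 + Suc n] = (k + 2 + n) # rev [a..<k + 2 + n]"
    using assms by simp
  then have chain: "op_prod (map demazure (rev [a..<k + 2 + Suc n])) g
      = demazure (k + 2 + n) (op_prod (map demazure (rev [a..<k + 2 + n])) g)" for g
    by (simp only: list.map op_prod_simps o_apply)
  have far: "demazure k (demazure (k + 2 + n) g) = demazure (k + 2 + n) (demazure k g)" for g
    by (rule demazure_far [symmetric]) simp
  show ?case
    by (simp only: chain far Suc.IH)
qed

section \<open>The longest element and the Vandermonde product\<close>

abbreviation longest_demazure :: "nat \<Rightarrow> nat \<Rightarrow> pol \<Rightarrow> pol" where
  "longest_demazure b n \<equiv> op_prod (map (\<lambda>k. demazure (b + k)) (longest_word n))"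

definition vandermonde :: "nat \<Rightarrow> nat \<Rightarrow> pol" where
  "vandermonde b n = (\<Prod>(k, l)\<in>{(k, l). 1 \<le> k \<and> k < l \<and> l \<le> n}. Var (b + k) - Var (b + l))"

lemma longest_word_Suc: "longest_word (Suc n) = longest_word n @ rev [1..<Suc n]"
  by (cases n) (simp_all add: longest_word_def)

lemma set_longest_word: "set (longest_word n) \<subseteq> {1..<n}"
  by (induction n) (auto simp: longest_word_Suc, simp add: longest_word_def)

lemma map_demazure_shift: "map (\<lambda>k. demazure (b + k)) (rev [1..<Suc n]) = map demazure (rev [Suc b..<Suc b + n])"
  by (induction n) auto

text \<open>
  The defining word ends with a long cycle.  The braid relations move the cycle to the front, so that it acts
  on a polynomial which is already symmetric in all variables but the first.
\<close>

lemma longest_demazure_Suc: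
  "longest_demazure b (Suc n) f = op_prod (map demazure (rev [Suc b..<Suc b + n])) (longest_demazure (Suc b) n f)"
proof -
  let ?C = "op_prod (map demazure (rev [Suc b..<Suc b + n]))"
  have "op_prod (map (\<lambda>k. demazure (b + k)) ks) (?C f) = ?C (op_prod (map (\<lambda>k. demazure (Suc b + k)) ks) f)"
    if "set ks \<subseteq> {1..<n}" for ks
    using that
  proof (induction ks)
    case (Cons k ks)
    then have "b + k + 2 + (n - k - 1) = Suc b + n" by auto
    with demazure_chain_commute [of "Suc b" "b + k" "n - k - 1"] Cons
    show ?case by (simp del: upt_Suc)
  qed simp
  from this [OF set_longest_word] show ?thesis
    by (simp only: longest_word_Suc map_append op_prod_append map_demazure_shift o_apply)
qed

text \<open>After the recursion the inner operator yields a polynomial symmetric in all variables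
  but the first; the chain turns it into a block sum, which is symmetric in all of them.\<close>

lemma sym_in_longest_demazure: "sym_in {Suc b..b + n} (longest_demazure b n f)"
proof (induction n arbitrary: b)
  case 0
  then show ?case by (simp add: sym_in_def)
next
  case (Suc n)
  have *: "{Suc (Suc b)..Suc b + n} = {Suc b<..Suc b + n}" "{Suc b..Suc b + n} - {Suc b} = {Suc b<..Suc b + n}"
    by auto
  have "sym_in {Suc b<..Suc b + n} (longest_demazure (Suc b) n f)"
    using Suc [of "Suc b"] by (simp only: *)
  then show ?case
    unfolding longest_demazure_Suc add_Suc_shift [symmetric]
    by (intro sym_in_block_sum [OF _ _ _ demazure_chain_up]) (simp_all only: *, simp_all)
qed

lemma vandermonde_Suc:
  "vandermonde b (Suc n) = (\<Prod>l\<in>{Suc b<..Suc b + n}. Var (Suc b) - Var l) * vandermonde (Suc b) n"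
proof -
  let ?A = "\<lambda>n. {(k, l). 1 \<le> k \<and> k < l \<and> l \<le> (n::nat)}"
  let ?f = "\<lambda>(k, l). Var (b + k) - Var (b + l)"
  have fin: "finite (?A n)" for n
    by (rule finite_subset [of _ "{..n} \<times> {..n}"]) auto
  have "?A (Suc n) = Pair 1 ` {1<..Suc n} \<union> map_prod Suc Suc ` ?A n"
  proof (intro equalityI subsetI)
    fix z assume "z \<in> ?A (Suc n)"
    then obtain k l where z: "z = (k, l)" "1 \<le> k" "k < l" "l \<le> Suc n" by auto
    show "z \<in> Pair 1 ` {1<..Suc n} \<union> map_prod Suc Suc ` ?A n"
    proof (cases "k = 1")
      case False
      then have "z = map_prod Suc Suc (k - 1, l - 1)" "(k - 1, l - 1) \<in> ?A n"
        using z by auto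
      then show ?thesis by blast
    qed (use z in auto)
  qed auto
  then have "vandermonde b (Suc n) = prod ?f (Pair 1 ` {1<..Suc n}) * prod ?f (map_prod Suc Suc ` ?A n)"
    unfolding vandermonde_def using fin by (simp add: prod.union_disjoint disjoint_iff image_iff)
  also have "prod ?f (Pair 1 ` {1<..Suc n}) = (\<Prod>l\<in>{1<..Suc n}. Var (Suc b) - Var (b + l))"
    by (subst prod.reindex) (auto simp: inj_on_def)
  also have "\<dots> = (\<Prod>l\<in>{Suc b<..Suc b + n}. Var (Suc b) - Var l)"
    by (rule prod.reindex_bij_witness [of _ "\<lambda>l. l - b" "\<lambda>l. b + l"]) auto
  also have "prod ?f (map_prod Suc Suc ` ?A n) = vandermonde (Suc b) n"
    unfolding vandermonde_def by (subst prod.reindex) (auto simp: inj_on_def intro!: prod.cong)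
  finally show ?thesis .
qed

text \<open>The transposition of c and r carries the product in the numerator to the denominator of
  index r, so every summand equals g.\<close>

lemma block_sum_vandermonde:
  assumes "finite B" "c \<in> B" "sym_in B g"
  shows "block_sum B c ((\<Prod>l\<in>B - {c}. Var c - Var l) * g) = to_fract (of_nat (card B) * g)"
proof -
  have "to_fract (rename (transpose c r) ((\<Prod>l\<in>B - {c}. Var c - Var l) * g)) / to_fract (\<Prod>j\<in>B - {r}. Var r - Var j)
      = to_fract g" if r: "r \<in> B" for r
  proof -
    have "rename (transpose c r) (\<Prod>l\<in>B - {c}. Var c - Var l) = (\<Prod>l\<in>B - {c}. Var r - Var (transpose c r l))"
      by simp
    also have "\<dots> = (\<Prod>j\<in>B - {r}. Var r - Var j)"
      by (rule prod.reindex_bij_witness [of _ "transpose c r" "transpose c r"])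
        (use r assms(2) in \<open>auto simp: transpose_def\<close>)
    finally have "rename (transpose c r) ((\<Prod>l\<in>B - {c}. Var c - Var l) * g) = (\<Prod>j\<in>B - {r}. Var r - Var j) * g"
      using assms r by (simp add: sym_inD permutes_swap_id)
    moreover have "(\<Prod>j\<in>B - {r}. Var r - Var j) \<noteq> 0"
      using assms(1) by auto
    ultimately show ?thesis
      by (simp del: to_fract_mult add: to_fract_mult [of "prod _ _"])
  qed
  moreover have "to_fract (of_nat n :: pol) = of_nat n" for n
    by (induction n) auto
  ultimately show ?thesis
    by (simp add: block_sum_def)
qed

text \<open>The factors of the Vandermonde product containing the first variable are symmetric in
  the others and pass through the induction hypothesis as part of g. The outer chain then adds up n
  + 1 equal terms; this is the origin of the factorial in \<open>e_block\<close>.\<close>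

lemma longest_demazure_vandermonde:
  "sym_in {Suc b..b + n} g \<Longrightarrow> longest_demazure b n (vandermonde b n * g) = fact n * g"
proof (induction n arbitrary: b g)
  case 0
  then show ?case by (auto simp: longest_word_def vandermonde_def intro!: prod.neutral)
next
  case (Suc n)
  let ?B = "{Suc b..Suc b + n}"
  let ?h = "(\<Prod>l\<in>?B - {Suc b}. Var (Suc b) - Var l) * (fact n * g)"
  have B: "?B - {Suc b} = {Suc b<..Suc b + n}" by auto
  have sym: "sym_in {Suc b<..Suc b + n} (\<Prod>l\<in>{Suc b<..Suc b + n}. Var (Suc b) - Var l)"
    unfolding sym_in_def
  proof (intro allI impI)
    fix \<pi> assume \<pi>: "\<pi> permutes {Suc b<..Suc b + n}"
    then have "\<pi> (Suc b) = Suc b"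
      by (simp add: permutes_not_in)
    then show "rename \<pi> (\<Prod>l\<in>{Suc b<..Suc b + n}. Var (Suc b) - Var l) = (\<Prod>l\<in>{Suc b<..Suc b + n}. Var (Suc b) - Var l)"
      using prod.reindex_bij_betw [OF permutes_imp_bij [OF \<pi>], of "\<lambda>l. Var (Suc b) - Var l"] by simp
  qed
  have symg: "sym_in {Suc b<..Suc b + n} g"
    using Suc.prems by (rule sym_in_mono) auto
  have fact: "sym_in A (fact n)" for A
    by (metis Cst_of_nat of_nat_fact sym_in_Cst)
  have "sym_in {Suc (Suc b)..Suc b + n} ((\<Prod>l\<in>?B - {Suc b}. Var (Suc b) - Var l) * g)"
    unfolding B unfolding atLeastSucAtMost_greaterThanAtMost by (intro sym_in_mult sym symg)
  from Suc.IH [OF this] have "longest_demazure (Suc b) n (vandermonde b (Suc n) * g) = ?h"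
    by (simp only: vandermonde_Suc B mult_ac)
  then have "longest_demazure b (Suc n) (vandermonde b (Suc n) * g) = op_prod (map demazure (rev [Suc b..<Suc b + n])) ?h"
    by (simp only: longest_demazure_Suc)
  moreover have "to_fract (op_prod (map demazure (rev [Suc b..<Suc b + n])) ?h) = block_sum ?B (Suc b) ?h"
    by (rule demazure_chain_up) (unfold B, intro sym_in_mult sym symg fact)
  moreover have "\<dots> = to_fract (fact (Suc n) * g)"
    using Suc.prems by (subst block_sum_vandermonde) (auto intro!: sym_in_mult fact simp: algebra_simps)
  ultimately show ?case
    by (metis to_fract_eq_iff)
qed

lemma rename_demazure: "inj \<pi> \<Longrightarrow> \<pi> k = k \<Longrightarrow> \<pi> (Suc k) = Suc k \<Longrightarrow> rename \<pi> (demazure k f) = demazure k (rename \<pi> f)"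
  by (simp add: demazure_eq rename_ddiff)

lemma rename_demazure_list:
  assumes "inj \<pi>" "\<And>k. k \<in> set ks \<Longrightarrow> \<pi> (t k) = t k \<and> \<pi> (Suc (t k)) = Suc (t k)"
  shows "rename \<pi> (op_prod (map (\<lambda>k. demazure (t k)) ks) f) = op_prod (map (\<lambda>k. demazure (t k)) ks) (rename \<pi> f)"
  using assms(2) by (induction ks) (auto simp: rename_demazure assms(1))

lemma polys_demazure: "1 \<le> k \<Longrightarrow> k < m \<Longrightarrow> f \<in> polys m \<Longrightarrow> demazure k f \<in> polys m"
  by (simp add: demazure_eq polys_ddiff)

lemma polys_demazure_list:
  "(\<And>k. k \<in> set ks \<Longrightarrow> 1 \<le> t k \<and> t k < m) \<Longrightarrow> f \<in> polys m \<Longrightarrow>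
    op_prod (map (\<lambda>k. demazure (t k)) ks) f \<in> polys m"
  by (induction ks) (auto simp: polys_demazure)

section \<open>Blocks of the word \<open>\<aleph>\<close>\<close>

lemma sorted_list_of_set_split:
  fixes A :: "'b::linorder set"
  assumes "finite A" "i \<in> A"
  shows "sorted_list_of_set A = sorted_list_of_set {j \<in> A. j < i} @ i # sorted_list_of_set {j \<in> A. i < j}"
proof (rule sorted_distinct_set_unique)
  show "sorted (sorted_list_of_set {j \<in> A. j < i} @ i # sorted_list_of_set {j \<in> A. i < j})"
    using assms by (fastforce simp: sorted_append)
qed (use assms in auto)

lemma length_concat_replicate:
  assumes "finite A"
  shows "length (concat (map (\<lambda>i. replicate (v i) i) (sorted_list_of_set A))) = sum v A"
proof -
  have "sum v (set (sorted_list_of_set A)) = sum_list (map v (sorted_list_of_set A))"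
    by (rule sum.distinct_set_conv_list) simp
  then show ?thesis
    using assms by (simp add: length_concat o_def)
qed

context iyangian_datum
begin

abbreviation m where "m \<equiv> total_dim S"
abbreviation letter where "letter l \<equiv> aleph S ! (l - 1)"
abbreviation block where "block i \<equiv> {pos_first S i..pos_last S i}"

lemma finite_Qplus [simp]: "finite (Qplus S)"
  using plus_verts finite_verts by (rule finite_subset)

lemma pos_first_ge_1: "1 \<le> pos_first S i"
  by (simp add: pos_first_def)

lemma pos_last_eq:
  assumes "i \<in> Qplus S"
  shows "pos_last S i = pos_first S i - 1 + vdim S i"
proof -
  have "{j \<in> Qplus S. j \<le> i} = insert i {j \<in> Qplus S. j < i}"
    using assms by auto
  then show ?thesis
    by (simp add: pos_last_def pos_first_def)
qed

lemma aleph_split: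
  assumes "i \<in> Qplus S"
  obtains p q where "aleph S = p @ replicate (vdim S i) i @ q"
    "length p = pos_first S i - 1" "set p \<subseteq> {j \<in> Qplus S. j < i}" "set q \<subseteq> {j \<in> Qplus S. i < j}"
proof
  let ?c = "\<lambda>A. concat (map (\<lambda>i. replicate (vdim S i) i) (sorted_list_of_set A))"
  show "aleph S = ?c {j \<in> Qplus S. j < i} @ replicate (vdim S i) i @ ?c {j \<in> Qplus S. i < j}"
    unfolding aleph_def by (subst sorted_list_of_set_split [OF _ assms]) auto
  show "length (?c {j \<in> Qplus S. j < i}) = pos_first S i - 1"
    by (simp add: length_concat_replicate pos_first_def)
qed auto

lemma length_aleph: "length (aleph S) = m"
  by (simp add: aleph_def length_concat_replicate total_dim_def)

lemma set_aleph: "set (aleph S) \<subseteq> Qplus S"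
  by (auto simp: aleph_def)

lemma letter_in_Qplus: "l \<in> {1..m} \<Longrightarrow> letter l \<in> Qplus S"
  using set_aleph length_aleph nth_mem [of "l - 1" "aleph S"] by auto

text \<open>Describing blocks by letters makes their disjointness immediate and relates them to
  crossing factors, which depend on the letter at a position.\<close>

lemma block_eq:
  assumes "i \<in> Qplus S"
  shows "block i = {l \<in> {1..m}. letter l = i}"
proof -
  obtain p q where al: "aleph S = p @ replicate (vdim S i) i @ q"
    and p: "length p = pos_first S i - 1" "set p \<subseteq> {j \<in> Qplus S. j < i}" and q: "set q \<subseteq> {j \<in> Qplus S. i < j}"
    using aleph_split [OF assms] by blast
  have len: "m = length p + vdim S i + length q"
    using length_aleph by (simp add: al)
  have "letter l = i \<longleftrightarrow> l \<in> block i" if l: "l \<in> {1..m}" for l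
  proof -
    obtain k where k: "l = Suc k"
      using l by (cases l) auto
    obtain b where b: "pos_first S i = Suc b"
      using pos_first_ge_1 [of i] by (cases "pos_first S i") auto
    consider "k < length p" | "length p \<le> k" "k < length p + vdim S i" | "length p + vdim S i \<le> k"
      by linarith
    then show ?thesis
    proof cases
      case 1
      then have "aleph S ! k \<in> set p" by (simp add: al nth_append)
      then have "aleph S ! k \<noteq> i" using p by auto
      with 1 p k b show ?thesis by simp
    next
      case 2
      then have "aleph S ! k = i" by (auto simp: al nth_append)
      with 2 p k b pos_last_eq [OF assms] show ?thesis by simp
    next
      case 3
      then have "aleph S ! k = q ! (k - length p - vdim S i)"
        by (auto simp: al nth_append)
      moreover have "k - length p - vdim S i < length q"
        using 3 l k len by auto
      ultimately have "aleph S ! k \<in> set q" by simp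
      then have "aleph S ! k \<noteq> i" using q by auto
      with 3 p k b pos_last_eq [OF assms] show ?thesis by simp
    qed
  qed
  moreover have "block i \<subseteq> {1..m}"
    using pos_last_eq [OF assms] p(1) len pos_first_ge_1 [of i] by auto
  ultimately show ?thesis by blast
qed

lemma block_subset: "i \<in> Qplus S \<Longrightarrow> block i \<subseteq> {1..m}"
  by (auto simp: block_eq)

lemma block_disjoint: "i \<in> Qplus S \<Longrightarrow> j \<in> Qplus S \<Longrightarrow> i \<noteq> j \<Longrightarrow> block i \<inter> block j = {}"
  by (auto simp: block_eq)

lemma mem_P_sym: "f \<in> P_sym S \<longleftrightarrow> f \<in> polys m \<and> (\<forall>i\<in>Qplus S. sym_in (block i) f)"
  by (auto simp: P_sym_def P_space_def sym_in_def rename_def)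

abbreviation offset where "offset i \<equiv> pos_first S i - 1"

lemma var_index_eq: "1 \<le> k \<Longrightarrow> var_index S i k = offset i + k"
  using pos_first_ge_1 [of i] by (simp add: var_index_def)

lemma block_offset: "i \<in> Qplus S \<Longrightarrow> block i = {Suc (offset i)..offset i + vdim S i}"
  using pos_first_ge_1 [of i] by (simp add: pos_last_eq)

section \<open>The symmetrizer as projection onto the symmetric polynomials\<close>

lemma e_block_eq:
  assumes "i \<in> Qplus S"
  shows "e_block S i f = Cst [:1 / fact (vdim S i):] *
    longest_demazure (offset i) (vdim S i) (vandermonde (offset i) (vdim S i) * f)"
proof -
  have "map (\<lambda>k. demazure (var_index S i k)) (longest_word (vdim S i)) = map (\<lambda>k. demazure (offset i + k)) (longest_word (vdim S i))"
    using set_longest_word [of "vdim S i"] by (auto simp: var_index_eq)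
  moreover have "(\<Prod>(k, l)\<in>{(k, l). 1 \<le> k \<and> k < l \<and> l \<le> vdim S i}. xvar S i k - xvar S i l) = vandermonde (offset i) (vdim S i)"
    unfolding vandermonde_def using assms by (intro prod.cong) (auto simp: xvar_def var_index_eq)
  ultimately show ?thesis
    by (simp only: e_block_def)
qed

lemma sym_in_e_block: "i \<in> Qplus S \<Longrightarrow> sym_in (block i) (e_block S i f)"
  unfolding e_block_eq block_offset by (intro sym_in_mult sym_in_Cst sym_in_longest_demazure)

lemma e_block_sym:
  assumes "i \<in> Qplus S" "sym_in (block i) f"
  shows "e_block S i f = f"
proof -
  have "Cst [:1 / fact (vdim S i):] * fact (vdim S i) = Cst [:1 / fact (vdim S i):] * Cst [:fact (vdim S i):]"
    using Cst_of_nat [of "fact (vdim S i)"] by simp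
  also have "\<dots> = 1"
    by (simp flip: Cst_pCons_mult one_pCons)
  finally show ?thesis
    unfolding e_block_eq [OF assms(1)] using assms
    by (subst longest_demazure_vandermonde) (auto simp: block_offset simp flip: mult.assoc)
qed

lemma polys_vandermonde:
  assumes "i \<in> Qplus S"
  shows "vandermonde (offset i) (vdim S i) \<in> polys m"
proof -
  have "Var (offset i + k) \<in> polys m" if "1 \<le> k" "k \<le> vdim S i" for k
    using that block_subset [OF assms] unfolding block_offset [OF assms] by (intro polys_Var) auto
  then show ?thesis
    unfolding vandermonde_def by (intro polys_prod) auto
qed

lemma offset_letters:
  assumes "i \<in> Qplus S" "k \<in> set (longest_word (vdim S i))"
  shows "offset i + k \<in> block i" "Suc (offset i + k) \<in> block i" "1 \<le> offset i + k" "offset i + k < m"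
proof -
  have k: "1 \<le> k" "k < vdim S i"
    using set_longest_word [of "vdim S i"] assms(2) by auto
  then have "offset i + vdim S i \<in> block i"
    unfolding block_offset [OF assms(1)] by auto
  then have "offset i + vdim S i \<le> m"
    using block_subset [OF assms(1)] by auto
  with k show "1 \<le> offset i + k" "offset i + k < m"
    by auto
  show "offset i + k \<in> block i" "Suc (offset i + k) \<in> block i"
    unfolding block_offset [OF assms(1)] using k by auto
qed

lemma polys_e_block:
  assumes "i \<in> Qplus S" "f \<in> polys m"
  shows "e_block S i f \<in> polys m"
  unfolding e_block_eq [OF assms(1)]
  by (intro polys_mult polys_Cst polys_demazure_list polys_vandermonde assms)
    (use offset_letters(3,4) [OF assms(1)] in auto)

lemma rename_e_block:
  assumes "i \<in> Qplus S" "j \<in> Qplus S" "i \<noteq> j" "\<pi> permutes block j"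
  shows "rename \<pi> (e_block S i f) = e_block S i (rename \<pi> f)"
proof -
  have fixed: "\<pi> l = l" if "l \<in> block i" for l
    using that assms block_disjoint [of i j] by (intro permutes_not_in [OF assms(4)]) auto
  have "rename \<pi> (vandermonde (offset i) (vdim S i)) = vandermonde (offset i) (vdim S i)"
    unfolding vandermonde_def rename_simps
    using assms(1) by (intro prod.cong refl) (auto simp: fixed block_offset)
  moreover have "rename \<pi> (longest_demazure (offset i) (vdim S i) g) = longest_demazure (offset i) (vdim S i) (rename \<pi> g)" for g
    using assms(1,4) offset_letters(1,2) by (intro rename_demazure_list) (auto simp: fixed permutes_inj)
  ultimately show ?thesis
    by (simp add: e_block_eq assms(1))
qed

lemma polys_e_blocks:
  "set js \<subseteq> Qplus S \<Longrightarrow> f \<in> polys m \<Longrightarrow> op_prod (map (e_block S) js) f \<in> polys m"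
  by (induction js) (auto simp: polys_e_block)

text \<open>The operator of one block commutes with the permutations of any other block, so symmetry
  once obtained is not lost.\<close>

lemma sym_in_e_blocks:
  "set js \<subseteq> Qplus S \<Longrightarrow> j \<in> set js \<Longrightarrow> sym_in (block j) (op_prod (map (e_block S) js) f)"
proof (induction js)
  case (Cons i js)
  show ?case
  proof (cases "j = i")
    case True
    then show ?thesis using Cons.prems by (simp add: sym_in_e_block)
  next
    case False
    then have "sym_in (block j) (op_prod (map (e_block S) js) f)" "i \<in> Qplus S" "j \<in> Qplus S"
      using Cons by auto
    with False rename_e_block [of i j] show ?thesis
      by (simp add: sym_in_def)
  qed
qed simp

lemma e_Sigma_in_P_sym: "f \<in> polys m \<Longrightarrow> e_Sigma S f \<in> P_sym S"
  by (auto simp: mem_P_sym e_Sigma_def P_space_def polys_e_blocks sym_in_e_blocks)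

lemma e_Sigma_P_sym:
  assumes "f \<in> P_sym S"
  shows "e_Sigma S f = f"
proof -
  have "op_prod (map (e_block S) js) f = f" if "set js \<subseteq> Qplus S" for js
    using that assms by (induction js) (auto simp: mem_P_sym e_block_sym)
  then show ?thesis
    using assms by (simp add: e_Sigma_def P_space_def mem_P_sym)
qed

end

section \<open>Operators of the KLR iYangian on single summands\<close>

lemma summandwise_single:
  "\<phi> w 0 = 0 \<Longrightarrow> summandwise g \<phi> (Poly_Mapping.single w f) = Poly_Mapping.single (g w) (\<phi> w f)"
  by (cases "f = 0") (simp_all add: summandwise_def)

lemma pol_scale_single: "pol_scale c (Poly_Mapping.single w f) = Poly_Mapping.single w (Cst c * f)"
  by (simp add: pol_scale_def)

lemma idem_single: "idem w (Poly_Mapping.single w f) = Poly_Mapping.single w f"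
  by (simp add: idem_def)

lemma swap_word_split: "swap_word (Suc (length p)) (p @ x # y # q) = p @ y # x # q"
  by (simp add: swap_word_def list_update_append nth_append)

text \<open>The cycle by which variables are renamed when a strand passes from position a to
  position e and the strands in between step back; \<open>rotate_left\<close> is its inverse when
  \<open>a \<le> e\<close>.\<close>

definition rotate_right :: "nat \<Rightarrow> nat \<Rightarrow> nat \<Rightarrow> nat" where
  "rotate_right a e n = (if n = a then e else if a < n \<and> n \<le> e then n - 1 else n)"

definition rotate_left :: "nat \<Rightarrow> nat \<Rightarrow> nat \<Rightarrow> nat" where
  "rotate_left a e n = (if n = e then a else if a \<le> n \<and> n < e then n + 1 else n)"

lemma transpose_rotate_right: "a \<le> e \<Longrightarrow> transpose e (Suc e) \<circ> rotate_right a e = rotate_right a (Suc e)"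
  by (auto simp: fun_eq_iff rotate_right_def transpose_def)

lemma transpose_rotate_left: "Suc a \<le> e \<Longrightarrow> transpose a (Suc a) \<circ> rotate_left (Suc a) e = rotate_left a e"
  by (auto simp: fun_eq_iff rotate_left_def transpose_def)

lemma rotate_trivial: "rotate_right a a = id" "rotate_left a a = id"
  by (auto simp: fun_eq_iff rotate_right_def rotate_left_def)

lemma rename_Xbar: "rename \<pi> (Xbar S x y u v) = Xbar S x y (rename \<pi> u) (rename \<pi> v)"
  by (simp add: Xbar_def)

context iyangian_datum
begin

text \<open>
  The operators of the generators are defined on all of \<open>Pol\<close>, whereas the elements of \<open>KLR_iYangian\<close> are
  extensional and contain an idempotent; the last conjunct provides an element of the algebra with the same
  effect on the \<open>w\<close>-summand.
\<close>

definition realizes :: "('v polrep \<Rightarrow> 'v polrep) \<Rightarrow> 'v list \<Rightarrow> (pol \<Rightarrow> pol) \<Rightarrow> 'v list \<Rightarrow> bool" where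
  "realizes A w \<phi> w' \<longleftrightarrow> w \<in> lists (verts (quiver S)) \<and> w' \<in> lists (verts (quiver S)) \<and>
    (\<forall>f\<in>polys (length w). \<phi> f \<in> polys (length w') \<and>
      A (Poly_Mapping.single w f) = Poly_Mapping.single w' (\<phi> f)) \<and>
    (\<exists>B\<in>KLR_iYangian S. \<forall>f\<in>polys (length w). B (Poly_Mapping.single w f) = Poly_Mapping.single w' (\<phi> f))"

lemma single_in_Pol:
  "w \<in> lists (verts (quiver S)) \<Longrightarrow> f \<in> polys (length w) \<Longrightarrow> Poly_Mapping.single w f \<in> Pol S"
  by (simp add: Pol_def)

lemma realizesI:
  assumes "w \<in> lists (verts (quiver S))" "w' \<in> lists (verts (quiver S))"
    and "\<And>f. f \<in> polys (length w) \<Longrightarrow> \<phi> f \<in> polys (length w')"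
    and "\<And>f. f \<in> polys (length w) \<Longrightarrow> A (Poly_Mapping.single w f) = Poly_Mapping.single w' (\<phi> f)"
    and "B \<in> KLR_iYangian S"
    and "\<And>f. f \<in> polys (length w) \<Longrightarrow> B (Poly_Mapping.single w f) = Poly_Mapping.single w' (\<phi> f)"
  shows "realizes A w \<phi> w'"
  unfolding realizes_def using assms(1-4) by (intro conjI ballI bexI [OF _ assms(5)] assms(6)) simp_all

lemma realizesD:
  assumes "realizes A w \<phi> w'"
  shows "w \<in> lists (verts (quiver S))" "w' \<in> lists (verts (quiver S))"
    and "f \<in> polys (length w) \<Longrightarrow> \<phi> f \<in> polys (length w')"
    and "f \<in> polys (length w) \<Longrightarrow> A (Poly_Mapping.single w f) = Poly_Mapping.single w' (\<phi> f)"
  using assms by (simp_all add: realizes_def)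

lemma realizesE:
  assumes "realizes A w \<phi> w'"
  obtains B where "B \<in> KLR_iYangian S"
    "\<And>f. f \<in> polys (length w) \<Longrightarrow> B (Poly_Mapping.single w f) = Poly_Mapping.single w' (\<phi> f)"
  using assms unfolding realizes_def by blast

lemma realizes_comp:
  assumes A: "realizes A w \<phi> w'" and B: "realizes B w' \<psi> w''"
  shows "realizes (B \<circ> A) w (\<psi> \<circ> \<phi>) w''"
proof -
  from A obtain A' where A': "A' \<in> KLR_iYangian S"
    "\<And>f. f \<in> polys (length w) \<Longrightarrow> A' (Poly_Mapping.single w f) = Poly_Mapping.single w' (\<phi> f)"
    by (rule realizesE) (rule that)
  from B obtain B' where B': "B' \<in> KLR_iYangian S"
    "\<And>f. f \<in> polys (length w') \<Longrightarrow> B' (Poly_Mapping.single w' f) = Poly_Mapping.single w'' (\<psi> f)"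
    by (rule realizesE) (rule that)
  show ?thesis
  proof (rule realizesI)
    show "(\<lambda>F\<in>Pol S. B' (A' F)) \<in> KLR_iYangian S"
      using B'(1) A'(1) unfolding KLR_iYangian_def by (rule gen_algebra.mult)
  qed (simp_all add: realizesD [OF A] realizesD [OF B] A'(2) B'(2) single_in_Pol)
qed

lemma realizes_cong:
  assumes "realizes A w \<phi> w'" "\<And>f. f \<in> polys (length w) \<Longrightarrow> \<phi> f = \<psi> f"
  shows "realizes A w \<psi> w'"
  using assms unfolding realizes_def by simp

lemma realizes_add:
  assumes A: "realizes A w \<phi> w'" and B: "realizes B w \<psi> w'"
  shows "realizes (\<lambda>F. A F + B F) w (\<lambda>f. \<phi> f + \<psi> f) w'"
proof -
  from A obtain A' where A': "A' \<in> KLR_iYangian S"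
    "\<And>f. f \<in> polys (length w) \<Longrightarrow> A' (Poly_Mapping.single w f) = Poly_Mapping.single w' (\<phi> f)"
    by (rule realizesE) (rule that)
  from B obtain B' where B': "B' \<in> KLR_iYangian S"
    "\<And>f. f \<in> polys (length w) \<Longrightarrow> B' (Poly_Mapping.single w f) = Poly_Mapping.single w' (\<psi> f)"
    by (rule realizesE) (rule that)
  show ?thesis
  proof (rule realizesI)
    show "(\<lambda>F\<in>Pol S. A' F + B' F) \<in> KLR_iYangian S"
      using A'(1) B'(1) unfolding KLR_iYangian_def by (rule gen_algebra.add)
  qed (simp_all add: realizesD [OF A] realizesD [OF B] A'(2) B'(2) single_in_Pol single_add)
qed

lemma realizes_scale:
  assumes A: "realizes A w \<phi> w'"
  shows "realizes (\<lambda>F. pol_scale c (A F)) w (\<lambda>f. Cst c * \<phi> f) w'"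
proof -
  from A obtain A' where A': "A' \<in> KLR_iYangian S"
    "\<And>f. f \<in> polys (length w) \<Longrightarrow> A' (Poly_Mapping.single w f) = Poly_Mapping.single w' (\<phi> f)"
    by (rule realizesE) (rule that)
  show ?thesis
  proof (rule realizesI)
    show "(\<lambda>F\<in>Pol S. pol_scale c (A' F)) \<in> KLR_iYangian S"
      using A'(1) unfolding KLR_iYangian_def by (rule gen_algebra.scale)
  qed (simp_all add: realizesD [OF A] A'(2) single_in_Pol pol_scale_single)
qed

lemma realizes_generator:
  assumes "restrict (A \<circ> idem w) (Pol S) \<in> KLR_iYangian S"
    and "w \<in> lists (verts (quiver S))" "w' \<in> lists (verts (quiver S))"
    and "\<And>f. f \<in> polys (length w) \<Longrightarrow> \<phi> f \<in> polys (length w')"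
    and "\<And>f. A (Poly_Mapping.single w f) = Poly_Mapping.single w' (\<phi> f)"
  shows "realizes A w \<phi> w'"
  using assms by (intro realizesI [OF _ _ _ _ assms(1)]) (simp_all add: idem_single single_in_Pol)

lemma realizes_idem:
  assumes "w \<in> lists (verts (quiver S))"
  shows "realizes (idem w) w id w"
proof (rule realizes_generator)
  have "restrict (idem w) (Pol S) \<in> KLR_iYangian S"
    unfolding KLR_iYangian_def by (rule gen_algebra.gen) (use assms in blast)
  moreover have "idem w \<circ> idem w = idem w"
    by (simp add: fun_eq_iff idem_def)
  ultimately show "restrict (idem w \<circ> idem w) (Pol S) \<in> KLR_iYangian S"
    by simp
qed (use assms in \<open>auto simp: idem_single\<close>)

lemma realizes_id:
  assumes "w \<in> lists (verts (quiver S))"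
  shows "realizes id w id w"
  using realizes_idem [OF assms] by (simp add: realizes_def idem_single)

lemma realizes_dot:
  assumes "w \<in> lists (verts (quiver S))" "1 \<le> k" "k \<le> length w"
  shows "realizes (dot k) w (\<lambda>f. Var k * f) w"
proof (rule realizes_generator)
  show "restrict (dot k \<circ> idem w) (Pol S) \<in> KLR_iYangian S"
    unfolding KLR_iYangian_def by (rule gen_algebra.gen) (use assms in blast)
qed (use assms in \<open>auto simp: dot_def summandwise_single\<close>)

lemma demazure_0 [simp]: "demazure k 0 = 0"
  by (simp add: demazure_eq ddiff_0)

lemma restrict_sigma:
  assumes "w \<in> lists (verts (quiver S))" "1 \<le> k" "k < length w"
  shows "restrict (sigma S k \<circ> idem w) (Pol S) \<in> KLR_iYangian S"
  unfolding KLR_iYangian_def by (rule gen_algebra.gen) (use assms in blast)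

lemma realizes_sigma_eq:
  assumes "w \<in> lists (verts (quiver S))" "1 \<le> k" "k < length w" "w ! (k - 1) = w ! k"
  shows "realizes (sigma S k) w (demazure k) w"
proof (rule realizes_generator [OF restrict_sigma])
  have "swap_word k w = w"
    using assms(3,4) by (simp add: swap_word_def) (metis assms(4) list_update_id One_nat_def)
  then show "sigma S k (Poly_Mapping.single w f) = Poly_Mapping.single w (demazure k f)" for f
    using assms by (simp add: sigma_def summandwise_single)
qed (use assms in \<open>auto simp: polys_demazure\<close>)

lemma polys_Xbar: "u \<in> polys n \<Longrightarrow> v \<in> polys n \<Longrightarrow> Xbar S x y u v \<in> polys n"
  by (simp add: Xbar_def)

lemma realizes_sigma_neq:
  assumes "p @ x # y # q \<in> lists (verts (quiver S))" "x \<noteq> y" and k: "k = Suc (length p)"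
  shows "realizes (sigma S k) (p @ x # y # q)
    (\<lambda>f. Xbar S x y (Var (Suc k)) (Var k) * rename (transpose k (Suc k)) f) (p @ y # x # q)"
proof (rule realizes_generator [OF restrict_sigma])
  show "sigma S k (Poly_Mapping.single (p @ x # y # q) f) = Poly_Mapping.single (p @ y # x # q)
      (Xbar S x y (Var (Suc k)) (Var k) * rename (transpose k (Suc k)) f)" for f
    using assms by (simp add: sigma_def summandwise_single nth_append swap_word_split swap_vars_eq rename_Xbar)
qed (use assms in \<open>auto intro!: polys_mult polys_Xbar polys_rename simp: transpose_def\<close>)

lemma realizes_rho_L:
  assumes "x # u \<in> lists (verts (quiver S))"
    and "poly (p_poly S (tau S x)) (Var 1) \<in> polys (Suc (length u))"
  shows "realizes (rho_L S) (x # u)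
    (\<lambda>f. poly (p_poly S (tau S x)) (Var 1) * subst (Var(1 := - Var 1 + hbar)) f) (tau S x # u)"
proof (rule realizes_generator)
  show "restrict (rho_L S \<circ> idem (x # u)) (Pol S) \<in> KLR_iYangian S"
    unfolding KLR_iYangian_def by (rule gen_algebra.gen) (use assms in blast)
qed (use assms tau_vert in \<open>auto simp: rho_L_def summandwise_single intro!: polys_mult polys_subst\<close>)

lemma realizes_rho_R:
  assumes "u @ [x] \<in> lists (verts (quiver S))" "n = Suc (length u)"
  shows "realizes (rho_R S) (u @ [x]) (subst (Var(n := - Var n))) (u @ [tau S x])"
proof (rule realizes_generator)
  show "restrict (rho_R S \<circ> idem (u @ [x])) (Pol S) \<in> KLR_iYangian S"
    unfolding KLR_iYangian_def by (rule gen_algebra.gen) (use assms in blast)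
qed (use assms tau_vert in \<open>auto simp: rho_R_def summandwise_single intro!: polys_subst\<close>)

lemma realizes_demazure_list:
  assumes "w \<in> lists (verts (quiver S))"
    and "\<And>k. k \<in> set ks \<Longrightarrow> 1 \<le> k \<and> k < length w \<and> w ! (k - 1) = w ! k"
  shows "realizes (op_prod (map (sigma S) ks)) w (op_prod (map demazure ks)) w"
  using assms(2)
proof (induction ks)
  case Nil
  then show ?case unfolding list.map op_prod_simps by (intro realizes_id assms(1))
next
  case (Cons k ks)
  have IH: "realizes (op_prod (map (sigma S) ks)) w (op_prod (map demazure ks)) w"
    by (rule Cons.IH) (use Cons.prems in auto)
  have k: "1 \<le> k" "k < length w" "w ! (k - 1) = w ! k"
    using Cons.prems [of k] by auto
  show ?case
    unfolding list.map op_prod_simps by (rule realizes_comp [OF IH realizes_sigma_eq [OF assms(1) k]])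
qed

text \<open>As x does not occur in u, all crossings are between different colours. A factor
  collected early is carried along by the later crossings, so in the end each factor involves the
  final position e of the moving strand and the final position a + l of the strand it
  crossed.\<close>

lemma realizes_move_right:
  assumes "p @ x # u @ q \<in> lists (verts (quiver S))" "x \<notin> set u" "a = Suc (length p)" "e = a + length u"
  shows "realizes (op_prod (map (sigma S) (rev [a..<e]))) (p @ x # u @ q)
    (\<lambda>f. (\<Prod>l<length u. Xbar S x (u ! l) (Var e) (Var (a + l))) * rename (rotate_right a e) f) (p @ u @ x # q)"
  using assms
proof (induction u arbitrary: q e rule: rev_induct)
  case Nil
  have "realizes id (p @ x # q) id (p @ x # q)"
    using Nil.prems by (intro realizes_id) simp
  then have "realizes id (p @ x # q)
      (\<lambda>f. (\<Prod>l<length []. Xbar S x ([] ! l) (Var e) (Var (a + l))) * rename (rotate_right a e) f) (p @ x # q)"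
    by (rule realizes_cong) (use Nil.prems in \<open>simp add: rotate_trivial\<close>)
  moreover have "rev [a..<e] = []"
    using Nil.prems by simp
  ultimately show ?case
    by (simp only: list.map op_prod_simps append.simps)
next
  case (snoc y u)
  define e' where "e' = a + length u"
  let ?\<phi> = "\<lambda>f. (\<Prod>l<length u. Xbar S x (u ! l) (Var e') (Var (a + l))) * rename (rotate_right a e') f"
  have e: "e = Suc e'" and ops: "rev [a..<e] = e' # rev [a..<e']"
    using snoc.prems by (simp_all add: e'_def)
  have 1: "realizes (op_prod (map (sigma S) (rev [a..<e']))) (p @ x # u @ y # q) ?\<phi> (p @ u @ x # y # q)"
    using snoc.prems by (intro snoc.IH) (auto simp: e'_def)
  have 2: "realizes (sigma S e') ((p @ u) @ x # y # q)
      (\<lambda>f. Xbar S x y (Var (Suc e')) (Var e') * rename (transpose e' (Suc e')) f) ((p @ u) @ y # x # q)"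
    using snoc.prems by (intro realizes_sigma_neq) (auto simp: e'_def)
  have "realizes (sigma S e' \<circ> op_prod (map (sigma S) (rev [a..<e']))) (p @ x # u @ y # q)
      ((\<lambda>f. Xbar S x y (Var (Suc e')) (Var e') * rename (transpose e' (Suc e')) f) \<circ> ?\<phi>) (p @ u @ y # x # q)"
    using realizes_comp [OF 1] 2 by simp
  then have "realizes (sigma S e' \<circ> op_prod (map (sigma S) (rev [a..<e']))) (p @ x # u @ y # q)
     (\<lambda>f. (\<Prod>l<length (u @ [y]). Xbar S x ((u @ [y]) ! l) (Var e) (Var (a + l))) * rename (rotate_right a e) f)
     (p @ u @ y # x # q)"
  proof (rule realizes_cong)
    fix f
    have "rename (transpose e' (Suc e')) (\<Prod>l<length u. Xbar S x (u ! l) (Var e') (Var (a + l)))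
        = (\<Prod>l<length u. Xbar S x ((u @ [y]) ! l) (Var e) (Var (a + l)))"
      unfolding rename_simps rename_Xbar
      by (intro prod.cong refl) (auto simp: e e'_def transpose_def nth_append)
    moreover have "rename (transpose e' (Suc e')) (rename (rotate_right a e') f) = rename (rotate_right a e) f"
      by (simp add: rename_rename transpose_rotate_right e'_def e)
    ultimately show "((\<lambda>f. Xbar S x y (Var (Suc e')) (Var e') * rename (transpose e' (Suc e')) f) \<circ> ?\<phi>) f =
        (\<Prod>l<length (u @ [y]). Xbar S x ((u @ [y]) ! l) (Var e) (Var (a + l))) * rename (rotate_right a e) f"
      by (simp add: e e'_def mult_ac)
  qed
  then show ?case
    by (simp only: ops list.map op_prod_simps append_assoc append.simps)
qed

lemma realizes_move_right_free:
  assumes "p @ x # u @ q \<in> lists (verts (quiver S))" "x \<notin> set u" "a = Suc (length p)" "e = a + length u"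
    "\<And>y. y \<in> set u \<Longrightarrow> \<not> arrow S y x"
  shows "realizes (op_prod (map (sigma S) (rev [a..<e]))) (p @ x # u @ q)
    (rename (rotate_right a e)) (p @ u @ x # q)"
  using realizes_move_right [OF assms(1-4)] by (rule realizes_cong) (auto simp: Xbar_def assms(5))

lemma realizes_move_left_free:
  assumes "p @ u @ x # q \<in> lists (verts (quiver S))" "x \<notin> set u" "a = Suc (length p)" "e = a + length u"
    "\<And>y. y \<in> set u \<Longrightarrow> \<not> arrow S x y"
  shows "realizes (op_prod (map (sigma S) [a..<e])) (p @ u @ x # q)
    (rename (rotate_left a e)) (p @ x # u @ q)"
  using assms
proof (induction u arbitrary: p a)
  case Nil
  have "realizes id (p @ x # q) id (p @ x # q)"
    using Nil.prems by (intro realizes_id) simp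
  then have "realizes id (p @ x # q) (rename (rotate_left a e)) (p @ x # q)"
    by (rule realizes_cong) (use Nil.prems in \<open>simp add: rotate_trivial\<close>)
  moreover have "[a..<e] = []"
    using Nil.prems by simp
  ultimately show ?case
    by (simp only: list.map op_prod_simps append.simps)
next
  case (Cons y u)
  have ops: "[a..<e] = a # [Suc a..<e]"
    using Cons.prems by (intro upt_conv_Cons) simp
  have 1: "realizes (op_prod (map (sigma S) [Suc a..<e])) ((p @ [y]) @ u @ x # q) (rename (rotate_left (Suc a) e)) ((p @ [y]) @ x # u @ q)"
    using Cons.prems by (intro Cons.IH) auto
  have 2: "realizes (sigma S a) (p @ y # x # u @ q)
      (\<lambda>f. Xbar S y x (Var (Suc a)) (Var a) * rename (transpose a (Suc a)) f) (p @ x # y # u @ q)"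
    using Cons.prems by (intro realizes_sigma_neq) auto
  have "realizes (sigma S a \<circ> op_prod (map (sigma S) [Suc a..<e])) ((p @ [y]) @ u @ x # q)
     ((\<lambda>f. Xbar S y x (Var (Suc a)) (Var a) * rename (transpose a (Suc a)) f) \<circ> rename (rotate_left (Suc a) e)) (p @ x # y # u @ q)"
    using realizes_comp [OF 1] 2 by simp
  then have "realizes (sigma S a \<circ> op_prod (map (sigma S) [Suc a..<e])) ((p @ [y]) @ u @ x # q)
     (rename (rotate_left a e)) (p @ x # y # u @ q)"
    by (rule realizes_cong) (use Cons.prems in \<open>simp add: Xbar_def rename_rename transpose_rotate_left\<close>)
  then show ?case
    by (simp only: ops list.map op_prod_simps append_assoc append.simps)
qed

end

lemma upt_split: "i \<le> j \<Longrightarrow> j \<le> k \<Longrightarrow> [i..<k] = [i..<j] @ [j..<k]"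
  by (metis le_add_diff_inverse upt_add_eq_append)

lemma poly_p_poly: "poly (p_poly S j) x = (\<Prod>c\<in>#params S j. x - Cst [:0, c:])"
  by (simp add: p_poly_def poly_prod_mset image_mset.compositionality o_def)

lemma subst_p_poly [simp]: "subst g (poly (p_poly S j) x) = poly (p_poly S j) (subst g x)"
proof -
  have "subst g (\<Prod>c\<in>#M. x - Cst [:0, c:]) = (\<Prod>c\<in>#M. subst g x - Cst [:0, c:])" for M
    by (induction M) auto
  then show ?thesis by (simp add: poly_p_poly)
qed

lemma rename_p_poly [simp]: "rename \<pi> (poly (p_poly S j) x) = poly (p_poly S j) (rename \<pi> x)"
  by (simp add: rename_def)

lemma polys_p_poly: "x \<in> polys n \<Longrightarrow> poly (p_poly S j) x \<in> polys n"
proof -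
  assume "x \<in> polys n"
  then have "(\<Prod>c\<in>#M. x - Cst [:0, c:]) \<in> polys n" for M
    by (induction M) auto
  then show ?thesis by (simp add: poly_p_poly)
qed

context iyangian_datum
begin

lemma on_aleph_realizes:
  "realizes A (aleph S) \<phi> (aleph S) \<Longrightarrow> f \<in> polys m \<Longrightarrow> on_aleph S A f = \<phi> f"
  by (simp add: on_aleph_def P_space_def realizes_def length_aleph)

lemma realizes_corner:
  assumes "realizes A (aleph S) \<phi> (aleph S)"
  shows "restrict \<phi> (P_space S) \<in> KLR_corner S"
proof -
  from assms obtain B where B: "B \<in> KLR_iYangian S"
    "\<And>f. f \<in> polys (length (aleph S)) \<Longrightarrow> B (Poly_Mapping.single (aleph S) f) = Poly_Mapping.single (aleph S) (\<phi> f)"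
    by (rule realizesE) (rule that)
  have "on_aleph S (idem (aleph S) \<circ> B \<circ> idem (aleph S)) = restrict \<phi> (P_space S)"
    using B(2) by (auto simp: on_aleph_def P_space_def length_aleph idem_single fun_eq_iff)
  then show ?thesis
    using B(1) unfolding KLR_corner_def
    by (intro image_eqI [where x = "idem (aleph S) \<circ> B \<circ> idem (aleph S)"]) auto
qed

lemma aleph_in_lists: "aleph S \<in> lists (verts (quiver S))"
  using set_aleph plus_verts by auto

lemma realizes_mult_poly:
  assumes "w \<in> lists (verts (quiver S))" "g \<in> polys (length w)"
  shows "\<exists>A. realizes A w (\<lambda>f. g * f) w"
  using assms(2)
proof (induction rule: polys_induct)
  case (Cst c)
  show ?case
    using realizes_scale [OF realizes_id [OF assms(1)], of c] by auto
next
  case (Var n)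
  then show ?case
    using realizes_dot [OF assms(1)] by blast
next
  case (add f g)
  then show ?case
    using realizes_add unfolding distrib_right by blast
next
  case (mult f g)
  then show ?case
    using realizes_comp unfolding o_def mult.assoc by blast
qed

lemma realizes_dot_plus:
  assumes "w \<in> lists (verts (quiver S))" "1 \<le> k" "k \<le> length w"
  shows "realizes (dot_plus k c) w (\<lambda>f. (Var k + Cst c) * f) w"
  using realizes_add [OF realizes_dot [OF assms] realizes_scale [OF realizes_id [OF assms(1)], of c]]
  unfolding dot_plus_def [abs_def] by (simp add: distrib_right)

lemma realizes_dot_plus_power:
  assumes "w \<in> lists (verts (quiver S))" "1 \<le> k" "k \<le> length w"
  shows "realizes (dot_plus k c ^^ r) w (\<lambda>f. (Var k + Cst c) ^ r * f) w"
proof (induction r)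
  case 0
  show ?case using realizes_id [OF assms(1)] by (simp add: id_def)
next
  case (Suc r)
  show ?case
    unfolding funpow.simps
    by (rule realizes_cong [OF realizes_comp [OF Suc realizes_dot_plus [OF assms]]]) (simp add: mult.assoc)
qed

section \<open>Strands going around both mirrors\<close>

lemma arrow_plus_minus: "arrow S x y \<Longrightarrow> x \<in> Qplus S \<and> y \<in> verts (quiver S) \<and> y \<notin> Qplus S"
  using arc_plus_minus by (auto simp: arcs_ends_def arc_to_ends_def)

lemma tau_Qplus: "i \<in> Qplus S \<Longrightarrow> tau S i \<in> verts (quiver S) \<and> tau S i \<notin> Qplus S"
  using tau_plus by blast

text \<open>The word is cut in two ways because the strand leaves its block at one end and comes
  back to it at the other: first to last letter for \<open>D_loop S i\<close>, last to first for
  \<open>D_loop S (tau S i)\<close>.\<close>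

lemma loop_word:
  assumes i: "i \<in> Qplus S" "vdim S i > 0"
  obtains p v q where "aleph S = p @ i # replicate v i @ q" "aleph S = (p @ replicate v i) @ i # q"
    "vdim S i = Suc v" "pos_first S i = Suc (length p)" "pos_last S i = Suc (length p + v)"
    "m = Suc (length p + v + length q)" "i \<notin> set p" "i \<notin> set q"
    "set (p @ replicate v i @ q) \<subseteq> Qplus S"
proof -
  obtain p q where al: "aleph S = p @ replicate (vdim S i) i @ q"
    and p: "length p = pos_first S i - 1" "set p \<subseteq> {j \<in> Qplus S. j < i}" and q: "set q \<subseteq> {j \<in> Qplus S. i < j}"
    using aleph_split [OF i(1)] by blast
  obtain v where v: "vdim S i = Suc v"
    using i(2) gr0_conv_Suc by blast
  have "replicate (Suc v) i = replicate v i @ [i]"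
    by (simp add: replicate_append_same)
  then have "aleph S = p @ i # replicate v i @ q" "aleph S = (p @ replicate v i) @ i # q"
    using al unfolding v by simp_all
  moreover have "pos_first S i = Suc (length p)"
    using p(1) pos_first_ge_1 [of i] by simp
  moreover have "pos_last S i = Suc (length p + v)"
    using pos_last_eq [OF i(1)] v p(1) by simp
  moreover have "m = Suc (length p + v + length q)"
    using length_aleph al v by simp
  ultimately show ?thesis
    using p q v i by (intro that [of p v q]) auto
qed

lemma letter_remove:
  assumes "N \<in> {1..m}" "l < m - 1"
  shows "rotate_left N m (Suc l) \<in> {1..m} - {N}"
    "(take (N - 1) (aleph S) @ drop N (aleph S)) ! l = letter (rotate_left N m (Suc l))"
  using assms length_aleph by (auto simp: rotate_left_def nth_append)

text \<open>While one strand is away the others are numbered consecutively;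
  \<open>rotate_left N m\<close> reinserts the gap at N when the strand returns there.\<close>

lemma prod_remove_letter:
  assumes "N \<in> {1..m}"
  shows "(\<Prod>l<m - 1. F ((take (N - 1) (aleph S) @ drop N (aleph S)) ! l) (rotate_left N m (Suc l)))
    = (\<Prod>l\<in>{1..m} - {N}. F (letter l) l)"
proof -
  have "(\<Prod>l<m - 1. F ((take (N - 1) (aleph S) @ drop N (aleph S)) ! l) (rotate_left N m (Suc l)))
      = (\<Prod>l<m - 1. F (letter (rotate_left N m (Suc l))) (rotate_left N m (Suc l)))"
    by (intro prod.cong refl) (simp only: lessThan_iff letter_remove(2) [OF assms])
  \<comment> \<open>The crossings are counted from 0 and positions from 1, and beyond N the removed
    letter shifts the count once more; hence l - 1 and l - 2 in the inverse bijection.\<close>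
  also have "\<dots> = (\<Prod>l\<in>{1..m} - {N}. F (letter l) l)"
    by (rule prod.reindex_bij_witness [of _ "\<lambda>l. if l < N then l - 1 else l - 2" "\<lambda>l. rotate_left N m (Suc l)"])
      (use assms in \<open>auto simp: rotate_left_def\<close>)
  finally show ?thesis .
qed

text \<open>A crossing gives \<open>Var m - Var l - half_hbar\<close>; the right mirror negates
  \<open>Var m\<close>, which then becomes \<open>Var N\<close>. The result is the negative of
  \<open>(Var N + half_hbar) + Var l\<close>, a factor of a V-polynomial of negated
  variables.\<close>

definition loop_factor :: "'v \<Rightarrow> nat \<Rightarrow> pol" where
  "loop_factor i N = (\<Prod>l\<in>{1..m} - {N}.
     if arrow S (letter l) (tau S i) then - Var N - Var l - half_hbar else 1)"

text \<open>The strand leaves its block on the left and re-enters it from the right, so it meets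
  strands of its own colour only at the very end. In between it has colour \<open>tau S i\<close>
  from the left to the right mirror, where all crossing factors arise. Reflecting first by -X +
  \<hbar> and then by -X gives the shift X + \<hbar>.\<close>

lemma realizes_D_loop_plus:
  assumes i: "i \<in> Qplus S" "vdim S i > 0"
  defines "a \<equiv> pos_first S i" and "N \<equiv> pos_last S i"
  shows "realizes (D_loop S i) (aleph S) (\<lambda>f. op_prod (map demazure [a..<N])
    (loop_factor i N * poly (p_poly S (tau S i)) (- Var N) *
      subst (\<lambda>n. if n = a then Var N + hbar else Var (rotate_right a N n)) f)) (aleph S)"
proof -
  obtain p v q where al: "aleph S = p @ i # replicate v i @ q" "aleph S = (p @ replicate v i) @ i # q"
    and v: "vdim S i = Suc v" and a: "a = Suc (length p)" and N: "N = Suc (length p + v)"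
    and m: "m = Suc (length p + v + length q)" and ipq: "i \<notin> set p" "i \<notin> set q"
    and sub: "set (p @ replicate v i @ q) \<subseteq> Qplus S"
    using loop_word [OF i] unfolding a_def N_def by metis
  define u where "u = p @ replicate v i @ q"
  have lists: "p \<in> lists (verts (quiver S))" "q \<in> lists (verts (quiver S))" "u \<in> lists (verts (quiver S))"
    "i \<in> verts (quiver S)" "tau S i \<in> verts (quiver S)"
    using sub plus_verts i tau_Qplus unfolding u_def by auto
  have u: "u = take (N - 1) (aleph S) @ drop N (aleph S)" "length u = m - 1"
    unfolding al(2) u_def by (simp_all add: N m)
  have tau_u: "tau S i \<notin> set u"
    using sub tau_Qplus [OF i(1)] unfolding u_def by blast
  have no_arrow: "\<not> arrow S i y" if "y \<in> set u" for y
    using that sub arrow_plus_minus unfolding u_def by blast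
  \<comment> \<open>One map for each segment of the path: to the left mirror, reflection, to the
    right mirror, reflection, back to the right end of the block.\<close>
  define \<phi>1 \<phi>2 \<phi>3 \<phi>4 \<phi>5 where
    "\<phi>1 = rename (rotate_left 1 a)"
    and "\<phi>2 = (\<lambda>f. poly (p_poly S (tau S i)) (Var 1) * subst (Var(1 := - Var 1 + hbar)) f)"
    and "\<phi>3 = (\<lambda>f. (\<Prod>l<length u. Xbar S (tau S i) (u ! l) (Var m) (Var (1 + l))) * rename (rotate_right 1 m) f)"
    and "\<phi>4 = subst (Var(m := - Var m))"
    and "\<phi>5 = rename (rotate_left N m)"
  have 1: "realizes (op_prod (map (sigma S) [1..<a])) (aleph S) \<phi>1 (i # u)"
  proof -
    have "realizes (op_prod (map (sigma S) [1..<a])) ([] @ p @ i # replicate v i @ q) \<phi>1 ([] @ i # p @ replicate v i @ q)"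
      unfolding \<phi>1_def using lists ipq no_arrow
      by (intro realizes_move_left_free) (auto simp: a u_def)
    then show ?thesis by (simp add: al(1) u_def)
  qed
  have 2: "realizes (rho_L S) (i # u) \<phi>2 (tau S i # u)"
    unfolding \<phi>2_def using lists by (intro realizes_rho_L polys_p_poly) auto
  have 3: "realizes (op_prod (map (sigma S) (rev [1..<m]))) (tau S i # u) \<phi>3 (u @ [tau S i])"
    using realizes_move_right [of "[]" "tau S i" u "[]" 1 m] lists tau_u u(2) m
    by (simp add: \<phi>3_def)
  have 4: "realizes (rho_R S) (u @ [tau S i]) \<phi>4 (u @ [i])"
    using realizes_rho_R [of u "tau S i" m] lists u(2) m tau_tau [of i]
    by (simp add: \<phi>4_def)
  have 5: "realizes (op_prod (map (sigma S) [N..<m])) (u @ [i]) \<phi>5 (aleph S)"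
  proof -
    have "realizes (op_prod (map (sigma S) [N..<m])) ((p @ replicate v i) @ q @ i # []) \<phi>5 ((p @ replicate v i) @ i # q @ [])"
      unfolding \<phi>5_def using lists ipq no_arrow
      by (intro realizes_move_left_free) (auto simp: N m u_def)
    then show ?thesis by (simp add: al(2) u_def)
  qed
  have 6: "realizes (op_prod (map (sigma S) [a..<N])) (aleph S) (op_prod (map demazure [a..<N])) (aleph S)"
    by (intro realizes_demazure_list aleph_in_lists) (auto simp: al(1) a N nth_append nth_Cons')
  \<comment> \<open>The return splits at N into crossings with other colours, which only rename, and
    crossings inside the block, which are divided differences.\<close>
  have "[a..<m] = [a..<N] @ [N..<m]"
    by (rule upt_split) (auto simp: a N m)
  then have D: "D_loop S i = op_prod (map (sigma S) [a..<N]) \<circ> (op_prod (map (sigma S) [N..<m]) \<circ> (rho_R S \<circ>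
      (op_prod (map (sigma S) (rev [1..<m])) \<circ> (rho_L S \<circ> (op_prod (map (sigma S) [1..<a]) \<circ> idem (aleph S))))))"
    using i(1) by (simp only: D_loop_def Let_def if_True a_def [symmetric] map_append op_prod_append o_assoc)
  show ?thesis
    unfolding D
  proof (rule realizes_cong)
    show "realizes (op_prod (map (sigma S) [a..<N]) \<circ> (op_prod (map (sigma S) [N..<m]) \<circ> (rho_R S \<circ>
      (op_prod (map (sigma S) (rev [1..<m])) \<circ> (rho_L S \<circ> (op_prod (map (sigma S) [1..<a]) \<circ> idem (aleph S)))))))
      (aleph S) (op_prod (map demazure [a..<N]) \<circ> (\<phi>5 \<circ> (\<phi>4 \<circ> (\<phi>3 \<circ> (\<phi>2 \<circ> (\<phi>1 \<circ> id)))))) (aleph S)"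
      by (intro realizes_comp [OF _ 6] realizes_comp [OF _ 5] realizes_comp [OF _ 4] realizes_comp [OF _ 3]
          realizes_comp [OF _ 2] realizes_comp [OF _ 1] realizes_idem aleph_in_lists)
    fix f assume "f \<in> polys (length (aleph S))"
    then have f: "f \<in> polys m" by (simp add: length_aleph)
    have "\<phi>5 (\<phi>4 (\<Prod>l<length u. Xbar S (tau S i) (u ! l) (Var m) (Var (1 + l)))) = loop_factor i N"
    proof -
      have "\<phi>5 (\<phi>4 (Xbar S (tau S i) (u ! l) (Var m) (Var (1 + l))))
          = (\<lambda>x n. if arrow S x (tau S i) then - Var N - Var n - half_hbar else 1) (u ! l) (rotate_left N m (Suc l))"
        if "l < m - 1" for l
        using that by (simp add: Xbar_def \<phi>5_def \<phi>4_def rotate_left_def N m)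
      then have "\<phi>5 (\<phi>4 (\<Prod>l<length u. Xbar S (tau S i) (u ! l) (Var m) (Var (1 + l))))
        = (\<Prod>l<m - 1. (\<lambda>x n. if arrow S x (tau S i) then - Var N - Var n - half_hbar else 1) (u ! l) (rotate_left N m (Suc l)))"
        unfolding u(2) \<phi>4_def \<phi>5_def subst_prod rename_simps by (intro prod.cong refl) simp
      also have "\<dots> = loop_factor i N"
        unfolding u(1) loop_factor_def by (rule prod_remove_letter) (simp add: N m)
      finally show ?thesis .
    qed
    moreover have "\<phi>5 (\<phi>4 (rename (rotate_right 1 m) (\<phi>2 (\<phi>1 f)))) = poly (p_poly S (tau S i)) (- Var N) *
        subst (\<lambda>n. if n = a then Var N + hbar else Var (rotate_right a N n)) f"
    proof -
      have "\<phi>5 (\<phi>4 (rename (rotate_right 1 m) (subst (Var(1 := - Var 1 + hbar)) (\<phi>1 f))))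
          = subst (\<lambda>n. if n = a then Var N + hbar else Var (rotate_right a N n)) f"
        unfolding \<phi>1_def \<phi>4_def \<phi>5_def rename_def subst_subst using f
        by (rule subst_cong) (auto simp: rotate_left_def rotate_right_def a N m)
      moreover have "\<phi>5 (\<phi>4 (rename (rotate_right 1 m) (poly (p_poly S (tau S i)) (Var 1)))) = poly (p_poly S (tau S i)) (- Var N)"
        by (simp add: \<phi>4_def \<phi>5_def rotate_right_def rotate_left_def)
      ultimately show ?thesis
        unfolding \<phi>2_def by (simp add: \<phi>4_def \<phi>5_def)
    qed
    ultimately have "\<phi>5 (\<phi>4 (\<phi>3 (\<phi>2 (\<phi>1 f)))) = loop_factor i N * poly (p_poly S (tau S i)) (- Var N) *
        subst (\<lambda>n. if n = a then Var N + hbar else Var (rotate_right a N n)) f"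
      unfolding \<phi>3_def by (simp add: \<phi>4_def \<phi>5_def mult.assoc)
    then show "(op_prod (map demazure [a..<N]) \<circ> (\<phi>5 \<circ> (\<phi>4 \<circ> (\<phi>3 \<circ> (\<phi>2 \<circ> (\<phi>1 \<circ> id)))))) f =
        op_prod (map demazure [a..<N]) (loop_factor i N * poly (p_poly S (tau S i)) (- Var N) *
          subst (\<lambda>n. if n = a then Var N + hbar else Var (rotate_right a N n)) f)"
      by simp
  qed
qed

text \<open>Moving right with colour i, a factor would require an arrow into i; moving left with
  colour \<open>tau S i\<close>, an arrow out of \<open>tau S i\<close>. Neither exists, so only the
  polynomial of the left mirror remains. The mirrors now act in the other order, hence X -
  \<hbar>.\<close>

lemma realizes_D_loop_minus:
  assumes i: "i \<in> Qplus S" "vdim S i > 0"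
  defines "a \<equiv> pos_first S i" and "N \<equiv> pos_last S i"
  shows "realizes (D_loop S (tau S i)) (aleph S) (\<lambda>f. op_prod (map demazure (rev [a..<N]))
    (poly (p_poly S i) (Var a) *
      subst (\<lambda>n. if n = N then Var a - hbar else Var (rotate_left a N n)) f)) (aleph S)"
proof -
  obtain p v q where al: "aleph S = p @ i # replicate v i @ q" "aleph S = (p @ replicate v i) @ i # q"
    and v: "vdim S i = Suc v" and a: "a = Suc (length p)" and N: "N = Suc (length p + v)"
    and m: "m = Suc (length p + v + length q)" and ipq: "i \<notin> set p" "i \<notin> set q"
    and sub: "set (p @ replicate v i @ q) \<subseteq> Qplus S"
    using loop_word [OF i] unfolding a_def N_def by metis
  define u where "u = p @ replicate v i @ q"
  have lists: "p \<in> lists (verts (quiver S))" "q \<in> lists (verts (quiver S))" "u \<in> lists (verts (quiver S))"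
    "i \<in> verts (quiver S)" "tau S i \<in> verts (quiver S)"
    using sub plus_verts i tau_Qplus unfolding u_def by auto
  have u: "length u = m - 1"
    by (simp add: u_def m)
  have tau_u: "tau S i \<notin> set u"
    using sub tau_Qplus [OF i(1)] unfolding u_def by blast
  have no_arrow: "\<not> arrow S y i" "\<not> arrow S (tau S i) y" for y
    using arrow_plus_minus [of y i] arrow_plus_minus [of "tau S i" y] i(1) tau_Qplus [OF i(1)] by auto
  have tt: "tau S (tau S i) = i"
    by (intro tau_tau lists)
  define \<phi>1 \<phi>2 \<phi>3 \<phi>4 \<phi>5 where
    "\<phi>1 = rename (rotate_right N m)"
    and "\<phi>2 = subst (Var(m := - Var m))"
    and "\<phi>3 = rename (rotate_left 1 m)"
    and "\<phi>4 = (\<lambda>f. poly (p_poly S i) (Var 1) * subst (Var(1 := - Var 1 + hbar)) f)"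
    and "\<phi>5 = rename (rotate_right 1 a)"
  have 1: "realizes (op_prod (map (sigma S) (rev [N..<m]))) (aleph S) \<phi>1 (u @ [i])"
  proof -
    have "realizes (op_prod (map (sigma S) (rev [N..<m]))) ((p @ replicate v i) @ i # q @ []) \<phi>1 ((p @ replicate v i) @ q @ i # [])"
      unfolding \<phi>1_def using lists ipq no_arrow
      by (intro realizes_move_right_free) (auto simp: N m u_def)
    then show ?thesis by (simp add: al(2) u_def)
  qed
  have 2: "realizes (rho_R S) (u @ [i]) \<phi>2 (u @ [tau S i])"
    using realizes_rho_R [of u i m] lists u m by (simp add: \<phi>2_def)
  have 3: "realizes (op_prod (map (sigma S) [1..<m])) (u @ [tau S i]) \<phi>3 (tau S i # u)"
    using realizes_move_left_free [of "[]" u "tau S i" "[]" 1 m] lists tau_u u m no_arrow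
    by (simp add: \<phi>3_def)
  have 4: "realizes (rho_L S) (tau S i # u) \<phi>4 (i # u)"
    using realizes_rho_L [of "tau S i" u] lists
    unfolding \<phi>4_def tt by (simp add: polys_p_poly)
  have 5: "realizes (op_prod (map (sigma S) (rev [1..<a]))) (i # u) \<phi>5 (aleph S)"
  proof -
    have "realizes (op_prod (map (sigma S) (rev [1..<a]))) ([] @ i # p @ replicate v i @ q) \<phi>5 ([] @ p @ i # replicate v i @ q)"
      unfolding \<phi>5_def using lists ipq no_arrow
      by (intro realizes_move_right_free) (auto simp: a u_def)
    then show ?thesis by (simp add: al(1) u_def)
  qed
  have 6: "realizes (op_prod (map (sigma S) (rev [a..<N]))) (aleph S) (op_prod (map demazure (rev [a..<N]))) (aleph S)"
    by (intro realizes_demazure_list aleph_in_lists) (auto simp: al(1) a N nth_append nth_Cons')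
  have "[1..<N] = [1..<a] @ [a..<N]"
    by (rule upt_split) (auto simp: a N)
  then have D: "D_loop S (tau S i) = op_prod (map (sigma S) (rev [a..<N])) \<circ> (op_prod (map (sigma S) (rev [1..<a])) \<circ> (rho_L S \<circ>
      (op_prod (map (sigma S) [1..<m]) \<circ> (rho_R S \<circ> (op_prod (map (sigma S) (rev [N..<m])) \<circ> idem (aleph S))))))"
    using tau_Qplus [OF i(1)]
    by (simp only: D_loop_def Let_def if_False tt N_def [symmetric] rev_append map_append op_prod_append o_assoc)
  show ?thesis
    unfolding D
  proof (rule realizes_cong)
    show "realizes (op_prod (map (sigma S) (rev [a..<N])) \<circ> (op_prod (map (sigma S) (rev [1..<a])) \<circ> (rho_L S \<circ>
      (op_prod (map (sigma S) [1..<m]) \<circ> (rho_R S \<circ> (op_prod (map (sigma S) (rev [N..<m])) \<circ> idem (aleph S)))))))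
      (aleph S) (op_prod (map demazure (rev [a..<N])) \<circ> (\<phi>5 \<circ> (\<phi>4 \<circ> (\<phi>3 \<circ> (\<phi>2 \<circ> (\<phi>1 \<circ> id)))))) (aleph S)"
      by (intro realizes_comp [OF _ 6] realizes_comp [OF _ 5] realizes_comp [OF _ 4] realizes_comp [OF _ 3]
          realizes_comp [OF _ 2] realizes_comp [OF _ 1] realizes_idem aleph_in_lists)
    fix f assume "f \<in> polys (length (aleph S))"
    then have f: "f \<in> polys m" by (simp add: length_aleph)
    have "\<phi>5 (subst (Var(1 := - Var 1 + hbar)) (\<phi>3 (\<phi>2 (\<phi>1 f))))
          = subst (\<lambda>n. if n = N then Var a - hbar else Var (rotate_left a N n)) f"
      unfolding \<phi>1_def \<phi>2_def \<phi>3_def \<phi>5_def rename_def subst_subst using f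
      by (rule subst_cong) (auto simp: rotate_left_def rotate_right_def a N m)
    then have "\<phi>5 (\<phi>4 (\<phi>3 (\<phi>2 (\<phi>1 f)))) = poly (p_poly S i) (Var a) *
        subst (\<lambda>n. if n = N then Var a - hbar else Var (rotate_left a N n)) f"
      unfolding \<phi>4_def by (simp add: \<phi>5_def rotate_right_def)
    then show "(op_prod (map demazure (rev [a..<N])) \<circ> (\<phi>5 \<circ> (\<phi>4 \<circ> (\<phi>3 \<circ> (\<phi>2 \<circ> (\<phi>1 \<circ> id)))))) f =
        op_prod (map demazure (rev [a..<N])) (poly (p_poly S i) (Var a) *
          subst (\<lambda>n. if n = N then Var a - hbar else Var (rotate_left a N n)) f)"
      by simp
  qed
qed

end

section \<open>The coefficients of the series \<open>b\<^sub>i\<close>\<close>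

text \<open>The geometric series of 1/(-z - c) in powers of 1/z, verified by multiplying back; it
  starts with -1/z.\<close>

lemma fls_nth_inverse_linear:
  fixes c :: "'b::field"
  shows "fls_nth (1 / (- fls_X_inv - fls_const c)) n = (if n \<ge> 1 then (- 1) ^ nat n * c ^ nat (n - 1) else 0)"
proof -
  let ?s = "- fls_X_inv - fls_const c"
  define g where "g = fps_to_fls (Abs_fps (\<lambda>k. if k = 0 then 0 else (- 1) ^ k * c ^ (k - 1)))"
  have g: "fls_nth g n = (if n \<ge> 1 then (- 1) ^ nat n * c ^ nat (n - 1) else 0)" for n
    by (auto simp: g_def nat_diff_distrib)
  have "g * ?s = 1"
  proof (rule fls_eqI)
    fix n
    have "fls_nth (g * ?s) n = - fls_nth g (n + 1) - fls_nth g n * c"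
      by (simp add: right_diff_distrib fls_X_inv_times_conv_shift)
    also have "\<dots> = fls_nth 1 n"
    proof -
      consider "n \<le> -1" | "n = 0" | "n \<ge> 1"
        by linarith
      then show ?thesis
      proof cases
        case 3
        then obtain k where k: "n = 1 + int k"
          by (metis zle_iff_zadd)
        then have "nat (n + 1) = Suc (Suc k)" "nat n = Suc k" "nat (n + 1 - 1) = Suc k" "nat (n - 1) = k"
          by auto
        with k show ?thesis by (simp add: g)
      qed (auto simp: g)
    qed
    finally show "fls_nth (g * ?s) n = fls_nth 1 n" .
  qed
  then have "1 / ?s = g"
    by (metis divide_inverse inverse_unique mult.commute mult_1)
  then show ?thesis
    by (simp add: g)
qed

lemma emb_add: "emb (f + g) = emb f + emb g"
  and emb_mult: "emb (f * g) = emb f * emb g"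
  and emb_0: "emb 0 = 0"
  and emb_1: "emb 1 = 1"
  and emb_uminus: "emb (- f) = - emb f"
  by (simp_all add: emb_def fls_plus_const)

lemma emb_divide: "emb f / emb g = fls_const (to_fract f / to_fract g)"
  by (simp add: emb_def fls_const_divide_const)

context iyangian_datum
begin

lemma fls_nth_b_series:
  assumes n: "n \<ge> 1"
  shows "fls_nth (b_series S i f) n = (\<Sum>r\<in>{1..vdim S i}. to_fract ((- 1) ^ nat n * (xvar S i r + half_hbar) ^ nat (n - 1) *
     (if arrow S i (tau S i) then poly (V_omit S (tau S i) r) (xvar S i r + half_hbar) else 1) *
     (\<Prod>j\<in>{j \<in> verts (quiver S). j \<noteq> tau S i \<and> arrow S i j}. poly (V_poly S j) (xvar S i r + half_hbar)) *
     poly (p_poly S (tau S i)) (xvar S (tau S i) r) * shift_op S i r f) /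
     to_fract (poly (V_omit S i r) (xvar S i r)))" (is "_ = sum ?R _")
proof -
  have pow: "to_fract (x ^ k) = to_fract x ^ k" for x :: pol and k
    by (induction k) auto
  have "fls_nth (1 / (- z_ser - emb x - emb half_hbar) * emb A * emb B * (emb C / emb D) * emb E) n
      = to_fract ((- 1) ^ nat n * (x + half_hbar) ^ nat (n - 1) * A * B * C * E) / to_fract D" for x A B C D E
  proof -
    have c: "- z_ser - emb x - emb half_hbar = - z_ser - fls_const (to_fract (x + half_hbar))"
      by (simp add: emb_def fls_plus_const [symmetric] del: fls_plus_const)
    show ?thesis
      unfolding c emb_divide unfolding emb_def fls_mult_const_nth fls_nth_inverse_linear
      using n by (simp add: pow)
  qed
  then show ?thesis
    unfolding b_series_def fls_nth_sum by (intro sum.cong refl) blast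
qed

lemma fls_nth_b_series_nonpos:
  assumes n: "n < 1"
  shows "fls_nth (b_series S i f) n = 0"
proof -
  have "fls_nth (1 / (- z_ser - emb x - emb half_hbar) * emb A * emb B * (emb C / emb D) * emb E) n = 0" for x A B C D E
  proof -
    have c: "- z_ser - emb x - emb half_hbar = - z_ser - fls_const (to_fract (x + half_hbar))"
      by (simp add: emb_def fls_plus_const [symmetric] del: fls_plus_const)
    show ?thesis
      unfolding c emb_divide unfolding emb_def fls_mult_const_nth fls_nth_inverse_linear
      using n by simp
  qed
  then show ?thesis
    unfolding b_series_def fls_nth_sum by (intro sum.neutral ballI) blast
qed

lemma prod_offset: "i \<in> Qplus S \<Longrightarrow> (\<Prod>k\<in>{1..vdim S i}. F (offset i + k)) = (\<Prod>l\<in>block i. F l)"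
  unfolding block_offset
  by (rule prod.reindex_bij_witness [of _ "\<lambda>l. l - offset i" "\<lambda>k. offset i + k"]) auto

lemma sum_offset: "i \<in> Qplus S \<Longrightarrow> (\<Sum>k\<in>{1..vdim S i}. F (offset i + k)) = (\<Sum>l\<in>block i. F l)"
  unfolding block_offset
  by (rule sum.reindex_bij_witness [of _ "\<lambda>l. l - offset i" "\<lambda>k. offset i + k"]) auto

lemma prod_offset_omit:
  "i \<in> Qplus S \<Longrightarrow> (\<Prod>k\<in>{1..vdim S i} - {r}. F (offset i + k)) = (\<Prod>l\<in>block i - {offset i + r}. F l)"
  unfolding block_offset
  by (rule prod.reindex_bij_witness [of _ "\<lambda>l. l - offset i" "\<lambda>k. offset i + k"]) auto

lemma poly_V_poly_tau:
  assumes "i \<in> Qplus S"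
  shows "poly (V_poly S (tau S i)) u = (\<Prod>l\<in>block i. u + Var l)"
  unfolding V_poly_def poly_prod using assms tau_Qplus [OF assms] vdim_tau [of i] tau_tau [of i] plus_verts
  by (subst prod_offset [symmetric]) (auto intro!: prod.cong simp: xvar_def var_index_eq)

lemma poly_V_omit:
  "i \<in> Qplus S \<Longrightarrow> poly (V_omit S i r) u = (\<Prod>l\<in>block i - {offset i + r}. u - Var l)"
  unfolding V_omit_def poly_prod
  by (subst prod_offset_omit [symmetric]) (auto intro!: prod.cong simp: xvar_def var_index_eq)

lemma poly_V_omit_tau:
  assumes "i \<in> Qplus S"
  shows "poly (V_omit S (tau S i) r) u = (\<Prod>l\<in>block i - {offset i + r}. u + Var l)"
  unfolding V_omit_def poly_prod using assms tau_Qplus [OF assms] vdim_tau [of i] tau_tau [of i] plus_verts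
  by (subst prod_offset_omit [symmetric]) (auto intro!: prod.cong simp: xvar_def var_index_eq)

lemma arrow_tau: "arrow S x y \<Longrightarrow> arrow S (tau S y) (tau S x)"
  using tau_arc tail_tau_arc head_tau_arc by (auto simp: arcs_ends_def arc_to_ends_def image_iff) metis

lemma card_block: "i \<in> Qplus S \<Longrightarrow> card (block i) = vdim S i"
  by (simp add: block_offset)

text \<open>The number of crossings that carry a factor. The moving strand does not cross itself,
  which explains the subtraction; it is exact as soon as \<open>vdim S i > 0\<close>.\<close>

definition loop_degree :: "'v \<Rightarrow> nat" where
  "loop_degree i = (\<Sum>j\<in>{j \<in> Qplus S. arrow S j (tau S i)}. vdim S j) - (if arrow S i (tau S i) then 1 else 0)"

text \<open>The strands contributing a factor are grouped by colour j. The involution turns an arrow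
  from j to \<open>tau S i\<close> into one from i to \<open>tau S j\<close>, and the block of j
  gives the roots of \<open>V_poly S (tau S j)\<close>. The block of i itself lacks the moved strand
  and gives \<open>V_omit\<close>.\<close>

lemma loop_factor_eq:
  assumes i: "i \<in> Qplus S" and r: "1 \<le> r" "r \<le> vdim S i"
  defines "l \<equiv> offset i + r"
  shows "loop_factor i l = (- 1) ^ loop_degree i *
     ((if arrow S i (tau S i) then poly (V_omit S (tau S i) r) (Var l + half_hbar) else 1) *
     (\<Prod>j\<in>{j \<in> verts (quiver S). j \<noteq> tau S i \<and> arrow S i j}. poly (V_poly S j) (Var l + half_hbar)))"
proof -
  define J where "J = {j \<in> Qplus S. arrow S j (tau S i)}"
  define L where "L = {k \<in> {1..m}. arrow S (letter k) (tau S i)}"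
  define \<delta> where "\<delta> \<longleftrightarrow> arrow S i (tau S i)"
  let ?u = "Var l + half_hbar"
  have l: "l \<in> block i"
    using r unfolding l_def block_offset [OF i] by auto
  have finJ: "finite J"
    by (simp add: J_def)
  have L: "L = (\<Union>j\<in>J. block j)"
    using letter_in_Qplus by (auto simp: L_def J_def block_eq)
  have disj: "block j \<inter> block k = {}" if "j \<in> J" "k \<in> J" "j \<noteq> k" for j k
    using that block_disjoint by (auto simp: J_def)
  have lL: "l \<in> L \<longleftrightarrow> \<delta>"
    using l i by (auto simp: L_def block_eq \<delta>_def)
  have "card L = (\<Sum>j\<in>J. card (block j))"
    unfolding L by (rule card_UN_disjoint) (use finJ disj in auto)
  also have "\<dots> = (\<Sum>j\<in>J. vdim S j)"
    by (intro sum.cong refl card_block) (simp add: J_def)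
  finally have card: "card (L - {l}) = loop_degree i"
    using lL by (simp add: loop_degree_def J_def \<delta>_def card_Diff_singleton_if)
  have finL: "finite L"
    by (simp add: L_def)
  have "loop_factor i l = (\<Prod>k\<in>L - {l}. - Var l - Var k - half_hbar)"
    unfolding loop_factor_def L_def by (rule prod.mono_neutral_cong_right) auto
  also have "\<dots> = (\<Prod>k\<in>L - {l}. (- 1) * (?u + Var k))"
    by (intro prod.cong refl) simp
  also have "\<dots> = (- 1) ^ loop_degree i * (\<Prod>k\<in>L - {l}. ?u + Var k)"
    unfolding prod.distrib using card by simp
  also have "(\<Prod>k\<in>L - {l}. ?u + Var k) = (if \<delta> then \<Prod>k\<in>block i - {l}. ?u + Var k else 1) *
      (\<Prod>j\<in>J - {i}. \<Prod>k\<in>block j. ?u + Var k)"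
  proof -
    \<comment> \<open>The intervals are hidden behind a name so that the set identities are proved
      without arithmetic on their endpoints.\<close>
    define B where "B j = block j" for j
    have B: "B i \<inter> B j = {}" if "j \<in> J - {i}" for j
      using that i block_disjoint [of i j] unfolding B_def J_def by blast
    have "i \<in> J \<longleftrightarrow> \<delta>" "l \<in> B i" "L = (\<Union>j\<in>J. B j)"
      using i l L by (simp_all add: J_def \<delta>_def B_def)
    then have "L - {l} = (if \<delta> then B i - {l} else {}) \<union> (\<Union>j\<in>J - {i}. B j)"
      using B by auto
    then have "L - {l} = (if \<delta> then block i - {l} else {}) \<union> (\<Union>j\<in>J - {i}. block j)"
      by (simp only: B_def)
    moreover have "(if \<delta> then B i - {l} else {}) \<inter> (\<Union>j\<in>J - {i}. B j) = {}"
      using B by auto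
    then have "(if \<delta> then block i - {l} else {}) \<inter> (\<Union>j\<in>J - {i}. block j) = {}"
      by (simp only: B_def)
    ultimately have "(\<Prod>k\<in>L - {l}. ?u + Var k) = (\<Prod>k\<in>(if \<delta> then block i - {l} else {}). ?u + Var k) *
        (\<Prod>k\<in>(\<Union>j\<in>J - {i}. block j). ?u + Var k)"
      using finJ by (simp only:) (rule prod.union_disjoint, auto)
    moreover have "(\<Prod>k\<in>(\<Union>j\<in>J - {i}. block j). ?u + Var k) = (\<Prod>j\<in>J - {i}. \<Prod>k\<in>block j. ?u + Var k)"
      by (rule prod.UNION_disjoint) (use finJ disj in auto)
    ultimately show ?thesis
      by simp
  qed
  also have "(\<Prod>j\<in>J - {i}. \<Prod>k\<in>block j. ?u + Var k)
      = (\<Prod>j\<in>{j \<in> verts (quiver S). j \<noteq> tau S i \<and> arrow S i j}. poly (V_poly S j) ?u)"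
  proof (rule prod.reindex_bij_witness [of _ "tau S" "tau S"])
    fix j assume j: "j \<in> J - {i}"
    then have jv: "j \<in> verts (quiver S)" "i \<in> verts (quiver S)" and jQ: "j \<in> Qplus S"
      using plus_verts i by (auto simp: J_def)
    then show "tau S (tau S j) = j"
      by (simp add: tau_tau)
    show "tau S j \<in> {j \<in> verts (quiver S). j \<noteq> tau S i \<and> arrow S i j}"
      using j jv arrow_tau [of j "tau S i"] tau_vert tau_tau by (auto simp: J_def) (metis)
    show "poly (V_poly S (tau S j)) ?u = (\<Prod>k\<in>block j. ?u + Var k)"
      by (rule poly_V_poly_tau [OF jQ])
  next
    fix j assume j: "j \<in> {j \<in> verts (quiver S). j \<noteq> tau S i \<and> arrow S i j}"
    then show "tau S (tau S j) = j"
      by (simp add: tau_tau)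
    have "j \<notin> Qplus S"
      using j arrow_plus_minus by blast
    then have "tau S j \<in> Qplus S"
      using j tau_minus by blast
    then show "tau S j \<in> J - {i}"
      using j arrow_tau [of i j] tau_tau by (auto simp: J_def)
  qed
  finally show ?thesis
    unfolding poly_V_omit_tau [OF i] \<delta>_def l_def [symmetric] by simp
qed

lemma rename_loop_factor:
  assumes "\<pi> permutes {1..m}" "\<And>l. l \<in> {1..m} \<Longrightarrow> letter (\<pi> l) = letter l"
  shows "rename \<pi> (loop_factor i N) = loop_factor i (\<pi> N)"
proof -
  let ?F = "\<lambda>N l. if arrow S (letter l) (tau S i) then - Var N - Var l - half_hbar else 1"
  have "rename \<pi> (loop_factor i N) = (\<Prod>l\<in>{1..m} - {N}. ?F (\<pi> N) (\<pi> l))"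
    unfolding loop_factor_def rename_simps using assms(2) by (intro prod.cong refl) auto
  also have "\<dots> = (\<Prod>l\<in>\<pi> ` ({1..m} - {N}). ?F (\<pi> N) l)"
    using inj_on_subset [OF permutes_inj [OF assms(1)]] by (subst prod.reindex) auto
  also have "\<pi> ` ({1..m} - {N}) = {1..m} - {\<pi> N}"
    using permutes_inj [OF assms(1)] permutes_image [OF assms(1)] by (simp add: image_set_diff)
  finally show ?thesis
    by (simp add: loop_factor_def)
qed

lemma block_permutation:
  assumes "j \<in> Qplus S" "\<pi> permutes block j"
  shows "\<pi> permutes {1..m}" "l \<in> {1..m} \<Longrightarrow> letter (\<pi> l) = letter l"
proof -
  show "\<pi> permutes {1..m}"
    using assms block_subset by (blast intro: permutes_subset)
  assume l: "l \<in> {1..m}"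
  show "letter (\<pi> l) = letter l"
  proof (cases "l \<in> block j")
    case True
    then have "\<pi> l \<in> block j"
      using assms(2) by (simp only: permutes_in_image)
    with True show ?thesis
      unfolding block_eq [OF assms(1)] by simp
  next
    case False
    then show ?thesis
      using assms(2) by (simp add: permutes_not_in)
  qed
qed

lemma rename_subst_shift:
  assumes "inj \<pi>" "rename \<pi> f = f"
  shows "rename \<pi> (subst (Var(l := Var l + Cst c)) f) = subst (Var(\<pi> l := Var (\<pi> l) + Cst c)) f"
proof -
  have "rename \<pi> (subst (Var(l := Var l + Cst c)) f) = subst (Var(\<pi> l := Var (\<pi> l) + Cst c)) (rename \<pi> f)"
    unfolding rename_def subst_subst using assms(1)
    by (rule_tac arg_cong [where f = "\<lambda>g. subst g f"]) (auto simp: fun_eq_iff inj_eq)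
  then show ?thesis
    by (simp add: assms(2))
qed

end

lemma Cst_half: "Cst [:0, 1/2:] = half_hbar" "Cst [:0, -1/2:] = - half_hbar"
  by (simp_all add: half_hbar_def Cst_uminus [symmetric])

lemma hbar_halves: "hbar = half_hbar + half_hbar"
  by (simp add: hbar_def half_hbar_def Cst_add [symmetric])

lemma rotate_permutes:
  assumes "a \<le> e"
  shows "rotate_right a e permutes {a..e}" "rotate_left a e permutes {a..e}"
proof -
  show "rotate_right a e permutes {a..e}"
    by (rule bij_imp_permutes, rule bij_betw_byWitness [where f' = "rotate_left a e"])
      (use assms in \<open>auto simp: rotate_right_def rotate_left_def\<close>)
  show "rotate_left a e permutes {a..e}"
    by (rule bij_imp_permutes, rule bij_betw_byWitness [where f' = "rotate_right a e"])
      (use assms in \<open>auto simp: rotate_right_def rotate_left_def\<close>)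
qed

context iyangian_datum
begin

text \<open>In block i the symmetry comes from the block sum; in every other block it comes from
  divided differences commuting with permutations that fix their variables. The sign covers both
  directions of a chain.\<close>

lemma block_operator_P_sym:
  assumes i: "i \<in> Qplus S" and c: "c \<in> block i" and H: "H \<in> polys m"
    and inv: "\<And>j \<pi>. j \<in> Qplus S \<Longrightarrow> \<pi> permutes block j \<Longrightarrow> \<pi> c = c \<Longrightarrow> rename \<pi> H = H"
    and ks: "\<And>k. k \<in> set ks \<Longrightarrow> k \<in> block i \<and> Suc k \<in> block i"
    and F: "to_fract (op_prod (map demazure ks) H) = (- 1) ^ e * block_sum (block i) c H"
  shows "op_prod (map demazure ks) H \<in> P_sym S"
  unfolding mem_P_sym
proof (intro conjI ballI)
  let ?F = "op_prod (map demazure ks) H"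
  have "1 \<le> k \<and> k < m" if "k \<in> set ks" for k
    using ks [OF that] block_subset [OF i] by fastforce
  then show "?F \<in> polys m"
    using polys_demazure_list [of ks "\<lambda>k. k" m H] H by simp
  fix j assume j: "j \<in> Qplus S"
  show "sym_in (block j) ?F"
  proof (cases "j = i")
    case True
    have sym: "sym_in (block i - {c}) H"
      unfolding sym_in_def
    proof (intro allI impI)
      fix \<pi> assume \<pi>: "\<pi> permutes block i - {c}"
      then show "rename \<pi> H = H"
        by (intro inv [OF i] permutes_subset [OF \<pi>]) (auto intro: permutes_not_in)
    qed
    have "to_fract ((- 1) ^ e * ?F) = block_sum (block i) c H"
      using F by (cases "even e") auto
    then have "sym_in (block i) ((- 1) ^ e * ?F)"
      using sym_in_block_sum [OF _ c sym] by simp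
    then show ?thesis
      using True by (cases "even e") (simp_all add: sym_in_def)
  next
    case False
    show ?thesis
      unfolding sym_in_def
    proof (intro allI impI)
      fix \<pi> assume \<pi>: "\<pi> permutes block j"
      have fixed: "\<pi> k = k" if "k \<in> block i" for k
        using that block_disjoint [OF i j] False by (intro permutes_not_in [OF \<pi>]) blast
      have "rename \<pi> (op_prod (map (\<lambda>k. demazure k) ks) H) = op_prod (map (\<lambda>k. demazure k) ks) (rename \<pi> H)"
        by (rule rename_demazure_list) (use ks fixed permutes_inj [OF \<pi>] in blast)+
      then show "rename \<pi> ?F = ?F"
        using inv [OF j \<pi> fixed [OF c]] by simp
    qed
  qed
qed

section \<open>Comparison of the loops with the coefficients of b\<close>

definition plus_numerator :: "'v \<Rightarrow> nat \<Rightarrow> nat \<Rightarrow> pol \<Rightarrow> pol" where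
  "plus_numerator i r l f = loop_factor i l * poly (p_poly S (tau S i)) (- Var l) *
     ((Var l + half_hbar) ^ r * subst (Var(l := Var l + hbar)) f)"

definition minus_numerator :: "'v \<Rightarrow> nat \<Rightarrow> nat \<Rightarrow> pol \<Rightarrow> pol" where
  "minus_numerator i r l f = poly (p_poly S i) (Var l) *
     ((Var l - half_hbar) ^ r * subst (Var(l := Var l - hbar)) f)"

text \<open>Equivariance in l is what allows a block sum built from the numerator at a single
  position c to be read as the sum of the numerators at all positions of the block.\<close>

lemma rename_numerators:
  assumes "j \<in> Qplus S" "\<pi> permutes block j" "f \<in> P_sym S"
  shows "rename \<pi> (plus_numerator i r l f) = plus_numerator i r (\<pi> l) f"
    and "rename \<pi> (minus_numerator i r l f) = minus_numerator i r (\<pi> l) f"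
proof -
  have f: "rename \<pi> f = f"
    using assms by (auto simp: mem_P_sym sym_in_def)
  note \<pi> = block_permutation [OF assms(1,2)]
  have "rename \<pi> (subst (Var(l := Var l + hbar)) f) = subst (Var(\<pi> l := Var (\<pi> l) + hbar)) f"
    unfolding hbar_def by (rule rename_subst_shift [OF permutes_inj [OF assms(2)] f])
  moreover have "rename \<pi> (subst (Var(l := Var l - hbar)) f) = subst (Var(\<pi> l := Var (\<pi> l) - hbar)) f"
    using rename_subst_shift [OF permutes_inj [OF assms(2)] f, of l "- [:0, 1:]"]
    by (simp only: Cst_uminus hbar_def add_uminus_conv_diff)
  moreover have "rename \<pi> (loop_factor i l) = loop_factor i (\<pi> l)"
    by (rule rename_loop_factor [OF \<pi>])
  ultimately show "rename \<pi> (plus_numerator i r l f) = plus_numerator i r (\<pi> l) f"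
    and "rename \<pi> (minus_numerator i r l f) = minus_numerator i r (\<pi> l) f"
    unfolding plus_numerator_def minus_numerator_def by simp_all
qed

lemma block_sum_numerators:
  assumes "i \<in> Qplus S" "c \<in> block i" "f \<in> P_sym S"
  shows "block_sum (block i) c (plus_numerator i r c f) =
      (\<Sum>l\<in>block i. to_fract (plus_numerator i r l f) / to_fract (\<Prod>j\<in>block i - {l}. Var l - Var j))"
    and "block_sum (block i) c (minus_numerator i r c f) =
      (\<Sum>l\<in>block i. to_fract (minus_numerator i r l f) / to_fract (\<Prod>j\<in>block i - {l}. Var l - Var j))"
proof -
  have "rename (transpose c l) (plus_numerator i r c f) = plus_numerator i r l f"
    "rename (transpose c l) (minus_numerator i r c f) = minus_numerator i r l f" if "l \<in> block i" for l
    using that assms by (simp_all only: rename_numerators [OF assms(1) permutes_swap_id] transpose_apply_first)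
  then show "block_sum (block i) c (plus_numerator i r c f) =
      (\<Sum>l\<in>block i. to_fract (plus_numerator i r l f) / to_fract (\<Prod>j\<in>block i - {l}. Var l - Var j))"
    and "block_sum (block i) c (minus_numerator i r c f) =
      (\<Sum>l\<in>block i. to_fract (minus_numerator i r l f) / to_fract (\<Prod>j\<in>block i - {l}. Var l - Var j))"
    unfolding block_sum_def by (auto intro!: sum.cong)
qed

lemma polys_numerators:
  assumes "l \<in> {1..m}" "f \<in> polys m"
  shows "plus_numerator i r l f \<in> polys m" "minus_numerator i r l f \<in> polys m"
proof -
  have "loop_factor i l \<in> polys m"
    unfolding loop_factor_def using assms(1) by (intro polys_prod) auto
  then show "plus_numerator i r l f \<in> polys m" "minus_numerator i r l f \<in> polys m"
    unfolding plus_numerator_def minus_numerator_def using assms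
    by (auto intro!: polys_mult polys_p_poly polys_power polys_subst)
qed

lemma to_fract_neg_one_power: "to_fract ((- 1) ^ k) = (- 1) ^ k"
  by (induction k) auto

text \<open>The exponent r + 1 comes from the geometric series, \<open>loop_degree i\<close> from
  writing the V-polynomials as crossing factors of opposite sign.\<close>

lemma b_series_plus:
  assumes i: "i \<in> Qplus S" and c: "c \<in> block i" and f: "f \<in> P_sym S"
  shows "fls_nth (b_series S i f) (int r + 1) =
    (- 1) ^ (Suc r + loop_degree i) * block_sum (block i) c (plus_numerator i r c f)"
proof -
  have le: "1 \<le> int r + 1" and nats: "nat (int r + 1) = Suc r" "nat (int r + 1 - 1) = r"
    by simp_all
  note b = fls_nth_b_series [OF le, of i f, unfolded nats]
  have "fls_nth (b_series S i f) (int r + 1) = (\<Sum>k\<in>{1..vdim S i}. (- 1) ^ (Suc r + loop_degree i) *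
      (to_fract (plus_numerator i r (offset i + k) f) / to_fract (\<Prod>j\<in>block i - {offset i + k}. Var (offset i + k) - Var j)))"
    unfolding b
  proof (rule sum.cong [OF refl])
    fix k assume k: "k \<in> {1..vdim S i}"
    define l where "l = offset i + k"
    have x: "xvar S i k = Var l" "xvar S (tau S i) k = - Var l" "shift_op S i k = subst (Var(l := Var l + hbar))"
      using k i tau_Qplus [OF i] tau_tau [of i] plus_verts
      by (auto simp: xvar_def shift_op_def var_index_eq l_def)
    have lf: "loop_factor i l = (- 1) ^ loop_degree i *
     ((if arrow S i (tau S i) then poly (V_omit S (tau S i) k) (Var l + half_hbar) else 1) *
     (\<Prod>j\<in>{j \<in> verts (quiver S). j \<noteq> tau S i \<and> arrow S i j}. poly (V_poly S j) (Var l + half_hbar)))"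
      (is "_ = _ * (?A * ?B)") unfolding l_def by (rule loop_factor_eq) (use k i in auto)
    have "(- 1) ^ loop_degree i * loop_factor i l = ?A * ?B"
      unfolding lf by (simp flip: mult.assoc power_add)
    \<comment> \<open>The rearrangements are stated for atoms, so that reordering does not enter the
      large products.\<close>
    moreover have "(c * e) * (lf * p * (X * s)) = (e * lf) * (c * p * X * s)" for c e lf p X s :: pol
      by (simp only: mult_ac)
    moreover have "c * X * A * B * p * s = (A * B) * (c * p * X * s)" for c A B p X s :: pol
      by (simp only: mult_ac)
    ultimately have "(- 1) ^ Suc r * (Var l + half_hbar) ^ r * ?A * ?B * poly (p_poly S (tau S i)) (- Var l) *
        subst (Var(l := Var l + hbar)) f = (- 1) ^ (Suc r + loop_degree i) * plus_numerator i r l f"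
      unfolding plus_numerator_def power_add by (simp only:)
    then show "to_fract ((- 1) ^ Suc r * (xvar S i k + half_hbar) ^ r *
         (if arrow S i (tau S i) then poly (V_omit S (tau S i) k) (xvar S i k + half_hbar) else 1) *
         (\<Prod>j\<in>{j \<in> verts (quiver S). j \<noteq> tau S i \<and> arrow S i j}. poly (V_poly S j) (xvar S i k + half_hbar)) *
         poly (p_poly S (tau S i)) (xvar S (tau S i) k) * shift_op S i k f) /
         to_fract (poly (V_omit S i k) (xvar S i k)) =
      (- 1) ^ (Suc r + loop_degree i) * (to_fract (plus_numerator i r (offset i + k) f) /
         to_fract (\<Prod>j\<in>block i - {offset i + k}. Var (offset i + k) - Var j))"
      unfolding x poly_V_omit [OF i] l_def [symmetric]
      by (simp only: to_fract_mult to_fract_neg_one_power times_divide_eq_right)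
  qed
  also have "\<dots> = (- 1) ^ (Suc r + loop_degree i) * block_sum (block i) c (plus_numerator i r c f)"
    unfolding block_sum_numerators(1) [OF i c f] sum_distrib_left sum_offset [OF i, symmetric] ..
  finally show ?thesis .
qed

text \<open>No arrow leaves \<open>tau S i\<close>, so the V-products in the numerator are empty. At
  the point -X the series contributes -(X - \<hbar>/2)^r, and the denominator consists of
  \<open>vdim S i - 1\<close> factors of opposite sign; together this is the sign
  (-1)^\<open>vdim S i\<close>.\<close>

lemma b_series_minus:
  assumes i: "i \<in> Qplus S" and c: "c \<in> block i" and f: "f \<in> P_sym S"
  shows "fls_nth (b_series S (tau S i) f) (int r + 1) =
    (- 1) ^ vdim S i * block_sum (block i) c (minus_numerator i r c f)"
proof -
  have iv: "i \<in> verts (quiver S)" using i plus_verts by blast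
  have le: "1 \<le> int r + 1" and nats: "nat (int r + 1) = Suc r" "nat (int r + 1 - 1) = r"
    by simp_all
  note b = fls_nth_b_series [OF le, of "tau S i" f, unfolded nats]
  have "fls_nth (b_series S (tau S i) f) (int r + 1) = (\<Sum>k\<in>{1..vdim S i}. (- 1) ^ vdim S i *
      (to_fract (minus_numerator i r (offset i + k) f) / to_fract (\<Prod>j\<in>block i - {offset i + k}. Var (offset i + k) - Var j)))"
    unfolding b vdim_tau [OF iv]
  proof (rule sum.cong [OF refl])
    fix k assume k: "k \<in> {1..vdim S i}"
    define l where "l = offset i + k"
    have tt: "tau S (tau S i) = i" by (rule tau_tau [OF iv])
    have x: "xvar S i k = Var l" "xvar S (tau S i) k = - Var l" "shift_op S (tau S i) k = subst (Var(l := Var l - hbar))"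
      using k i tau_Qplus [OF i] tt
      by (auto simp: xvar_def shift_op_def var_index_eq l_def)
    have no: "arrow S (tau S i) j \<longleftrightarrow> False" for j
      using arrow_plus_minus [of "tau S i" j] tau_Qplus [OF i] by blast
    have empty: "{j \<in> verts (quiver S). j \<noteq> i \<and> False} = {}"
      by simp
    have lb: "l \<in> block i"
      using k unfolding l_def block_offset [OF i] by auto
    then have card: "card (block i - {l}) = vdim S i - 1"
      by (simp only: card_Diff_singleton card_block [OF i])
    have "poly (V_omit S (tau S i) k) (- Var l) = (\<Prod>j\<in>block i - {l}. (- 1) * (Var l - Var j))"
      unfolding poly_V_omit_tau [OF i] l_def [symmetric] by (intro prod.cong refl) simp
    also have "\<dots> = (- 1) ^ (vdim S i - 1) * (\<Prod>j\<in>block i - {l}. Var l - Var j)"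
      unfolding prod.distrib using card by simp
    finally have V: "poly (V_omit S (tau S i) k) (- Var l) = (- 1) ^ (vdim S i - 1) * (\<Prod>j\<in>block i - {l}. Var l - Var j)" .
    have "(- 1) ^ Suc r * (- Var l + half_hbar) ^ r = - ((- 1) ^ r * (- Var l + half_hbar) ^ r)"
      by simp
    also have "(- 1) ^ r * (- Var l + half_hbar) ^ r = (Var l - half_hbar) ^ r"
      by (simp flip: power_mult_distrib)
    finally have num: "(- 1) ^ Suc r * (- Var l + half_hbar) ^ r * 1 * 1 * poly (p_poly S i) (Var l) *
        subst (Var(l := Var l - hbar)) f = - minus_numerator i r l f"
      by (simp add: minus_numerator_def mult_ac)
    obtain v where v: "vdim S i = Suc v"
      using k by (cases "vdim S i") auto
    have sgn: "- 1 / (- 1) ^ (vdim S i - 1) = ((- 1) ^ vdim S i :: pol fract)"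
      unfolding v by (cases "even v") simp_all
    have "to_fract (- minus_numerator i r l f) / to_fract ((- 1) ^ (vdim S i - 1) * (\<Prod>j\<in>block i - {l}. Var l - Var j))
        = (- 1 / (- 1) ^ (vdim S i - 1)) * (to_fract (minus_numerator i r l f) / to_fract (\<Prod>j\<in>block i - {l}. Var l - Var j))"
      by (simp add: to_fract_neg_one_power)
    then show "to_fract ((- 1) ^ Suc r * (xvar S (tau S i) k + half_hbar) ^ r *
         (if arrow S (tau S i) (tau S (tau S i)) then poly (V_omit S (tau S (tau S i)) k) (xvar S (tau S i) k + half_hbar) else 1) *
         (\<Prod>j\<in>{j \<in> verts (quiver S). j \<noteq> tau S (tau S i) \<and> arrow S (tau S i) j}. poly (V_poly S j) (xvar S (tau S i) k + half_hbar)) *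
         poly (p_poly S (tau S (tau S i))) (xvar S (tau S (tau S i)) k) * shift_op S (tau S i) k f) /
         to_fract (poly (V_omit S (tau S i) k) (xvar S (tau S i) k)) =
      (- 1) ^ vdim S i * (to_fract (minus_numerator i r (offset i + k) f) /
         to_fract (\<Prod>j\<in>block i - {offset i + k}. Var (offset i + k) - Var j))"
      unfolding no if_False tt x V l_def [symmetric] sgn empty prod.empty num [symmetric] .
  qed
  also have "\<dots> = (- 1) ^ vdim S i * block_sum (block i) c (minus_numerator i r c f)"
    unfolding block_sum_numerators(2) [OF i c f] sum_distrib_left sum_offset [OF i, symmetric] ..
  finally show ?thesis .
qed

text \<open>Arrows start in \<open>Qplus S\<close>, so both sums have the same range. If i is joined
  to \<open>tau S i\<close> by an arrow, the positive number \<open>vdim S i\<close> occurs in the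
  sum and the truncated subtraction in \<open>loop_degree\<close> is exact.\<close>

lemma eps_eq:
  assumes i: "i \<in> Qplus S" "vdim S i > 0"
  shows "int r + eps S i = int (r + vdim S i + loop_degree i)"
proof -
  let ?J = "{j \<in> Qplus S. arrow S j (tau S i)}"
  have "{j \<in> verts (quiver S). arrow S j (tau S i)} = ?J"
    using arrow_plus_minus plus_verts by blast
  moreover have "1 \<le> (\<Sum>j\<in>?J. vdim S j)" if "arrow S i (tau S i)"
    using sum_nonneg_leq_bound [of ?J "vdim S" "\<Sum>j\<in>?J. vdim S j" i] that i by simp
  ultimately show ?thesis
    by (auto simp: eps_def loop_degree_def delta_def of_nat_diff)
qed

lemma block_ends:
  assumes i: "i \<in> Qplus S" "vdim S i > 0"
  shows "pos_first S i \<in> block i" "pos_last S i \<in> block i" "pos_last S i = pos_first S i + (vdim S i - 1)"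
  using pos_last_eq [OF i(1)] pos_first_ge_1 [of i] i(2) by auto

text \<open>The downward chain contributes \<open>vdim S i - 1\<close> to the exponent of -1.
  Compared with r + 1 + \<open>loop_degree i\<close> from the series, this leaves r +
  \<open>eps S i\<close> modulo 2.\<close>

lemma plus_loop:
  assumes i: "i \<in> Qplus S" "vdim S i > 0"
  obtains \<phi> where "realizes (D_loop S i \<circ> dot_plus (pos_first S i) [:0, -1/2:] ^^ r) (aleph S) \<phi> (aleph S)"
    "\<And>f. f \<in> P_sym S \<Longrightarrow> \<phi> f \<in> P_sym S"
    "\<And>f. f \<in> P_sym S \<Longrightarrow>
      fls_nth (b_series S i f) (int r + 1) = to_fract (Cst [:(-1) powi (int r + eps S i):] * \<phi> f)"
proof -
  define a N where "a = pos_first S i" and "N = pos_last S i"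
  have aN: "a \<in> block i" "N \<in> block i" "N = a + (vdim S i - 1)"
    unfolding a_def N_def by (rule block_ends [OF i])+
  have blk: "block i = {a..N}"
    by (simp add: a_def N_def)
  let ?\<sigma> = "\<lambda>n. if n = a then Var N + hbar else Var (rotate_right a N n)"
  define \<phi> where "\<phi> = (\<lambda>f. op_prod (map demazure [a..<N]) (loop_factor i N * poly (p_poly S (tau S i)) (- Var N) * subst ?\<sigma> f))
      \<circ> (\<lambda>f. (Var a + Cst [:0, -1/2:]) ^ r * f)"
  have a_le: "1 \<le> a" "a \<le> length (aleph S)"
    using block_subset [OF i(1)] aN(1) by (auto simp: length_aleph)
  have real: "realizes (D_loop S i \<circ> dot_plus a [:0, -1/2:] ^^ r) (aleph S) \<phi> (aleph S)"
    unfolding \<phi>_def a_def N_def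
    by (rule realizes_comp [OF realizes_dot_plus_power realizes_D_loop_plus [OF i]])
      (use a_le aleph_in_lists in \<open>auto simp: a_def\<close>)
  have \<phi>: "\<phi> f = op_prod (map demazure [a..<N]) (plus_numerator i r N f)" if f: "f \<in> P_sym S" for f
  proof -
    \<comment> \<open>The substitution is a rotation of the block followed by the shift at N; a
      symmetric f absorbs the rotation.\<close>
    have "?\<sigma> = (\<lambda>n. subst (Var(N := Var N + hbar)) (Var (rotate_right a N n)))"
      using aN by (auto simp: fun_eq_iff rotate_right_def)
    then have "subst ?\<sigma> f = subst (Var(N := Var N + hbar)) (rename (rotate_right a N) f)"
      by (simp only: rename_def subst_subst)
    also have "rename (rotate_right a N) f = f"
      using f i(1) rotate_permutes(1) [of a N] aN blk by (auto simp: mem_P_sym sym_in_def)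
    finally have "subst ?\<sigma> f = subst (Var(N := Var N + hbar)) f" .
    moreover have "Var N + hbar + Cst [:0, -1/2:] = Var N + half_hbar"
      unfolding Cst_half(2) hbar_halves by simp
    ultimately show ?thesis
      unfolding \<phi>_def plus_numerator_def by (simp add: mult.assoc add.assoc)
  qed
  have inv: "rename \<pi> (plus_numerator i r N f) = plus_numerator i r N f"
    if "f \<in> P_sym S" "j \<in> Qplus S" "\<pi> permutes block j" "\<pi> N = N" for f j \<pi>
    using rename_numerators(1) [OF that(2,3,1), of i r N] that(4) by simp
  have bs: "to_fract (op_prod (map demazure [a..<N]) (plus_numerator i r N f)) =
      (- 1) ^ (vdim S i - 1) * block_sum (block i) N (plus_numerator i r N f)" if f: "f \<in> P_sym S" for f
  proof -
    have "sym_in {a..<N} (plus_numerator i r N f)"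
      unfolding sym_in_def
    proof (intro allI impI)
      fix \<pi> assume \<pi>: "\<pi> permutes {a..<N}"
      show "rename \<pi> (plus_numerator i r N f) = plus_numerator i r N f"
        by (rule inv [OF f i(1)]) (unfold blk, rule permutes_subset [OF \<pi>], auto intro: permutes_not_in [OF \<pi>])
    qed
    moreover have "N - (vdim S i - 1) = a"
      using aN(3) by simp
    ultimately show ?thesis
      using demazure_chain_down [of N "vdim S i - 1" "plus_numerator i r N f"] aN(3) unfolding blk by simp
  qed
  have num: "plus_numerator i r N f \<in> polys m" if "f \<in> P_sym S" for f
    using that block_subset [OF i(1)] aN(2) by (intro polys_numerators) (auto simp: mem_P_sym)
  show ?thesis
  proof (rule that [OF real [unfolded a_def]])
    fix f assume f: "f \<in> P_sym S"
    show "\<phi> f \<in> P_sym S"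
      unfolding \<phi> [OF f]
      by (rule block_operator_P_sym [OF i(1) aN(2) num [OF f] inv [OF f] _ bs [OF f]]) (auto simp: blk)
    obtain v where v: "vdim S i = Suc v"
      using i(2) gr0_conv_Suc by blast
    have "(- 1) powi (int r + eps S i) = ((- 1) ^ (r + vdim S i + loop_degree i) :: complex)"
      unfolding eps_eq [OF i] by (rule power_int_of_nat)
    then have "to_fract (Cst [:(-1) powi (int r + eps S i):] * \<phi> f) =
        (- 1) ^ (r + vdim S i + loop_degree i) * ((- 1) ^ (vdim S i - 1) * block_sum (block i) N (plus_numerator i r N f))"
      unfolding \<phi> [OF f] by (simp only: Cst_neg_one_power to_fract_mult to_fract_neg_one_power bs [OF f])
    also have "\<dots> = (- 1) ^ (Suc r + loop_degree i) * block_sum (block i) N (plus_numerator i r N f)"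
      unfolding v by (cases "even v") (simp_all add: power_add)
    finally show "fls_nth (b_series S i f) (int r + 1) = to_fract (Cst [:(-1) powi (int r + eps S i):] * \<phi> f)"
      using b_series_plus [OF i(1) aN(2) f] by simp
  qed
qed

text \<open>The upward chain has no sign, so the sign of \<open>b_series_minus\<close>
  remains.\<close>

lemma minus_loop:
  assumes i: "i \<in> Qplus S" "vdim S i > 0"
  obtains \<phi> where "realizes (D_loop S (tau S i) \<circ> dot_plus (pos_last S i) [:0, 1/2:] ^^ r) (aleph S) \<phi> (aleph S)"
    "\<And>f. f \<in> P_sym S \<Longrightarrow> \<phi> f \<in> P_sym S"
    "\<And>f. f \<in> P_sym S \<Longrightarrow>
      fls_nth (b_series S (tau S i) f) (int r + 1) = to_fract (Cst [:(-1) ^ vdim S i:] * \<phi> f)"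
proof -
  define a N where "a = pos_first S i" and "N = pos_last S i"
  have aN: "a \<in> block i" "N \<in> block i" "N = a + (vdim S i - 1)"
    unfolding a_def N_def by (rule block_ends [OF i])+
  have blk: "block i = {a..N}"
    by (simp add: a_def N_def)
  let ?\<sigma> = "\<lambda>n. if n = N then Var a - hbar else Var (rotate_left a N n)"
  define \<phi> where "\<phi> = (\<lambda>f. op_prod (map demazure (rev [a..<N])) (poly (p_poly S i) (Var a) * subst ?\<sigma> f))
      \<circ> (\<lambda>f. (Var N + Cst [:0, 1/2:]) ^ r * f)"
  have N_le: "1 \<le> N" "N \<le> length (aleph S)"
    using block_subset [OF i(1)] aN(2) by (auto simp: length_aleph)
  have real: "realizes (D_loop S (tau S i) \<circ> dot_plus N [:0, 1/2:] ^^ r) (aleph S) \<phi> (aleph S)"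
    unfolding \<phi>_def a_def N_def
    by (rule realizes_comp [OF realizes_dot_plus_power realizes_D_loop_minus [OF i]])
      (use N_le aleph_in_lists in \<open>auto simp: N_def\<close>)
  have \<phi>: "\<phi> f = op_prod (map demazure (rev [a..<N])) (minus_numerator i r a f)" if f: "f \<in> P_sym S" for f
  proof -
    have "?\<sigma> = (\<lambda>n. subst (Var(a := Var a - hbar)) (Var (rotate_left a N n)))"
      using aN by (auto simp: fun_eq_iff rotate_left_def)
    then have "subst ?\<sigma> f = subst (Var(a := Var a - hbar)) (rename (rotate_left a N) f)"
      by (simp only: rename_def subst_subst)
    also have "rename (rotate_left a N) f = f"
      using f i(1) rotate_permutes(2) [of a N] aN blk by (auto simp: mem_P_sym sym_in_def)
    finally have "subst ?\<sigma> f = subst (Var(a := Var a - hbar)) f" .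
    then show ?thesis
      unfolding \<phi>_def minus_numerator_def by (simp add: Cst_half(1) hbar_halves mult.assoc)
  qed
  have inv: "rename \<pi> (minus_numerator i r a f) = minus_numerator i r a f"
    if "f \<in> P_sym S" "j \<in> Qplus S" "\<pi> permutes block j" "\<pi> a = a" for f j \<pi>
    using rename_numerators(2) [OF that(2,3,1), of i r a] that(4) by simp
  have bs: "to_fract (op_prod (map demazure (rev [a..<N])) (minus_numerator i r a f)) =
      (- 1) ^ 0 * block_sum (block i) a (minus_numerator i r a f)" if f: "f \<in> P_sym S" for f
  proof -
    have "sym_in {a<..N} (minus_numerator i r a f)"
      unfolding sym_in_def
    proof (intro allI impI)
      fix \<pi> assume \<pi>: "\<pi> permutes {a<..N}"
      show "rename \<pi> (minus_numerator i r a f) = minus_numerator i r a f"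
        by (rule inv [OF f i(1)]) (unfold blk, rule permutes_subset [OF \<pi>], auto intro: permutes_not_in [OF \<pi>])
    qed
    then show ?thesis
      using demazure_chain_up [of a "vdim S i - 1" "minus_numerator i r a f"] unfolding blk aN(3) by simp
  qed
  have num: "minus_numerator i r a f \<in> polys m" if "f \<in> P_sym S" for f
    using that block_subset [OF i(1)] aN(1) by (intro polys_numerators) (auto simp: mem_P_sym)
  show ?thesis
  proof (rule that [OF real [unfolded N_def]])
    fix f assume f: "f \<in> P_sym S"
    show "\<phi> f \<in> P_sym S"
      unfolding \<phi> [OF f]
      by (rule block_operator_P_sym [OF i(1) aN(1) num [OF f] inv [OF f] _ bs [OF f]]) (auto simp: blk)
    show "fls_nth (b_series S (tau S i) f) (int r + 1) = to_fract (Cst [:(-1) ^ vdim S i:] * \<phi> f)"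
      unfolding \<phi> [OF f] using b_series_minus [OF i(1) aN(1) f, of r] bs [OF f]
      by (simp only: Cst_neg_one_power to_fract_mult to_fract_neg_one_power power_0 mult_1)
  qed
qed

end

section \<open>The coefficients of the series \<open>h\<^sub>i\<close>\<close>

text \<open>
  The relation expresses that \<open>\<pi>\<close>, acting on coefficients, maps \<open>s\<close> to \<open>s'\<close>.  Unlike invariance under \<open>\<pi>\<close>
  it can be checked on the linear factors of a product which \<open>\<pi>\<close> only permutes.
\<close>

definition coeff_rel :: "nat \<Rightarrow> (nat \<Rightarrow> nat) \<Rightarrow> ser \<Rightarrow> ser \<Rightarrow> bool" where
  "coeff_rel k \<pi> s s' \<longleftrightarrow>
    (\<forall>n. \<exists>g\<in>polys k. fls_nth s n = to_fract g \<and> fls_nth s' n = to_fract (rename \<pi> g))"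

lemma coeff_relI:
  "(\<And>n. g n \<in> polys k) \<Longrightarrow> (\<And>n. fls_nth s n = to_fract (g n)) \<Longrightarrow>
    (\<And>n. fls_nth s' n = to_fract (rename \<pi> (g n))) \<Longrightarrow> coeff_rel k \<pi> s s'"
  unfolding coeff_rel_def by blast

lemma coeff_relE:
  assumes "coeff_rel k \<pi> s s'"
  obtains g where "\<And>n. g n \<in> polys k" "\<And>n. fls_nth s n = to_fract (g n)"
    "\<And>n. fls_nth s' n = to_fract (rename \<pi> (g n))"
  using assms unfolding coeff_rel_def by metis

lemma coeff_rel_emb: "g \<in> polys k \<Longrightarrow> coeff_rel k \<pi> (emb g) (emb (rename \<pi> g))"
  by (rule coeff_relI [of "\<lambda>n. if n = 0 then g else 0"]) (auto simp: emb_def)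

lemma coeff_rel_1: "coeff_rel k \<pi> 1 1"
  using coeff_rel_emb [of 1 k \<pi>] by (simp add: emb_1)

lemma coeff_rel_z: "coeff_rel k \<pi> z_ser z_ser"
  by (rule coeff_relI [of "\<lambda>n. if n = - 1 then 1 else 0"]) auto

lemma coeff_rel_X: "coeff_rel k \<pi> fls_X fls_X"
  by (rule coeff_relI [of "\<lambda>n. if n = 1 then 1 else 0"]) auto

lemma coeff_rel_add:
  assumes "coeff_rel k \<pi> s s'" "coeff_rel k \<pi> t t'"
  shows "coeff_rel k \<pi> (s + t) (s' + t')"
proof -
  obtain g where g: "\<And>n. g n \<in> polys k" "\<And>n. fls_nth s n = to_fract (g n)" "\<And>n. fls_nth s' n = to_fract (rename \<pi> (g n))"
    by (rule coeff_relE [OF assms(1)]) (rule that)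
  obtain h where h: "\<And>n. h n \<in> polys k" "\<And>n. fls_nth t n = to_fract (h n)" "\<And>n. fls_nth t' n = to_fract (rename \<pi> (h n))"
    by (rule coeff_relE [OF assms(2)]) (rule that)
  show ?thesis
    by (rule coeff_relI [of "\<lambda>n. g n + h n"]) (simp_all add: g h)
qed

lemma coeff_rel_uminus:
  assumes "coeff_rel k \<pi> s s'"
  shows "coeff_rel k \<pi> (- s) (- s')"
proof -
  obtain g where g: "\<And>n. g n \<in> polys k" "\<And>n. fls_nth s n = to_fract (g n)" "\<And>n. fls_nth s' n = to_fract (rename \<pi> (g n))"
    by (rule coeff_relE [OF assms]) (rule that)
  show ?thesis
    by (rule coeff_relI [of "\<lambda>n. - g n"]) (simp_all add: g)
qed

lemma coeff_rel_diff: "coeff_rel k \<pi> s s' \<Longrightarrow> coeff_rel k \<pi> t t' \<Longrightarrow> coeff_rel k \<pi> (s - t) (s' - t')"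
  using coeff_rel_add [OF _ coeff_rel_uminus] by fastforce

text \<open>With bounds p and q common to two pairs of series, both products are expanded over the
  same finite range.\<close>

lemma fls_times_nth_bounds:
  fixes f g :: "'b::{comm_monoid_add, mult_zero} fls"
  assumes "p \<le> fls_subdegree f" "q \<le> fls_subdegree g"
  shows "fls_nth (f * g) n = (\<Sum>i=p..n - q. fls_nth f i * fls_nth g (n - i))"
  unfolding fls_times_nth(2)
  by (rule sum.mono_neutral_left) (use assms in \<open>auto simp: not_le\<close>)

lemma coeff_rel_mult:
  assumes "coeff_rel k \<pi> s s'" "coeff_rel k \<pi> t t'"
  shows "coeff_rel k \<pi> (s * t) (s' * t')"
proof -
  obtain g where g: "\<And>n. g n \<in> polys k" "\<And>n. fls_nth s n = to_fract (g n)" "\<And>n. fls_nth s' n = to_fract (rename \<pi> (g n))"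
    by (rule coeff_relE [OF assms(1)]) (rule that)
  obtain h where h: "\<And>n. h n \<in> polys k" "\<And>n. fls_nth t n = to_fract (h n)" "\<And>n. fls_nth t' n = to_fract (rename \<pi> (h n))"
    by (rule coeff_relE [OF assms(2)]) (rule that)
  define p q where "p = min (fls_subdegree s) (fls_subdegree s')" and "q = min (fls_subdegree t) (fls_subdegree t')"
  show ?thesis
  proof (rule coeff_relI [of "\<lambda>n. \<Sum>i=p..n - q. g i * h (n - i)"])
    show "fls_nth (s * t) n = to_fract (\<Sum>i=p..n - q. g i * h (n - i))" for n
      by (subst fls_times_nth_bounds [of p _ q]) (simp_all add: p_def q_def g h)
    show "fls_nth (s' * t') n = to_fract (rename \<pi> (\<Sum>i=p..n - q. g i * h (n - i)))" for n
      by (subst fls_times_nth_bounds [of p _ q]) (simp_all add: p_def q_def g h)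
  qed (simp add: g h polys_sum)
qed

lemma coeff_rel_prod:
  "(\<And>x. x \<in> A \<Longrightarrow> coeff_rel k \<pi> (F x) (G x)) \<Longrightarrow> coeff_rel k \<pi> (prod F A) (prod G A)"
  by (induction A rule: infinite_finite_induct) (auto intro: coeff_rel_1 coeff_rel_mult)

text \<open>The leading coefficient -1 is a unit, so dividing by such a factor keeps the
  coefficients polynomial.\<close>

lemma coeff_rel_inverse_linear:
  assumes "g \<in> polys k"
  shows "coeff_rel k \<pi> (inverse (- z_ser - emb g)) (inverse (- z_ser - emb (rename \<pi> g)))"
proof -
  have pow: "to_fract (x ^ k) = to_fract x ^ k" for x :: pol and k
    by (induction k) auto
  have nth: "fls_nth (inverse (- z_ser - emb g)) n = to_fract (if n \<ge> 1 then (- 1) ^ nat n * g ^ nat (n - 1) else 0)" for g n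
    using fls_nth_inverse_linear [of "to_fract g" n] by (simp add: emb_def divide_inverse pow)
  show ?thesis
    by (rule coeff_relI [of "\<lambda>n. if n \<ge> 1 then (- 1) ^ nat n * g ^ nat (n - 1) else 0"])
      (simp_all add: nth assms)
qed

section \<open>Linear factors of the series h\<close>

lemma ev_linear_mult: "ev ([:a, 1:] * F) u = (emb a + u) * ev F u"
proof -
  have "map_poly emb (pCons 0 F + smult a F) = pCons 0 (map_poly emb F) + smult (emb a) (map_poly emb F)"
    by (rule poly_eqI) (auto simp: coeff_map_poly emb_0 emb_add emb_mult coeff_pCons split: nat.split)
  moreover have "[:a, 1:] * F = pCons 0 F + smult a F"
    by simp
  ultimately show ?thesis
    by (simp only: ev_def) (simp add: algebra_simps)
qed

lemma ev_1: "ev 1 u = 1"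
  by (simp add: ev_def map_poly_1' emb_1)

lemma ev_prod_linear: "finite A \<Longrightarrow> ev (\<Prod>x\<in>A. [:- c x, 1:]) u = (\<Prod>x\<in>A. u - emb (c x))"
proof (induction A rule: finite_induct)
  case empty
  then show ?case by (simp add: ev_1)
next
  case (insert x A)
  then show ?case
    unfolding prod.insert [OF insert.hyps] ev_linear_mult by (simp add: emb_uminus)
qed

lemma ev_p_poly: "ev (p_poly S i) u = (\<Prod>c\<in>#params S i. u - emb (Cst [:0, c:]))"
proof -
  have "ev (\<Prod>c\<in>#M. [:- Cst [:0, c:], 1:]) u = (\<Prod>c\<in>#M. u - emb (Cst [:0, c:]))" for M
  proof (induction M)
    case empty
    then show ?case by (simp add: ev_1)
  next
    case (add c M)
    then show ?case
      by (simp only: image_mset_add_mset prod_mset.add_mset ev_linear_mult) (simp add: emb_uminus)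
  qed
  then show ?thesis
    by (simp add: p_poly_def)
qed

lemma coeff_rel_ev_p_poly:
  assumes "coeff_rel k \<pi> u u"
  shows "coeff_rel k \<pi> (ev (p_poly S i) u) (ev (p_poly S i) u)"
proof -
  have "coeff_rel k \<pi> (\<Prod>c\<in>#M. u - emb (Cst [:0, c:])) (\<Prod>c\<in>#M. u - emb (Cst [:0, c:]))" for M
  proof (induction M)
    case (add c M)
    have "coeff_rel k \<pi> (u - emb (Cst [:0, c:])) (u - emb (Cst [:0, c:]))"
      using coeff_rel_diff [OF assms coeff_rel_emb [OF polys_Cst]] by fastforce
    then show ?case
      using coeff_rel_mult add by simp
  qed (simp add: coeff_rel_1)
  then show ?thesis
    by (simp add: ev_p_poly)
qed

text \<open>The possible exponents are the Cartan entries of i and \<open>tau S i\<close>. As 2 is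
  invertible in the coefficients, the inverse of 2z is \<open>fls_X\<close> times a
  constant.\<close>

lemma coeff_rel_two_z:
  assumes "e = 0 \<or> e = - 1"
  shows "coeff_rel k \<pi> ((2 * z_ser) powi e) ((2 * z_ser) powi e)"
proof (cases "e = 0")
  case False
  have Cst_2: "Cst [:2:] = 1 + 1"
    using Cst_of_nat [of 2] by simp
  have two: "emb (Cst [:2:]) = 2"
    unfolding Cst_2 emb_add emb_1 by simp
  have "Cst [:1/2:] * Cst [:2:] = 1"
    by (simp flip: Cst_pCons_mult one_pCons)
  then have "emb (Cst [:1/2:]) * 2 = 1"
    by (metis two emb_mult emb_1)
  moreover have "fls_X * z_ser = 1"
    by (simp add: fls_X_times_conv_shift)
  moreover have "emb (Cst [:1/2:]) * fls_X * (2 * z_ser) = (emb (Cst [:1/2:]) * 2) * (fls_X * z_ser)"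
    by (simp only: mult_ac)
  ultimately have "emb (Cst [:1/2:]) * fls_X * (2 * z_ser) = 1"
    by (simp only: mult_1)
  then have "inverse (2 * z_ser) = emb (Cst [:1/2:]) * fls_X"
    by (metis inverse_unique mult.commute)
  moreover have "(2 * z_ser) powi e = inverse (2 * z_ser)"
    using assms False by (simp only: power_int_minus1_right simp_thms)
  moreover have "coeff_rel k \<pi> (emb (Cst [:1/2:]) * fls_X) (emb (Cst [:1/2:]) * fls_X)"
    using coeff_rel_mult [OF coeff_rel_emb [OF polys_Cst] coeff_rel_X] by fastforce
  ultimately show ?thesis
    by (simp only:)
qed (simp add: coeff_rel_1)

lemma coeff_rel_sign: "coeff_rel k \<pi> ((- 1) powi e) ((- 1) powi e)"
proof -
  have "(- 1 :: ser) powi e = 1 \<or> (- 1 :: ser) powi e = - 1"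
    by (cases "even e") (simp_all add: power_int_minus_left)
  then show ?thesis
    using coeff_rel_1 coeff_rel_uminus by metis
qed

context iyangian_datum
begin

lemma ev_V_poly:
  "i \<in> Qplus S \<Longrightarrow> ev (V_poly S i) u = (\<Prod>l\<in>block i. u - emb (Var l))"
  unfolding V_poly_def
  by (subst prod_offset [symmetric]) (auto intro!: prod.cong simp: ev_prod_linear xvar_def var_index_eq)

lemma ev_V_poly_tau:
  assumes "i \<in> Qplus S"
  shows "ev (V_poly S (tau S i)) u = (\<Prod>l\<in>block i. u - emb (- Var l))"
proof -
  have iv: "i \<in> verts (quiver S)"
    using assms plus_verts by blast
  have x: "xvar S (tau S i) k = - Var (offset i + k)" if "k \<in> {1..vdim S i}" for k
    using that tau_Qplus [OF assms] tau_tau [OF iv] by (simp add: xvar_def var_index_eq)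
  show ?thesis
    unfolding V_poly_def vdim_tau [OF iv] ev_prod_linear [OF finite_atLeastAtMost] prod_offset [OF assms, symmetric]
    by (intro prod.cong refl) (simp only: x)
qed

lemma verts_cases:
  assumes "i \<in> verts (quiver S)"
  obtains "i \<in> Qplus S" | j where "j \<in> Qplus S" "i = tau S j"
  using assms tau_minus tau_tau by (metis DiffI imageI)

text \<open>The constant is 1 for vertices of \<open>Qplus S\<close> and -1 for the others, which
  lets later arguments treat both kinds at once.\<close>

lemma ev_V_poly_cases:
  assumes "i \<in> verts (quiver S)"
  obtains j \<epsilon> where "j \<in> Qplus S" "\<And>u. ev (V_poly S i) u = (\<Prod>l\<in>block j. u - emb (Cst \<epsilon> * Var l))"
proof (rule verts_cases [OF assms])
  assume "i \<in> Qplus S"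
  then show thesis
    by (intro that [of i 1]) (simp_all add: ev_V_poly)
next
  fix j assume "j \<in> Qplus S" "i = tau S j"
  then show thesis
    by (intro that [of j "- 1"]) (simp_all add: ev_V_poly_tau Cst_uminus)
qed

lemma prod_block_permute:
  assumes "j \<in> Qplus S" "i \<in> Qplus S" "\<pi> permutes block j"
  shows "(\<Prod>l\<in>block i. F (\<pi> l)) = (\<Prod>l\<in>block i. F l)"
proof (cases "i = j")
  case True
  then show ?thesis
    using prod.reindex_bij_betw [OF permutes_imp_bij [OF assms(3)], of F] by simp
next
  case False
  then have "\<pi> l = l" if "l \<in> block i" for l
    using that block_disjoint [OF assms(2,1)] by (intro permutes_not_in [OF assms(3)]) blast
  then show ?thesis
    by (intro prod.cong) auto
qed

lemma coeff_rel_ev_V_poly: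
  assumes i: "i \<in> verts (quiver S)" and j: "j \<in> Qplus S" and \<pi>: "\<pi> permutes block j"
    and u: "coeff_rel m \<pi> u u"
  shows "coeff_rel m \<pi> (ev (V_poly S i) u) (ev (V_poly S i) u)"
proof -
  obtain k \<epsilon> where k: "k \<in> Qplus S" and V: "\<And>u. ev (V_poly S i) u = (\<Prod>l\<in>block k. u - emb (Cst \<epsilon> * Var l))"
    by (rule ev_V_poly_cases [OF i]) (rule that)
  have "coeff_rel m \<pi> (\<Prod>l\<in>block k. u - emb (Cst \<epsilon> * Var l)) (\<Prod>l\<in>block k. u - emb (Cst \<epsilon> * Var (\<pi> l)))"
  proof (rule coeff_rel_prod)
    fix l assume "l \<in> block k"
    then have "Cst \<epsilon> * Var l \<in> polys m"
      using block_subset [OF k] by (intro polys_mult) auto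
    from coeff_rel_diff [OF u coeff_rel_emb [OF this]]
    show "coeff_rel m \<pi> (u - emb (Cst \<epsilon> * Var l)) (u - emb (Cst \<epsilon> * Var (\<pi> l)))"
      by simp
  qed
  then show ?thesis
    unfolding V prod_block_permute [OF j k \<pi>, of "\<lambda>l. u - emb (Cst \<epsilon> * Var l)"] .
qed

lemma coeff_rel_inverse_ev_V_poly:
  assumes i: "i \<in> verts (quiver S)" and j: "j \<in> Qplus S" and \<pi>: "\<pi> permutes block j"
  shows "coeff_rel m \<pi> (inverse (ev (V_poly S i) (- z_ser - emb (Cst c)))) (inverse (ev (V_poly S i) (- z_ser - emb (Cst c))))"
proof -
  obtain k \<epsilon> where k: "k \<in> Qplus S" and V: "\<And>u. ev (V_poly S i) u = (\<Prod>l\<in>block k. u - emb (Cst \<epsilon> * Var l))"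
    by (rule ev_V_poly_cases [OF i]) (rule that)
  let ?F = "\<lambda>l. inverse (- z_ser - emb (Cst c + Cst \<epsilon> * Var l))"
  have V': "inverse (ev (V_poly S i) (- z_ser - emb (Cst c))) = (\<Prod>l\<in>block k. ?F l)"
    unfolding V by (simp add: prod_inversef [symmetric] o_def emb_add diff_diff_eq)
  have "coeff_rel m \<pi> (\<Prod>l\<in>block k. ?F l) (\<Prod>l\<in>block k. ?F (\<pi> l))"
  proof (rule coeff_rel_prod)
    fix l assume "l \<in> block k"
    then have "Cst c + Cst \<epsilon> * Var l \<in> polys m"
      using block_subset [OF k] by (intro polys_add polys_mult) auto
    from coeff_rel_inverse_linear [OF this, of \<pi>]
    show "coeff_rel m \<pi> (?F l) (?F (\<pi> l))"
      by simp
  qed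
  then show ?thesis
    unfolding V' prod_block_permute [OF j k \<pi>, of ?F] .
qed

lemma coeff_rel_h_series:
  assumes i: "i \<in> verts (quiver S)" and j: "j \<in> Qplus S" and \<pi>: "\<pi> permutes block j"
  shows "coeff_rel m \<pi> (h_series S i) (h_series S i)"
proof -
  note V = coeff_rel_ev_V_poly [OF _ j \<pi>]
  have z: "coeff_rel m \<pi> z_ser z_ser" "coeff_rel m \<pi> (- z_ser) (- z_ser)"
    by (intro coeff_rel_z coeff_rel_uminus)+
  have d: "coeff_rel m \<pi> (inverse (ev (V_poly S i) (- z_ser + emb half_hbar))) (inverse (ev (V_poly S i) (- z_ser + emb half_hbar)))"
    "coeff_rel m \<pi> (inverse (ev (V_poly S i) (- z_ser - emb half_hbar))) (inverse (ev (V_poly S i) (- z_ser - emb half_hbar)))"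
    using coeff_rel_inverse_ev_V_poly [OF i j \<pi>, of "- [:0, 1/2:]"] coeff_rel_inverse_ev_V_poly [OF i j \<pi>, of "[:0, 1/2:]"]
    by (simp_all only: Cst_uminus emb_uminus half_hbar_def diff_minus_eq_add)
  have cartan: "cartan S i (tau S i) = 0 \<or> cartan S i (tau S i) = - 1"
    using tau_no_fix [OF i] by (auto simp: cartan_def)
  show ?thesis
    unfolding h_series_def divide_inverse inverse_mult_distrib
    by (intro coeff_rel_mult coeff_rel_sign coeff_rel_two_z [OF cartan] coeff_rel_ev_p_poly coeff_rel_prod V d z) auto
qed

text \<open>For each \<pi> the relation provides a polynomial of its own; by injectivity of
  \<open>to_fract\<close> all of them equal one g, which is therefore invariant.\<close>

lemma h_series_coeff:
  assumes i: "i \<in> verts (quiver S)"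
  obtains g where "g \<in> P_sym S" "fls_nth (h_series S i) n = to_fract g"
proof -
  have ne: "Qplus S \<noteq> {}"
    using i tau_minus by (metis Diff_empty empty_iff imageI)
  have rel: "\<exists>g\<in>polys m. fls_nth (h_series S i) n = to_fract g \<and> fls_nth (h_series S i) n = to_fract (rename \<pi> g)"
    if "j \<in> Qplus S" "\<pi> permutes block j" for j \<pi>
    using coeff_rel_h_series [OF i that] unfolding coeff_rel_def by blast
  obtain j where "j \<in> Qplus S"
    using ne by blast
  from rel [OF this permutes_id] obtain g where g: "g \<in> polys m" "fls_nth (h_series S i) n = to_fract g"
    by blast
  have "rename \<pi> g = g" if "j \<in> Qplus S" "\<pi> permutes block j" for j \<pi>
    using rel [OF that] g(2) by auto
  then have "g \<in> P_sym S"
    using g(1) by (simp add: mem_P_sym sym_in_def)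
  then show thesis
    using g(2) that by blast
qed

section \<open>The truncated shifted iYangian inside the KLR iYangian\<close>

lemma P_sym_polys: "f \<in> P_sym S \<Longrightarrow> f \<in> polys m"
  by (simp add: mem_P_sym)

lemma P_sym_add: "f \<in> P_sym S \<Longrightarrow> g \<in> P_sym S \<Longrightarrow> f + g \<in> P_sym S"
  by (simp add: mem_P_sym sym_in_def)

lemma P_sym_mult: "f \<in> P_sym S \<Longrightarrow> g \<in> P_sym S \<Longrightarrow> f * g \<in> P_sym S"
  by (simp add: mem_P_sym sym_in_mult)

lemma P_sym_Cst: "Cst c \<in> P_sym S"
  by (simp add: mem_P_sym sym_in_Cst)

lemma coeff_op_eq: "f \<in> P_sym S \<Longrightarrow> fls_nth (B f) n = to_fract g \<Longrightarrow> coeff_op S B n f = g"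
  by (simp add: coeff_op_def)

section \<open>Operators on P induced by the KLR iYangian\<close>

definition realizable :: "(pol \<Rightarrow> pol) \<Rightarrow> bool" where
  "realizable \<phi> \<longleftrightarrow> (\<exists>A. realizes A (aleph S) \<phi> (aleph S))"

lemma realizable_comp: "realizable \<phi> \<Longrightarrow> realizable \<psi> \<Longrightarrow> realizable (\<psi> \<circ> \<phi>)"
  unfolding realizable_def using realizes_comp by blast

lemma realizable_cong: "realizable \<phi> \<Longrightarrow> (\<And>f. f \<in> polys m \<Longrightarrow> \<phi> f = \<psi> f) \<Longrightarrow> realizable \<psi>"
  unfolding realizable_def using realizes_cong length_aleph by metis

lemma realizable_mult: "g \<in> polys m \<Longrightarrow> realizable (\<lambda>f. g * f)"
  unfolding realizable_def using realizes_mult_poly [OF aleph_in_lists] length_aleph by simp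

lemma realizable_add: "realizable \<phi> \<Longrightarrow> realizable \<psi> \<Longrightarrow> realizable (\<lambda>f. \<phi> f + \<psi> f)"
  unfolding realizable_def using realizes_add by blast

text \<open>The crossings named by the reduced word stay inside block i, where neighbouring letters
  of the word agree, so they act as divided differences.\<close>

lemma realizable_e_block:
  assumes i: "i \<in> Qplus S"
  shows "realizable (e_block S i)"
proof -
  let ?ks = "map (\<lambda>k. offset i + k) (longest_word (vdim S i))"
  have "realizes (op_prod (map (sigma S) ?ks)) (aleph S) (op_prod (map demazure ?ks)) (aleph S)"
  proof (rule realizes_demazure_list [OF aleph_in_lists])
    fix k assume "k \<in> set ?ks"
    then have k: "k \<in> block i" "Suc k \<in> block i" "1 \<le> k" "k < m"
      using offset_letters [OF i] by auto
    then show "1 \<le> k \<and> k < length (aleph S) \<and> aleph S ! (k - 1) = aleph S ! k"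
      unfolding block_eq [OF i] by (simp add: length_aleph)
  qed
  then have "realizable (longest_demazure (offset i) (vdim S i))"
    unfolding realizable_def map_map o_def by blast
  then have "realizable ((\<lambda>f. Cst [:1 / fact (vdim S i):] * f) \<circ> (longest_demazure (offset i) (vdim S i) \<circ>
      (\<lambda>f. vandermonde (offset i) (vdim S i) * f)))"
    by (intro realizable_comp realizable_mult polys_Cst polys_vandermonde i)
  then show ?thesis
    by (rule realizable_cong) (simp add: e_block_eq [OF i])
qed

lemma realizable_e_Sigma: "realizable (e_Sigma S)"
proof -
  have "realizable (op_prod (map (e_block S) js))" if "set js \<subseteq> Qplus S" for js
    using that
  proof (induction js)
    case Nil
    show ?case
      using realizable_mult [of 1] by (simp add: id_def)
  next
    case (Cons j js)
    then show ?case
      unfolding list.map op_prod_simps by (intro realizable_comp realizable_e_block) auto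
  qed
  then have "realizable (op_prod (map (e_block S) (sorted_list_of_set (Qplus S))))"
    by simp
  then show ?thesis
    by (rule realizable_cong) (simp add: e_Sigma_def P_space_def)
qed

text \<open>The invariant for induction over the generated algebra. Preservation of
  \<open>P_sym S\<close> is included because composing two extended operators gives the extension of
  the product only if \<open>e_Sigma S\<close> fixes the output of the first.\<close>

definition embeds :: "(pol \<Rightarrow> pol) \<Rightarrow> bool" where
  "embeds A \<longleftrightarrow> (\<forall>f\<in>P_sym S. A f \<in> P_sym S) \<and> realizable (A \<circ> e_Sigma S)"

lemma embedsI:
  assumes "realizable \<phi>" "\<And>f. f \<in> P_sym S \<Longrightarrow> \<phi> f \<in> P_sym S" "\<And>f. f \<in> P_sym S \<Longrightarrow> A f = \<phi> f"
  shows "embeds A"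
proof -
  have "realizable (A \<circ> e_Sigma S)"
    by (rule realizable_cong [OF realizable_comp [OF realizable_e_Sigma assms(1)]])
      (simp add: assms(3) e_Sigma_in_P_sym)
  then show ?thesis
    using assms by (simp add: embeds_def)
qed

lemma embeds_mult: "g \<in> P_sym S \<Longrightarrow> (\<And>f. f \<in> P_sym S \<Longrightarrow> A f = g * f) \<Longrightarrow> embeds A"
  by (rule embedsI [OF realizable_mult]) (auto simp: P_sym_polys P_sym_mult)

lemma embeds_b_coeff:
  assumes "i \<in> verts (quiver S)"
  shows "embeds (b_coeff S i n)"
\<comment> \<open>Loops need a strand to move: without one the series is an empty sum, and in any
  case it has no terms below the exponent 1 of 1/z.\<close>
proof (cases "n < 1 \<or> vdim S i = 0")
  case True
  have "fls_nth (b_series S i f) n = to_fract (0 * f)" for f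
    using True fls_nth_b_series_nonpos [of n i f] by (auto simp: b_series_def)
  then show ?thesis
    by (intro embeds_mult [of 0]) (use P_sym_Cst [of 0] in \<open>simp_all add: b_coeff_def coeff_op_eq\<close>)
next
  case False
  then obtain r where r: "n = int r + 1"
    by (metis add.commute not_less zle_iff_zadd)
  show ?thesis
  proof (rule verts_cases [OF assms])
    assume i: "i \<in> Qplus S"
    obtain \<phi> where \<phi>: "realizes (D_loop S i \<circ> dot_plus (pos_first S i) [:0, -1/2:] ^^ r) (aleph S) \<phi> (aleph S)"
      "\<And>f. f \<in> P_sym S \<Longrightarrow> \<phi> f \<in> P_sym S"
      "\<And>f. f \<in> P_sym S \<Longrightarrow>
        fls_nth (b_series S i f) (int r + 1) = to_fract (Cst [:(-1) powi (int r + eps S i):] * \<phi> f)"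
      by (rule plus_loop [OF i, of r]) (use False in simp, rule that)
    show ?thesis
      by (rule embedsI [OF realizable_comp [of \<phi> "\<lambda>f. Cst [:(-1) powi (int r + eps S i):] * f"]])
        (use \<phi> in \<open>auto simp: realizable_def r b_coeff_def coeff_op_eq intro!: P_sym_mult P_sym_Cst
          realizable_mult [unfolded realizable_def]\<close>)
  next
    fix k assume k: "k \<in> Qplus S" "i = tau S k"
    then have "vdim S i = vdim S k"
      using vdim_tau plus_verts by blast
    then have v: "vdim S k > 0"
      using False by simp
    obtain \<phi> where \<phi>: "realizes (D_loop S (tau S k) \<circ> dot_plus (pos_last S k) [:0, 1/2:] ^^ r) (aleph S) \<phi> (aleph S)"
      "\<And>f. f \<in> P_sym S \<Longrightarrow> \<phi> f \<in> P_sym S"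
      "\<And>f. f \<in> P_sym S \<Longrightarrow> fls_nth (b_series S (tau S k) f) (int r + 1) = to_fract (Cst [:(-1) ^ vdim S k:] * \<phi> f)"
      by (rule minus_loop [OF k(1) v, of r]) (rule that)
    show ?thesis
      by (rule embedsI [OF realizable_comp [of \<phi> "\<lambda>f. Cst [:(-1) ^ vdim S k:] * f"]])
        (use \<phi> in \<open>auto simp: realizable_def r k(2) b_coeff_def coeff_op_eq intro!: P_sym_mult P_sym_Cst
          realizable_mult [unfolded realizable_def]\<close>)
  qed
qed

lemma embeds_h_coeff:
  assumes "i \<in> verts (quiver S)"
  shows "embeds (h_coeff S i n)"
proof -
  obtain g where g: "g \<in> P_sym S" "fls_nth (h_series S i) n = to_fract g"
    by (rule h_series_coeff [OF assms]) (rule that)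
  show ?thesis
  proof (rule embeds_mult [OF g(1)])
    fix f assume f: "f \<in> P_sym S"
    have "fls_nth (h_series S i * emb f) n = to_fract (g * f)"
      unfolding emb_def fls_mult_const_nth g(2) by simp
    then show "h_coeff S i n f = g * f"
      unfolding h_coeff_def by (rule coeff_op_eq [OF f])
  qed
qed

lemma embedsD:
  assumes "embeds A"
  shows "f \<in> P_sym S \<Longrightarrow> A f \<in> P_sym S" "realizable (A \<circ> e_Sigma S)"
  using assms by (simp_all add: embeds_def)

text \<open>Elements of the algebra are prescribed on \<open>P_sym S\<close> only, and there A
  agrees with \<open>A \<circ> e_Sigma S\<close>; all cases are carried out with this realizable
  extension.\<close>

lemma embeds_iYangian: "A \<in> iYangian S \<Longrightarrow> embeds A"
  unfolding iYangian_def
proof (induction rule: gen_algebra.induct)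
  case (gen A)
  have "embeds id"
    by (rule embeds_mult [OF P_sym_Cst [of 1]]) simp
  with gen have A: "embeds A"
    by (auto intro: embeds_b_coeff embeds_h_coeff)
  show ?case
    by (rule embedsI [OF embedsD(2) [OF A]]) (simp_all add: embedsD(1) [OF A] e_Sigma_P_sym)
next
  case zero
  show ?case
    by (rule embeds_mult [OF P_sym_Cst [of 0]]) simp
next
  case (add A B)
  note A = add.IH(1) and B = add.IH(2)
  show ?case
    by (rule embedsI [OF realizable_add [OF embedsD(2) [OF A] embedsD(2) [OF B]]])
      (simp_all add: embedsD(1) [OF A] embedsD(1) [OF B] e_Sigma_P_sym P_sym_add)
next
  case (scale A c)
  note A = scale.IH
  show ?case
    by (rule embedsI [OF realizable_comp [OF embedsD(2) [OF A] realizable_mult [OF polys_Cst [of c]]]])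
      (simp_all add: embedsD(1) [OF A] e_Sigma_P_sym P_sym_mult P_sym_Cst)
next
  case (mult A B)
  note A = mult.IH(1) and B = mult.IH(2)
  show ?case
    by (rule embedsI [OF realizable_comp [OF embedsD(2) [OF B] embedsD(2) [OF A]]])
      (simp_all add: embedsD(1) [OF A] embedsD(1) [OF B] e_Sigma_P_sym)
qed

lemma extend_iYangian: "extend_End S ` iYangian S \<subseteq> KLR_corner S"
proof
  fix E assume "E \<in> extend_End S ` iYangian S"
  then obtain A where A: "A \<in> iYangian S" "E = extend_End S A" by blast
  then obtain B where "realizes B (aleph S) (A \<circ> e_Sigma S) (aleph S)"
    using embeds_iYangian unfolding embeds_def realizable_def by blast
  then have "restrict (A \<circ> e_Sigma S) (P_space S) \<in> KLR_corner S"
    by (rule realizes_corner)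
  then show "E \<in> KLR_corner S"
    by (simp add: A(2) extend_End_def o_def)
qed

lemma extend_b_gen:
  assumes "realizes A (aleph S) \<phi> (aleph S)" "\<And>f. f \<in> P_sym S \<Longrightarrow> fls_nth (b_series S i f) (int r + 1) = to_fract (Cst c * \<phi> f)"
  shows "extend_End S (b_gen S i r) = (\<lambda>f\<in>P_space S. Cst c * on_aleph S A (e_Sigma S f))"
proof -
  have "b_gen S i r (e_Sigma S f) = Cst c * on_aleph S A (e_Sigma S f)" if "f \<in> polys m" for f
    using e_Sigma_in_P_sym [OF that] on_aleph_realizes [OF assms(1)] assms(2)
    by (simp add: b_gen_def b_coeff_def coeff_op_eq P_sym_polys)
  then show ?thesis
    by (simp add: extend_End_def fun_eq_iff restrict_def P_space_def)
qed

end

theorem theorem3p10: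
  fixes S :: "('v::linorder, 'a) iyangian_data"
  assumes "iyangian_datum S"
  shows "extend_End S ` iYangian S \<subseteq> KLR_corner S \<and>
    (\<forall>i\<in>Qplus S. vdim S i > 0 \<longrightarrow>
      (\<forall>r.
        extend_End S (b_gen S i r) =
          (\<lambda>f\<in>P_space S. Cst [:(-1) powi (int r + eps S i):] *
             on_aleph S (D_loop S i \<circ> dot_plus (pos_first S i) [:0, -1/2:] ^^ r) (e_Sigma S f)) \<and>
        extend_End S (b_gen S (tau S i) r) =
          (\<lambda>f\<in>P_space S. Cst [:(-1) ^ vdim S i:] *
             on_aleph S (D_loop S (tau S i) \<circ> dot_plus (pos_last S i) [:0, 1/2:] ^^ r)
               (e_Sigma S f))))"
proof -
  interpret iyangian_datum S
    by (rule assms)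
  have "extend_End S (b_gen S i r) =
          (\<lambda>f\<in>P_space S. Cst [:(-1) powi (int r + eps S i):] *
             on_aleph S (D_loop S i \<circ> dot_plus (pos_first S i) [:0, -1/2:] ^^ r) (e_Sigma S f))"
    if "i \<in> Qplus S" "vdim S i > 0" for i r
    by (rule plus_loop [OF that, of r]) (rule extend_b_gen)
  moreover have "extend_End S (b_gen S (tau S i) r) =
          (\<lambda>f\<in>P_space S. Cst [:(-1) ^ vdim S i:] *
             on_aleph S (D_loop S (tau S i) \<circ> dot_plus (pos_last S i) [:0, 1/2:] ^^ r) (e_Sigma S f))"
    if "i \<in> Qplus S" "vdim S i > 0" for i r
    by (rule minus_loop [OF that, of r]) (rule extend_b_gen)
  ultimately show ?thesis
    using extend_iYangian by blast
qed

end
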